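(* Let $P(X)\in\mathbb Z[X]$ satisfy the standing assumptions in the context, and suppose that $P(X)$ is monic and hyperbolic. Let $$\beta_1=\min\{|\alpha_1|,\dots,|\alpha_p|\},\qquad \beta_2=\min\{|\alpha_{p+1}|^{-1},\dots,|\alpha_d|^{-1}\},\qquad \beta=\min\{\beta_1,\beta_2\}.$$ (1) For every integer $k\ge0$, $1/2$ is an accumulation point of $\mathcal L^{(k)}(P(X))$. (2) Let $k=0$ (so $f=P$). Assume that either $\beta_1=\beta$ and this minimum is attained by $|\alpha_i|$ at a single index $i\in\{1,\dots,p\}$, or $\beta_2=\beta$ and this minimum is attained by $|\alpha_i|^{-1}$ at a single index $i\in\{p+1,\dots,d\}$; and assume that $$\left\lceil\frac{\beta-1}{2}\right\rceil\sum_{n\in\mathbb Z}|\rho^f_n|<\frac12 .$$ Then there exists a sequence of proper intervals $[c_i,d_i]$ contained in $\mathcal L^{(0)}(P(X))$ with $\lim_{i\to\infty}c_i=1/2$. (3) Let $k=0$ (so $f=P$). Assume that $\beta_1$ is attained by $|\alpha_i|$ at a single index $i\in\{1,\dots,p\}$ and that $\beta_2$ is attained by $|\alpha_i|^{-1}$ at a single index $i\in\{p+1,\dots,d\}$. Moreover, suppose that $$\left\lceil\frac{\widetilde\beta-1}{2}\right\rceil\sum_{n\in\mathbb Z}|\rho^f_n|<\frac12,\qquad\text{where }\widetilde\beta=\max\{\beta_1,\beta_2\}.$$ Then there exists $v<1/2$ such that $[v,1/2]\subset\mathcal L^{(0)}(P(X))$.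
   Context: Setting. $P(X)=a_dX^d+\cdots+a_0\in\mathbb Z[X]$ with $d\ge1$, $a_d\ge1$, such that (i) $\gcd(a_d,\dots,a_0)=1$ and $a_0\ne0$; (ii) $P$ has no multiple roots; (iii) every irreducible factor of $P$ in $\mathbb Z[X]$ has at least one root of modulus greater than $1$. The roots of $P$ are $\alpha_1,\dots,\alpha_d$, ordered so that $|\alpha_i|>1$ for $1\le i\le p$ and $|\alpha_i|\le1$ for $p+1\le i\le d$, where $p=r_1+2r_2$, $\alpha_i\in\mathbb R$ for $1\le i\le r_1$, and $\alpha_{r_1+i}\in\mathbb C\setminus\mathbb R$, $\alpha_{r_1+r_2+i}=\overline{\alpha_{r_1+i}}$ for $1\le i\le r_2$. $P$ is called hyperbolic if $|\alpha_i|\ne1$ for every $1\le i\le d$. For an integer $k\ge0$, $\Xi_k$ is the set of $\mathbf g=(g_1,\dots,g_p)\in\mathbb R[X]^{r_1}\times\mathbb C[X]^{2r_2}$ with $\deg g_i\le k$ for all $i$ and $\overline{g_{r_1+i}(X)}=g_{r_1+r_2+i}(X)$ for $1\le i\le r_2$ (the bar conjugates the coefficients). For $\mathbf g\in\Xi_k$ and $n\in\mathbb Z$ put $x_n(\mathbf g)=\sum_{i=1}^p g_i(n)\alpha_i^n\in\mathbb R$. $\|x\|$ denotes the distance from $x\in\mathbb R$ to the nearest integer, and $\mathcal L^{(k)}(P)=\{\limsup_{n\to\infty}\|x_n(\mathbf g)\| : \mathbf g\in\Xi_k\}\subset[0,1/2]$. For $f=P^{k+1}$ and $n\in\mathbb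 Z$, $\rho^f_n=\frac{-1}{2\pi i}\int_{|z|=r}\frac{z^{n-1}}{f(z)}\,dz$, the circle being positively oriented with $1<r<\min_{1\le i\le p}|\alpha_i|$. These are real numbers. $\lceil x\rceil$ is the smallest integer not less than $x$. An interval is proper if it has positive length. If $p=d$, the minimum of the empty set is read as $\beta_2=+\infty$ (and $\beta_2$ is then not attained at any index). *)

theory Defs
  imports "HOL-Complex_Analysis.Complex_Analysis"
begin

abbreviation cpoly :: "int poly \<Rightarrow> complex poly" where
  "cpoly P \<equiv> map_poly of_int P"

definition admissible_poly :: "int poly \<Rightarrow> bool" where
  "admissible_poly P \<longleftrightarrow>
     degree P \<ge> 1 \<and> lead_coeff P \<ge> 1 \<and>
     content P = 1 \<and> coeff P 0 \<noteq> 0 \<and>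
     rsquarefree (cpoly P) \<and>
     (\<forall>Q. irreducible Q \<and> Q dvd P \<longrightarrow> (\<exists>z. poly (cpoly Q) z = 0 \<and> norm z > 1))"

definition hyperbolic_poly :: "int poly \<Rightarrow> bool" where
  "hyperbolic_poly P \<longleftrightarrow> (\<forall>z. poly (cpoly P) z = 0 \<longrightarrow> norm z \<noteq> 1)"

text \<open>
  Indices start at 1. The first \<open>p = r1 + 2 * r2\<close> roots are those outside the closed unit disc:
  \<open>r1\<close> real ones, then one of each pair of complex conjugates, then their conjugates in the same
  order. The values of \<open>\<alpha>\<close> outside \<open>{1..degree P}\<close> are irrelevant.
\<close>

definition root_ordering :: "int poly \<Rightarrow> nat \<Rightarrow> nat \<Rightarrow> (nat \<Rightarrow> complex) \<Rightarrow> bool" where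
  "root_ordering P r1 r2 \<alpha> \<longleftrightarrow>
     cpoly P = smult (of_int (lead_coeff P)) (\<Prod>i = 1..degree P. [:- \<alpha> i, 1:]) \<and>
     r1 + 2 * r2 \<le> degree P \<and>
     (\<forall>i\<in>{1..r1 + 2 * r2}. norm (\<alpha> i) > 1) \<and>
     (\<forall>i\<in>{r1 + 2 * r2 + 1..degree P}. norm (\<alpha> i) \<le> 1) \<and>
     (\<forall>i\<in>{1..r1}. \<alpha> i \<in> \<real>) \<and>
     (\<forall>i\<in>{1..r2}. \<alpha> (r1 + i) \<notin> \<real> \<and> \<alpha> (r1 + r2 + i) = cnj (\<alpha> (r1 + i)))"

text \<open>
  Tuples \<open>(g\<^sub>1, \<dots>, g\<^sub>p)\<close> are functions on \<open>nat\<close> that vanish outside \<open>{1..p}\<close>; a polynomial over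
  the reals is a complex polynomial with real coefficients.
\<close>

definition Xi :: "nat \<Rightarrow> nat \<Rightarrow> nat \<Rightarrow> (nat \<Rightarrow> complex poly) set" where
  "Xi r1 r2 k = {g.
     (\<forall>i. i \<notin> {1..r1 + 2 * r2} \<longrightarrow> g i = 0) \<and>
     (\<forall>i\<in>{1..r1 + 2 * r2}. degree (g i) \<le> k) \<and>
     (\<forall>i\<in>{1..r1}. \<forall>j. coeff (g i) j \<in> \<real>) \<and>
     (\<forall>i\<in>{1..r2}. map_poly cnj (g (r1 + i)) = g (r1 + r2 + i))}"

definition exp_poly_sum :: "nat \<Rightarrow> (nat \<Rightarrow> complex) \<Rightarrow> (nat \<Rightarrow> complex poly) \<Rightarrow> int \<Rightarrow> complex" where
  "exp_poly_sum p \<alpha> g n = (\<Sum>i = 1..p. poly (g i) (of_int n) * \<alpha> i powi n)"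

text \<open>
  The real part in the next definition discards nothing:
  see \<open>exp_poly_sum_real\<close> below.
\<close>

definition x_seq :: "nat \<Rightarrow> (nat \<Rightarrow> complex) \<Rightarrow> (nat \<Rightarrow> complex poly) \<Rightarrow> int \<Rightarrow> real" where
  "x_seq p \<alpha> g n = Re (exp_poly_sum p \<alpha> g n)"

lemma exp_poly_sum_real:
  assumes \<alpha>: "root_ordering P r1 r2 \<alpha>" and g: "g \<in> Xi r1 r2 k"
  shows "exp_poly_sum (r1 + 2 * r2) \<alpha> g n = of_real (x_seq (r1 + 2 * r2) \<alpha> g n)"
proof -
  define t where "t i = poly (g i) (of_int n) * \<alpha> i powi n" for i
  have cnj_powi: "cnj (z powi n) = cnj z powi n" for z
    by (simp add: power_int_def)
  have cnj_poly: "cnj (poly q (of_int n)) = poly (map_poly cnj q) (of_int n)" for q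
    using poly_cnj[of q "of_int n"] by simp
  have real_t: "cnj (t i) = t i" if "i \<in> {1..r1}" for i
  proof -
    have "map_poly cnj (g i) = g i"
      using g that by (intro poly_eqI) (auto simp: Xi_def coeff_map_poly Reals_cnj_iff)
    moreover have "cnj (\<alpha> i) = \<alpha> i"
      using \<alpha> that by (auto simp: root_ordering_def Reals_cnj_iff)
    ultimately show ?thesis
      by (simp add: t_def cnj_powi cnj_poly)
  qed
  have pair_t: "t (r1 + r2 + i) = cnj (t (r1 + i))" if "i \<in> {1..r2}" for i
    using \<alpha> g that by (auto simp: t_def cnj_powi cnj_poly root_ordering_def Xi_def)
  have shift: "(\<Sum>i\<in>{m + 1..m + r2}. t i) = (\<Sum>i = 1..r2. t (m + i))" for m
    using sum.shift_bounds_cl_nat_ivl[of t 1 m r2] by (simp add: add.commute)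
  have "exp_poly_sum (r1 + 2 * r2) \<alpha> g n = sum t {1..r1 + 2 * r2}"
    by (simp add: exp_poly_sum_def t_def)
  also have "{1..r1 + 2 * r2} = {1..r1} \<union> {r1 + 1..r1 + r2} \<union> {r1 + r2 + 1..r1 + r2 + r2}"
    by auto
  also have "sum t \<dots> = sum t {1..r1} + sum t {r1 + 1..r1 + r2} + sum t {r1 + r2 + 1..r1 + r2 + r2}"
    by (subst sum.union_disjoint; (subst sum.union_disjoint)?) auto
  also have "\<dots> = sum t {1..r1} + (\<Sum>i = 1..r2. t (r1 + i) + cnj (t (r1 + i)))"
    unfolding shift by (simp add: sum.distrib pair_t)
  finally have sum_eq: "exp_poly_sum (r1 + 2 * r2) \<alpha> g n =
      sum t {1..r1} + (\<Sum>i = 1..r2. t (r1 + i) + cnj (t (r1 + i)))" .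
  have "cnj (exp_poly_sum (r1 + 2 * r2) \<alpha> g n) = exp_poly_sum (r1 + 2 * r2) \<alpha> g n"
    unfolding sum_eq by (simp add: real_t add.commute)
  thus ?thesis
    by (simp add: x_seq_def complex_eq_iff)
qed

definition dist_nearest_int :: "real \<Rightarrow> real" where
  "dist_nearest_int x = infdist x \<int>"

definition spectrum_L :: "nat \<Rightarrow> nat \<Rightarrow> (nat \<Rightarrow> complex) \<Rightarrow> nat \<Rightarrow> real set" where
  "spectrum_L r1 r2 \<alpha> k =
     {l. \<exists>g\<in>Xi r1 r2 k.
        ereal l = limsup (\<lambda>n. ereal (dist_nearest_int (x_seq (r1 + 2 * r2) \<alpha> g (int n))))}"

text \<open>
  Used for radii \<open>r\<close> between 1 and the least modulus of a root of \<open>f\<close> outside the closed unit disc;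
  the value does not depend on the choice of such an \<open>r\<close>. The values are real, so \<open>norm\<close> of them
  is the absolute value.
\<close>

definition rho :: "int poly \<Rightarrow> real \<Rightarrow> int \<Rightarrow> complex" where
  "rho f r n = - 1 / (2 * of_real pi * \<i>) *
     contour_integral (circlepath 0 r) (\<lambda>z. z powi (n - 1) / poly (cpoly f) z)"

definition beta1 :: "nat \<Rightarrow> (nat \<Rightarrow> complex) \<Rightarrow> real" where
  "beta1 p \<alpha> = Min ((\<lambda>i. norm (\<alpha> i)) ` {1..p})"

definition beta2 :: "nat \<Rightarrow> nat \<Rightarrow> (nat \<Rightarrow> complex) \<Rightarrow> ereal" where
  "beta2 p d \<alpha> =
     (if p = d then \<infinity> else ereal (Min ((\<lambda>i. inverse (norm (\<alpha> i))) ` {p + 1..d})))"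

end

theory Submission
  imports Defs "HOL-Number_Theory.Cong"
begin

text \<open>
  Let \<open>\<rho>\<close> be the two-sided sequence of the Laurent coefficients of \<open>1 / P\<close> on the unit circle, reflected and with the
  opposite sign. It is summable because \<open>P\<close> has no root on the circle. If \<open>s\<close> is a bounded integer sequence that
  vanishes on the negative integers, the convolution of \<open>\<rho>\<close> with \<open>s\<close> agrees modulo 1 with \<open>x\<^sub>n(g)\<close> for suitable constants \<open>g\<close>
  (\<open>realization\<close>): the difference is an integer combination of the numbers
  \<open>h m = (\<Sum>i. \<alpha> i ^ m / P' (\<alpha> i))\<close>, which are integers as \<open>P\<close> is monic. So the spectrum contains the upper
  limits of the distances to the nearest integer of such convolutions.

  Accumulation at 1/2 uses only \<open>h\<close>. For odd \<open>q\<close> coprime to \<open>P 0\<close> the sequence \<open>h\<close> is periodic modulo \<open>q\<close> and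
  takes the value 1, so the distances to the nearest integer of the expanding part of \<open>(q - 1) / 2 * h n / q\<close> have the
  upper limit \<open>(q - 1) / (2 q)\<close> (\<open>odd_fraction_in_spectrum\<close>).

  The two statements about intervals follow from a common one: if \<open>\<beta>\<^sub>1\<close> or \<open>\<beta>\<^sub>2\<close> is attained only once and
  \<open>M\<close> times the norm of \<open>\<rho>\<close> is less than 1/2 for some integer \<open>M \<ge> (\<beta>\<^sub>1 - 1) / 2\<close> or \<open>M \<ge> (\<beta>\<^sub>2 - 1) / 2\<close>, respectively,
  then the spectrum contains an interval \<open>[v, 1/2]\<close> with \<open>v < 1/2\<close>. The following argument is for \<open>\<beta>\<^sub>1\<close>; the other case is
  obtained by reflection. The numbers
  \<open>\<rho> (- j)\<close> behave like a geometric sequence with ratio of modulus \<open>1 / \<beta>\<^sub>1\<close>. As there are \<open>2 M + 1 \<ge> \<beta>\<^sub>1\<close> digits of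
  absolute value at most \<open>M\<close>, a greedy expansion shows that such digits beyond a far position \<open>N\<close> can give the convolution every
  value in an interval around 0 at the position 0 (\<open>tail_hits_strict\<close>, \<open>tail_hits_regular\<close>). With one additional large digit
  the value 1/2 is attained exactly (\<open>conv_attains_half\<close>). Far out the convolution is bounded by \<open>M\<close> times the norm of \<open>\<rho>\<close>, so
  the distance 1/2 occurs at finitely many positions only; let 0 be the leftmost. Changing digits beyond
  \<open>N\<close> moves the value at 0 by a prescribed small \<open>x\<close> in one direction, and the values at the other positions with distance 1/2 by at
  least \<open>x\<close>, since the effect grows with the dominant root (\<open>redigit\<close>). At distance 1/2 every change lowers the distance,
  so the maximal distance becomes \<open>1/2 - x\<close>, for every small \<open>x\<close>. Repeating longer and longer windows of the digit
  sequence at sparse places converts the maximum into an upper limit (\<open>lacunary_limsup\<close>).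

  The borderline \<open>\<beta>\<^sub>1 = 2 M + 1\<close> needs care, because the greedy expansion may fail by an error of lower order. If
  there are contracting roots, digits far to the left make up for the error. If there are none, the norm of \<open>\<rho>\<close>
  is at most the product of the \<open>1 / (\<bar>\<alpha> i\<bar> - 1)\<close>, and this is so small that \<open>M\<close> can be replaced by
  \<open>M + 1\<close> (\<open>extra_digit_affordable\<close>).
\<close>

section \<open>Distance to the nearest integer\<close>

lemma dist_nearest_int_le: "dist_nearest_int x \<le> \<bar>x - of_int k\<bar>"
  unfolding dist_nearest_int_def using infdist_le[of "of_int k" \<int> x] by (simp add: dist_real_def)

lemma dist_nearest_int_attained: "\<exists>k::int. dist_nearest_int x = \<bar>x - of_int k\<bar>"
proof (rule ccontr)
  assume "\<nexists>k::int. dist_nearest_int x = \<bar>x - of_int k\<bar>"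
  hence *: "dist_nearest_int x \<noteq> \<bar>x - of_int k\<bar>" for k :: int
    by blast
  have "\<bar>x - of_int (round x)\<bar> \<le> infdist x \<int>"
    by (subst infdist_notempty)
       (auto intro!: cINF_greatest elim!: Ints_cases simp: dist_real_def round_diff_minimal)
  with dist_nearest_int_le[of x "round x"] *[of "round x"] show False
    by (simp add: dist_nearest_int_def)
qed

lemma dist_nearest_int_le_half: "dist_nearest_int x \<le> 1/2"
  using dist_nearest_int_le[of x "round x"] of_int_round_abs_le[of x] by (simp add: abs_minus_commute)

lemma dist_nearest_int_lipschitz: "dist_nearest_int x \<le> dist_nearest_int y + \<bar>x - y\<bar>"
  using infdist_triangle[of x \<int> y] by (simp add: dist_nearest_int_def dist_real_def)

lemma dist_nearest_int_add_int: "dist_nearest_int (x + of_int k) = dist_nearest_int x"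
proof (rule antisym)
  obtain m where "dist_nearest_int x = \<bar>x - of_int m\<bar>"
    using dist_nearest_int_attained by blast
  thus "dist_nearest_int (x + of_int k) \<le> dist_nearest_int x"
    using dist_nearest_int_le[of "x + of_int k" "m + k"] by simp
  obtain m where "dist_nearest_int (x + of_int k) = \<bar>x + of_int k - of_int m\<bar>"
    using dist_nearest_int_attained by blast
  thus "dist_nearest_int x \<le> dist_nearest_int (x + of_int k)"
    using dist_nearest_int_le[of "x" "m - k"] by (simp add: algebra_simps)
qed

lemma dist_nearest_int_diff_Ints:
  assumes "x - y \<in> \<int>" shows "dist_nearest_int x = dist_nearest_int y"
  using assms dist_nearest_int_add_int[of y] by (auto elim!: Ints_cases simp: algebra_simps)

lemma dist_nearest_int_le_abs: "dist_nearest_int x \<le> \<bar>x\<bar>"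
  using dist_nearest_int_le[of x 0] by simp

text \<open>
  Moving away from a half-integer lowers the distance, whatever the direction. This is what allows the
  value 1/2 itself to be approached from below by perturbations of either sign.
\<close>

lemma dist_nearest_int_half_plus:
  assumes "dist_nearest_int x = 1/2" "\<bar>e\<bar> \<le> 1/2"
  shows "dist_nearest_int (x + e) = 1/2 - \<bar>e\<bar>"
proof -
  obtain m where m: "dist_nearest_int x = \<bar>x - of_int m\<bar>"
    using dist_nearest_int_attained by blast
  obtain k where k: "dist_nearest_int (x + e) = \<bar>x + e - of_int k\<bar>"
    using dist_nearest_int_attained by blast
  from m assms(1) have "x = of_int m + 1/2 \<or> x = of_int m - 1/2"
    by (auto simp: abs_if split: if_splits)
  then obtain m' :: int where m': "x = of_int m' + 1/2"
  proof
    assume "x = of_int m - 1/2"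
    thus ?thesis using that[of "m - 1"] by simp
  qed (use that in blast)
  have "\<bar>x + e - of_int k\<bar> \<ge> 1/2 - \<bar>e\<bar>"
  proof -
    have "k \<le> m' \<or> k \<ge> m' + 1" by linarith
    hence "real_of_int k \<le> m' \<or> real_of_int k \<ge> m' + 1" by linarith
    thus ?thesis using m' by linarith
  qed
  moreover have "dist_nearest_int (x + e) \<le> 1/2 - \<bar>e\<bar>"
  proof (cases "e \<ge> 0")
    case True
    thus ?thesis using dist_nearest_int_le[of "x + e" "m' + 1"] m' assms(2) by simp
  next
    case False
    thus ?thesis using dist_nearest_int_le[of "x + e" "m'"] m' assms(2) by simp
  qed
  ultimately show ?thesis using k by linarith
qed

section \<open>Convolution with a summable kernel\<close>

text \<open>
  The summation runs over the argument of the kernel, so that every estimate is a comparison with the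
  summable sequence \<open>\<bar>\<rho>\<bar>\<close>, uniformly in the position \<open>n\<close>.
\<close>

definition conv :: "(int \<Rightarrow> real) \<Rightarrow> (int \<Rightarrow> int) \<Rightarrow> int \<Rightarrow> real" where
  "conv \<rho> s n = (\<Sum>\<^sub>\<infinity>m. \<rho> m * of_int (s (n - m)))"

lemma summable_on_mult_bounded:
  fixes f :: "'a \<Rightarrow> real" and c :: "'a \<Rightarrow> int"
  assumes "(\<lambda>m. \<bar>f m\<bar>) summable_on A" "\<And>m. m \<in> A \<Longrightarrow> \<bar>real_of_int (c m)\<bar> \<le> B"
  shows "(\<lambda>m. f m * of_int (c m)) summable_on A"
proof -
  have "(\<lambda>m. B * \<bar>f m\<bar>) summable_on A"
    by (intro summable_on_cmult_right assms)
  hence "(\<lambda>m. \<bar>f m * of_int (c m)\<bar>) summable_on A"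
  proof (rule summable_on_comparison_test)
    fix m assume "m \<in> A"
    thus "\<bar>f m * of_int (c m)\<bar> \<le> B * \<bar>f m\<bar>"
      using mult_left_mono[OF assms(2)[of m], of "\<bar>f m\<bar>"] by (simp add: abs_mult mult.commute)
  qed auto
  hence "(\<lambda>m. norm (f m * of_int (c m))) summable_on A" by simp
  thus ?thesis by (rule abs_summable_summable)
qed

text \<open>
  The only estimate for convolutions that is needed: the integer weights are bounded by \<open>M\<close> except on a
  set \<open>X\<close> that carries little mass, where they may exceed \<open>M\<close> by \<open>B\<close>. With \<open>M = 0\<close> it
  compares two digit sequences that agree off \<open>X\<close>.
\<close>

lemma infsum_mult_bounded_le:
  fixes f :: "'a \<Rightarrow> real" and c :: "'a \<Rightarrow> int"
  assumes f: "(\<lambda>m. \<bar>f m\<bar>) summable_on UNIV" and M: "0 \<le> M" and B: "0 \<le> B"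
    and out: "\<And>m. m \<notin> X \<Longrightarrow> \<bar>real_of_int (c m)\<bar> \<le> M"
    and inn: "\<And>m. m \<in> X \<Longrightarrow> \<bar>real_of_int (c m)\<bar> \<le> M + B"
  shows "\<bar>\<Sum>\<^sub>\<infinity>m. f m * of_int (c m)\<bar> \<le> M * (\<Sum>\<^sub>\<infinity>m. \<bar>f m\<bar>) + B * (\<Sum>\<^sub>\<infinity>m\<in>X. \<bar>f m\<bar>)"
proof -
  have c: "\<bar>real_of_int (c m)\<bar> \<le> M + B" for m
    using out[of m] inn[of m] B by (cases "m \<in> X") auto
  have s1: "(\<lambda>m. f m * of_int (c m)) summable_on UNIV"
    by (rule summable_on_mult_bounded[OF f]) (use c in auto)
  have fX: "(\<lambda>m. \<bar>f m\<bar>) summable_on X"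
    using f by (rule summable_on_subset) auto
  have s2: "(\<lambda>m. \<bar>f m\<bar> * indicator X m) summable_on UNIV"
  proof -
    have "(\<lambda>m. \<bar>f m\<bar> * indicator X m) summable_on UNIV \<longleftrightarrow> (\<lambda>m. \<bar>f m\<bar>) summable_on X"
      by (rule summable_on_cong_neutral) (auto simp: indicator_def)
    thus ?thesis using fX by blast
  qed
  have e2: "(\<Sum>\<^sub>\<infinity>m. \<bar>f m\<bar> * indicator X m) = (\<Sum>\<^sub>\<infinity>m\<in>X. \<bar>f m\<bar>)"
    by (rule infsum_cong_neutral) (auto simp: indicator_def)
  have s3: "(\<lambda>m. M * \<bar>f m\<bar> + B * (\<bar>f m\<bar> * indicator X m)) summable_on UNIV"
    by (intro summable_on_add summable_on_cmult_right f s2)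
  have "\<bar>\<Sum>\<^sub>\<infinity>m. f m * of_int (c m)\<bar> \<le> (\<Sum>\<^sub>\<infinity>m. M * \<bar>f m\<bar> + B * (\<bar>f m\<bar> * indicator X m))"
  proof -
    have "norm (\<Sum>\<^sub>\<infinity>m. f m * of_int (c m)) \<le> (\<Sum>\<^sub>\<infinity>m. norm (f m * of_int (c m)))"
      using s1 by (intro norm_infsum_bound) (rule summable_on_iff_abs_summable_on_real[THEN iffD1])
    also have "\<dots> \<le> (\<Sum>\<^sub>\<infinity>m. M * \<bar>f m\<bar> + B * (\<bar>f m\<bar> * indicator X m))"
    proof (rule infsum_mono[OF _ s3])
      show "(\<lambda>m. norm (f m * of_int (c m))) summable_on UNIV"
        using s1 by (rule summable_on_iff_abs_summable_on_real[THEN iffD1])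
      fix m
      show "norm (f m * of_int (c m)) \<le> M * \<bar>f m\<bar> + B * (\<bar>f m\<bar> * indicator X m)"
      proof (cases "m \<in> X")
        case True
        thus ?thesis using mult_left_mono[OF inn[of m], of "\<bar>f m\<bar>"]
          by (simp add: abs_mult algebra_simps)
      next
        case False
        thus ?thesis using mult_left_mono[OF out[of m], of "\<bar>f m\<bar>"]
          by (simp add: abs_mult algebra_simps)
      qed
    qed
    finally show ?thesis by simp
  qed
  also have "\<dots> = M * (\<Sum>\<^sub>\<infinity>m. \<bar>f m\<bar>) + B * (\<Sum>\<^sub>\<infinity>m\<in>X. \<bar>f m\<bar>)"
    by (subst infsum_add) (auto intro!: summable_on_cmult_right f s2 simp: infsum_cmult_right' e2)
  finally show ?thesis .
qed

lemma infsum_int_tail_small: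
  fixes f :: "int \<Rightarrow> real"
  assumes f: "(\<lambda>m. \<bar>f m\<bar>) summable_on UNIV" and "\<epsilon> > 0"
  obtains L :: int where "L \<ge> 0" "(\<Sum>\<^sub>\<infinity>m\<in>{m. \<bar>m\<bar> > L}. \<bar>f m\<bar>) < \<epsilon>"
proof -
  obtain F where F: "finite F" "dist (sum (\<lambda>m. \<bar>f m\<bar>) F) (\<Sum>\<^sub>\<infinity>m. \<bar>f m\<bar>) \<le> \<epsilon>/2"
    using infsum_finite_approximation[OF f, of "\<epsilon>/2"] \<open>\<epsilon> > 0\<close> by auto
  define L where "L = Max (insert 0 (abs ` F))"
  have L: "\<bar>m\<bar> \<le> L" if "m \<in> F" for m
    unfolding L_def using F(1) that by (intro Max_ge) auto
  have "L \<ge> 0" unfolding L_def using F(1) by (intro Max_ge) auto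
  have sub: "(\<lambda>m. \<bar>f m\<bar>) summable_on X" for X
    using f by (rule summable_on_subset) auto
  have "(\<Sum>\<^sub>\<infinity>m\<in>{m. \<bar>m\<bar> > L}. \<bar>f m\<bar>) \<le> (\<Sum>\<^sub>\<infinity>m\<in>-F. \<bar>f m\<bar>)"
    by (rule infsum_mono2) (use L sub in \<open>force+\<close>)
  also have "(\<Sum>\<^sub>\<infinity>m\<in>F \<union> -F. \<bar>f m\<bar>) = (\<Sum>\<^sub>\<infinity>m\<in>F. \<bar>f m\<bar>) + (\<Sum>\<^sub>\<infinity>m\<in>-F. \<bar>f m\<bar>)"
    by (intro infsum_Un_disjoint sub) auto
  hence "(\<Sum>\<^sub>\<infinity>m\<in>-F. \<bar>f m\<bar>) = (\<Sum>\<^sub>\<infinity>m. \<bar>f m\<bar>) - sum (\<lambda>m. \<bar>f m\<bar>) F"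
    using F(1) by (simp add: Compl_partition)
  also have "\<dots> < \<epsilon>" using F(2) \<open>\<epsilon> > 0\<close> by (simp add: dist_real_def abs_if split: if_splits)
  finally show ?thesis using that \<open>L \<ge> 0\<close> by blast
qed

lemma conv_shift: "conv \<rho> (\<lambda>j. s (j + c)) n = conv \<rho> s (n + c)"
  by (simp add: conv_def algebra_simps)

lemma conv_reflect: "conv (\<lambda>m. \<rho> (-m)) (\<lambda>j. s (-j)) n = conv \<rho> s (-n)"
  unfolding conv_def
  by (rule infsum_reindex_bij_witness[of _ uminus uminus]) auto

lemma conv_diff:
  assumes "(\<lambda>m. \<bar>\<rho> m\<bar>) summable_on UNIV" "\<And>j. \<bar>s j\<bar> \<le> B" "\<And>j. \<bar>s' j\<bar> \<le> B'"
  shows "conv \<rho> s n - conv \<rho> s' n' = (\<Sum>\<^sub>\<infinity>m. \<rho> m * of_int (s (n - m) - s' (n' - m)))"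
proof -
  have 1: "(\<lambda>m. \<rho> m * of_int (s (n - m))) summable_on UNIV"
    by (rule summable_on_mult_bounded[OF assms(1), of _ B]) (simp add: assms(2) flip: of_int_abs)
  have 2: "(\<lambda>m. - (\<rho> m * of_int (s' (n' - m)))) summable_on UNIV"
    unfolding summable_on_uminus
    by (rule summable_on_mult_bounded[OF assms(1), of _ B'])
       (simp add: assms(3) flip: of_int_abs)
  have "conv \<rho> s n - conv \<rho> s' n' = 
     (\<Sum>\<^sub>\<infinity>m. \<rho> m * of_int (s (n - m)) + - (\<rho> m * of_int (s' (n' - m))))"
    using infsum_add[OF 1 2] unfolding conv_def by (simp add: infsum_uminus)
  thus ?thesis by (simp add: algebra_simps)
qed

section \<open>Digit expansions in the tail of a kernel\<close>

text \<open>
  One step of a greedy expansion: as long as the weight \<open>a\<close> is at most twice the reach \<open>R\<close> of the remaining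
  weights, the translates of \<open>[-R, R]\<close> by the multiples \<open>a s\<close> with \<open>\<bar>s\<bar> \<le> M\<close> overlap and
  cover \<open>[- M \<bar>a\<bar> - R, M \<bar>a\<bar> + R]\<close>. The digit is the nearest integer to \<open>v / a\<close>, cut off at \<open>M\<close>.
\<close>

lemma digit_step:
  fixes v a R :: real and M :: nat
  assumes "\<bar>v\<bar> \<le> real M * \<bar>a\<bar> + R" "\<bar>a\<bar> \<le> 2 * R"
  obtains s :: int where "\<bar>s\<bar> \<le> int M" "\<bar>v - a * real_of_int s\<bar> \<le> R"
proof (cases "a = 0")
  case True
  thus ?thesis using that[of 0] assms by simp
next
  case False
  define s where "s = max (- int M) (min (int M) (round (v / a)))"
  have s: "\<bar>s\<bar> \<le> int M" by (auto simp: s_def)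
  define y where "y = v / a"
  have v: "v = a * y" using False by (simp add: y_def)
  have "\<bar>y - s\<bar> \<le> max (1/2) (\<bar>y\<bar> - M)"
  proof -
    consider "\<bar>round y\<bar> \<le> int M" | "round y > int M" | "round y < - int M" by linarith
    thus ?thesis
    proof cases
      case 1
      hence "s = round y" by (auto simp: s_def y_def)
      thus ?thesis using of_int_round_abs_le[of y]
        by (simp add: abs_minus_commute[of y] le_max_iff_disj)
    next
      case 2
      hence "s = int M" by (auto simp: s_def y_def)
      moreover have "y \<ge> M" using 2 of_int_round_le[of y] by linarith
      ultimately show ?thesis by (auto simp: max_def)
    next
      case 3
      hence "s = - int M" by (auto simp: s_def y_def)
      moreover have "y \<le> - M" using 3 of_int_round_ge[of y] by linarith
      ultimately show ?thesis by (auto simp: max_def)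
    qed
  qed
  hence "\<bar>a\<bar> * \<bar>y - s\<bar> \<le> \<bar>a\<bar> * max (1/2) (\<bar>y\<bar> - M)"
    by (intro mult_left_mono) auto
  also have "\<dots> \<le> R" using assms by (auto simp: max_def v abs_mult algebra_simps)
  finally have "\<bar>v - a * s\<bar> \<le> R" by (simp add: v abs_mult flip: right_diff_distrib)
  thus ?thesis using that s by blast
qed

text \<open>
  Kakeya's criterion for sums over digits of absolute value at most \<open>M\<close>. The weights come in two interleaved
  sequences \<open>a\<close> and \<open>e\<close>, ordered as \<open>a 0, e 0, a 1, e 1, \<dots>\<close>; each weight has to be
  at most \<open>2 M\<close> times the sum of all later ones. The second sequence, which may vanish at many places, fills
  the gaps that \<open>a\<close> alone would leave in the borderline case.
\<close>

lemma digit_expansion: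
  fixes a e A E :: "nat \<Rightarrow> real" and M :: nat and v :: real
  assumes A_def: "\<And>i. A i = (\<Sum>j. \<bar>a (i + j)\<bar>)" and E_def: "\<And>i. E i = (\<Sum>j. \<bar>e (i + j)\<bar>)"
  assumes sa: "summable (\<lambda>i. \<bar>a i\<bar>)" and se: "summable (\<lambda>i. \<bar>e i\<bar>)"
    and a: "\<And>i. \<bar>a i\<bar> \<le> 2 * real M * (A (Suc i) + E i)"
    and e: "\<And>i. \<bar>e i\<bar> \<le> 2 * real M * (A (Suc i) + E (Suc i))"
    and v: "\<bar>v\<bar> \<le> real M * (A 0 + E 0)"
  obtains s u :: "nat \<Rightarrow> int" where "\<And>i. \<bar>s i\<bar> \<le> int M" "\<And>i. \<bar>u i\<bar> \<le> int M"
    "(\<lambda>i. a i * real_of_int (s i) + e i * real_of_int (u i)) sums v"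
proof -
  have A_Suc: "A i = \<bar>a i\<bar> + A (Suc i)" for i
    using suminf_split_head[of "\<lambda>j. \<bar>a (i + j)\<bar>"] summable_ignore_initial_segment[OF sa, of i]
    by (simp add: A_def add.commute)
  have E_Suc: "E i = \<bar>e i\<bar> + E (Suc i)" for i
    using suminf_split_head[of "\<lambda>j. \<bar>e (i + j)\<bar>"] summable_ignore_initial_segment[OF se, of i]
    by (simp add: E_def add.commute)
  have "\<exists>w. \<forall>n. \<bar>w n\<bar> \<le> M * (A n + E n) \<and> (n = 0 \<longrightarrow> w n = v) \<and>
    (\<exists>s u::int. \<bar>s\<bar> \<le> int M \<and> \<bar>u\<bar> \<le> int M \<and> w (Suc n) = w n - a n * s - e n * u)"
    (is "\<exists>w. \<forall>n. ?P n (w n) \<and> _ \<and> ?Q n (w n) (w (Suc n))")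
  proof -
    have "\<exists>w. \<forall>n. (?P n (w n) \<and> (n = 0 \<longrightarrow> w n = v)) \<and> ?Q n (w n) (w (Suc n))"
    proof (rule dependent_nat_choice)
      show "\<exists>x. ?P 0 x \<and> (0 = (0::nat) \<longrightarrow> x = v)" using v by auto
      fix x n assume "?P n x \<and> (n = 0 \<longrightarrow> x = v)"
      hence "\<bar>x\<bar> \<le> M * \<bar>a n\<bar> + M * (A (Suc n) + E n)"
        by (simp add: A_Suc[of n] algebra_simps)
      then obtain s where s: "\<bar>s\<bar> \<le> int M" "\<bar>x - a n * s\<bar> \<le> M * (A (Suc n) + E n)"
        by (rule digit_step) (use a[of n] in \<open>simp_all add: mult.assoc\<close>)
      hence "\<bar>x - a n * s\<bar> \<le> M * \<bar>e n\<bar> + M * (A (Suc n) + E (Suc n))"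
        by (simp add: E_Suc[of n] algebra_simps)
      then obtain u where "\<bar>u\<bar> \<le> int M" "\<bar>x - a n * s - e n * u\<bar> \<le> M * (A (Suc n) + E (Suc n))"
        by (rule digit_step) (use e[of n] in \<open>simp_all add: mult.assoc\<close>)
      thus "\<exists>y. (?P (Suc n) y \<and> (Suc n = 0 \<longrightarrow> y = v)) \<and> ?Q n x y"
        using s by blast
    qed
    thus ?thesis by blast
  qed
  then obtain w where w: "\<And>n. \<bar>w n\<bar> \<le> M * (A n + E n)" "w 0 = v"
    "\<And>n. \<exists>s u::int. \<bar>s\<bar> \<le> int M \<and> \<bar>u\<bar> \<le> int M \<and> w (Suc n) = w n - a n * s - e n * u"
    by blast
  from w(3) obtain s u :: "nat \<Rightarrow> int" where su: "\<And>n. \<bar>s n\<bar> \<le> int M" "\<And>n. \<bar>u n\<bar> \<le> int M"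
     "\<And>n. w (Suc n) = w n - a n * s n - e n * u n"
    by metis
  have "(\<Sum>i<n. a i * s i + e i * u i) = v - w n" for n
    by (induction n) (auto simp: w(2) su(3))
  moreover have "(\<lambda>n. v - w n) \<longlonglongrightarrow> v"
  proof -
    have "(\<lambda>n. M * (A n + E n)) \<longlonglongrightarrow> real M * (0 + 0)"
      unfolding A_def E_def
      using suminf_exist_split2[OF sa] suminf_exist_split2[OF se]
      by (intro tendsto_intros) (simp_all add: add.commute)
    hence "w \<longlonglongrightarrow> 0"
      using w(1) by (intro Lim_null_comparison[of w "\<lambda>n. M * (A n + E n)"]) auto
    from tendsto_diff[OF tendsto_const[of v] this] show ?thesis by simp
  qed
  ultimately have "(\<lambda>i. a i * s i + e i * u i) sums v"
    by (simp add: sums_def)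
  thus ?thesis using that su by blast
qed

lemma summable_on_int_imp_summable:
  fixes f :: "int \<Rightarrow> real" and g :: "nat \<Rightarrow> int"
  assumes "(\<lambda>m. \<bar>f m\<bar>) summable_on UNIV" "inj g"
  shows "summable (\<lambda>i. \<bar>f (g i)\<bar>)"
proof -
  have "(\<lambda>m. \<bar>f m\<bar>) summable_on range g"
    using assms(1) by (rule summable_on_subset) auto
  hence "(\<lambda>i. \<bar>f (g i)\<bar>) summable_on UNIV"
    using summable_on_reindex[OF assms(2), of "\<lambda>m. \<bar>f m\<bar>"] by (simp add: o_def)
  thus ?thesis by (rule summable_on_imp_summable)
qed

text \<open>
  A digit at position \<open>j\<close> contributes \<open>\<rho> (- j)\<close> to the value of the convolution at 0, so this is the influence
  on that value of all positions beyond \<open>N\<close>.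
\<close>

definition right_mass :: "(int \<Rightarrow> real) \<Rightarrow> nat \<Rightarrow> real" where
  "right_mass \<rho> N = (\<Sum>i. \<bar>\<rho> (- int (Suc (N + i)))\<bar>)"

text \<open>
  The values \<open>\<bar>\<rho> l\<bar>\<close> with \<open>l\<close> large come close to every small scale \<open>x\<close>, up to the fixed factor \<open>r\<close>,
  at a place \<open>l\<close> after which nothing exceeds \<open>x\<close>. Digits at the positions \<open>-l\<close> can then correct errors of any
  prescribed order without disturbing larger scales.
\<close>

definition left_regular :: "(int \<Rightarrow> real) \<Rightarrow> bool" where
  "left_regular \<rho> \<longleftrightarrow> (\<exists>r>0. \<forall>K::int. \<exists>x0>0. \<forall>x. 0 < x \<and> x \<le> x0 \<longrightarrow>
     (\<exists>l>K. r * x \<le> \<bar>\<rho> l\<bar> \<and> (\<forall>i\<ge>l. \<bar>\<rho> i\<bar> \<le> x)))"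

text \<open>
  A linear recurrence that bounds \<open>\<bar>\<rho> l\<bar>\<close> by its \<open>D\<close> successors prevents the sequence from dropping abruptly:
  just after the last place where \<open>x\<close> is exceeded, one of \<open>D\<close> consecutive values is still of order \<open>x\<close>. The same
  recurrence propagates a zero tail to the left, so one nonzero value gives infinitely many.
\<close>

lemma left_regularI:
  fixes \<rho> :: "int \<Rightarrow> real" and l0 :: int and D :: nat and C :: real
  assumes sum: "(\<lambda>m. \<bar>\<rho> m\<bar>) summable_on UNIV"
    and rec: "\<And>l. l \<ge> l0 \<Longrightarrow> \<bar>\<rho> l\<bar> \<le> C * (\<Sum>i=1..D. \<bar>\<rho> (l + int i)\<bar>)"
    and nz: "\<exists>i\<ge>l0. \<rho> i \<noteq> 0"
  shows "left_regular \<rho>"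
proof -
  have small: "\<exists>n. \<forall>i\<ge>n. \<bar>\<rho> i\<bar> \<le> x" if "x > 0" for x
  proof -
    obtain L where L: "L \<ge> 0" "(\<Sum>\<^sub>\<infinity>m\<in>{m. \<bar>m\<bar> > L}. \<bar>\<rho> m\<bar>) < x"
      using infsum_int_tail_small[OF sum \<open>x > 0\<close>] by blast
    have "\<bar>\<rho> i\<bar> \<le> x" if "i \<ge> L + 1" for i
    proof -
      have "sum (\<lambda>m. \<bar>\<rho> m\<bar>) {i} \<le> (\<Sum>\<^sub>\<infinity>m\<in>{m. \<bar>m\<bar> > L}. \<bar>\<rho> m\<bar>)"
        by (rule finite_sum_le_infsum) (use that L(1) in \<open>auto intro!: summable_on_subset[OF sum]\<close>)
      thus ?thesis using L by simp
    qed
    thus ?thesis by blast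
  qed
  have nzK: "\<exists>i>K. i \<ge> l0 \<and> \<rho> i \<noteq> 0" for K
  proof (rule ccontr)
    assume "\<not> ?thesis"
    hence z: "\<rho> i = 0" if "i > K" "i \<ge> l0" for i using that by blast
    have zn: "\<forall>i\<ge>l0. i > K - int n \<longrightarrow> \<rho> i = 0" for n
    proof (induction n)
      case 0 thus ?case using z by auto
    next
      case (Suc n)
      have "\<rho> i = 0" if i: "i \<ge> l0" "i = K - int n" for i
      proof -
        have "(\<Sum>k=1..D. \<bar>\<rho> (i + int k)\<bar>) = 0"
          by (rule sum.neutral) (use Suc i in auto)
        thus ?thesis using rec[OF i(1)] by simp
      qed
      moreover have "i > K - int n \<or> i = K - int n" if "i > K - int (Suc n)" for i
        using that by linarith
      ultimately show ?case using Suc by blast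
    qed
    obtain i where "i \<ge> l0" "\<rho> i \<noteq> 0" using nz by blast
    thus False using zn[of "nat (K - i + 1)"] by auto
  qed
  define C' where "C' = max C 1"
  define r where "r = 1 / (C' * (real D + 1))"
  have "C' \<ge> 1" "C \<le> C'" by (auto simp: C'_def)
  hence "r > 0" by (simp add: r_def)
  have "\<exists>x0>0. \<forall>x. 0 < x \<and> x \<le> x0 \<longrightarrow> (\<exists>l>K. r * x \<le> \<bar>\<rho> l\<bar> \<and> (\<forall>i\<ge>l. \<bar>\<rho> i\<bar> \<le> x))" for K
  proof -
    define K' where "K' = max K l0"
    obtain i0 where i0: "i0 > K' + 1" "\<rho> i0 \<noteq> 0" using nzK[of "K' + 1"] by auto
    have "\<exists>l>K. r * x \<le> \<bar>\<rho> l\<bar> \<and> (\<forall>i\<ge>l. \<bar>\<rho> i\<bar> \<le> x)" if x: "0 < x" "x \<le> \<bar>\<rho> i0\<bar> / 2" for x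
    proof -
      define Q where "Q = (\<lambda>n::nat. \<forall>i\<ge>K' + int n. \<bar>\<rho> i\<bar> \<le> x)"
      have "\<exists>n. Q n"
      proof -
        obtain n where "\<forall>i\<ge>n. \<bar>\<rho> i\<bar> \<le> x" using small[OF x(1)] by blast
        hence "Q (nat (n - K'))" by (auto simp: Q_def)
        thus ?thesis ..
      qed
      define n where "n = (LEAST n. Q n)"
      have Qn: "Q n" unfolding n_def using \<open>\<exists>n. Q n\<close> by (rule LeastI_ex)
      have "\<not> Q 1" using i0 x by (auto simp: Q_def intro!: exI[of _ i0])
      moreover have "Q 0 \<Longrightarrow> Q 1" by (auto simp: Q_def)
      ultimately have "\<not> Q 0" by blast
      hence "n \<noteq> 0" using Qn by metis
      then obtain m where m: "n = Suc m" by (cases n) auto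
      have "\<not> Q m" using not_less_Least[of m Q] by (simp add: m flip: n_def)
      then obtain i where i: "i \<ge> K' + int m" "\<bar>\<rho> i\<bar> > x" by (auto simp: Q_def not_le)
      have "i = K' + int m"
      proof (rule ccontr)
        assume "i \<noteq> K' + int m"
        hence "i \<ge> K' + int n" using i(1) m by simp
        thus False using Qn i(2) by (force simp: Q_def)
      qed
      with i have big: "\<bar>\<rho> (K' + int m)\<bar> > x" by simp
      have "x < C * (\<Sum>i=1..D. \<bar>\<rho> (K' + int m + int i)\<bar>)"
      proof -
        have "K' + int m \<ge> l0" by (simp add: K'_def)
        from rec[OF this] big show ?thesis by linarith
      qed
      also have "\<dots> \<le> C' * (\<Sum>i=1..D. \<bar>\<rho> (K' + int m + int i)\<bar>)"
        by (intro mult_right_mono \<open>C \<le> C'\<close> sum_nonneg) auto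
      finally have lt: "x < C' * (\<Sum>i=1..D. \<bar>\<rho> (K' + int m + int i)\<bar>)" .
      have "\<exists>k\<in>{1..D}. r * x \<le> \<bar>\<rho> (K' + int m + int k)\<bar>"
      proof (rule ccontr)
        assume "\<not> ?thesis"
        hence "(\<Sum>i=1..D. \<bar>\<rho> (K' + int m + int i)\<bar>) \<le> (\<Sum>i=1..D. r * x)"
          by (intro sum_mono less_imp_le) (auto simp: not_le)
        hence "(\<Sum>i=1..D. \<bar>\<rho> (K' + int m + int i)\<bar>) \<le> D * (r * x)" by simp
        from lt mult_left_mono[OF this, of C'] \<open>C' \<ge> 1\<close> have "x < C' * (D * (r * x))" by linarith
        also have "C' * (D * (r * x)) = (C' * r) * (D * x)" by simp
        also have "C' * r = 1 / (real D + 1)" using \<open>C' \<ge> 1\<close> by (simp add: r_def)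
        also have "1 / (real D + 1) * (D * x) = (D / (D + 1)) * x" by simp
        also have "\<dots> \<le> 1 * x" by (intro mult_right_mono) (use x in auto)
        finally show False by simp
      qed
      then obtain k where k: "k \<in> {1..D}" "r * x \<le> \<bar>\<rho> (K' + int m + int k)\<bar>" by blast
      show ?thesis
        by (rule exI[of _ "K' + int m + int k"]) (use k Qn m in \<open>auto simp: Q_def K'_def\<close>)
    qed
    moreover have "\<bar>\<rho> i0\<bar> / 2 > 0" using i0 by simp
    ultimately show ?thesis by blast
  qed
  thus ?thesis using \<open>r > 0\<close> unfolding left_regular_def by blast
qed

lemma right_mass_Suc:
  assumes "(\<lambda>m. \<bar>\<rho> m\<bar>) summable_on UNIV"
  shows "right_mass \<rho> N = \<bar>\<rho> (- int (Suc N))\<bar> + right_mass \<rho> (Suc N)"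
proof -
  have "summable (\<lambda>i. \<bar>\<rho> (- int (Suc (N + i)))\<bar>)"
    by (rule summable_on_int_imp_summable[OF assms]) (auto simp: inj_def)
  from suminf_split_head[OF this] show ?thesis by (simp add: right_mass_def)
qed

text \<open>
  For a kernel with asymptotic ratio \<open>\<theta>\<close> the masses behave like those of a geometric series: consecutive
  masses have ratio about \<open>\<bar>\<theta>\<bar>\<close>, and \<open>\<bar>\<rho> (- j)\<bar>\<close> is about \<open>(1 - \<bar>\<theta>\<bar>) / \<bar>\<theta>\<bar>\<close> times the mass beyond \<open>j\<close>.
\<close>

lemma right_mass_ratio:
  fixes \<rho> :: "int \<Rightarrow> real"
  assumes sum: "(\<lambda>m. \<bar>\<rho> m\<bar>) summable_on UNIV"
    and ratio: "(\<lambda>j. \<rho> (- int (Suc j)) / \<rho> (- int j)) \<longlonglongrightarrow> \<theta>" and \<theta>: "0 < \<bar>\<theta>\<bar>"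
  shows right_mass_pos: "\<And>N. right_mass \<rho> N > 0"
    and right_mass_ratio_lower: "\<And>c. c < \<bar>\<theta>\<bar> \<Longrightarrow> \<forall>\<^sub>F j in sequentially. c * right_mass \<rho> j \<le> right_mass \<rho> (Suc j)"
    and right_mass_ratio_upper: "\<And>c. \<bar>\<theta>\<bar> < c \<Longrightarrow> \<forall>\<^sub>F j in sequentially. right_mass \<rho> (Suc j) \<le> c * right_mass \<rho> j"
    and right_mass_dominates: "\<And>q M. 0 \<le> q \<Longrightarrow> 0 \<le> M \<Longrightarrow> \<bar>\<theta>\<bar> < 1 \<Longrightarrow> q * (1 - \<bar>\<theta>\<bar>) < M * \<bar>\<theta>\<bar> \<Longrightarrow>
       \<forall>\<^sub>F j in sequentially. q * \<bar>\<rho> (- int j)\<bar> \<le> M * right_mass \<rho> j"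
    and ratio_eventually_nonzero: "\<forall>\<^sub>F j in sequentially. \<rho> (- int j) \<noteq> 0"
proof -
  define a where "a = (\<lambda>j. \<bar>\<rho> (- int j)\<bar>)"
  have a0: "a j \<ge> 0" for j by (simp add: a_def)
  have V: "right_mass \<rho> N = (\<Sum>i. a (Suc (N + i)))" for N by (simp add: right_mass_def a_def)
  have sa: "summable (\<lambda>i. a (N + i))" for N
    unfolding a_def by (rule summable_on_int_imp_summable[OF sum]) (auto simp: inj_def)
  have sa': "summable (\<lambda>i. a (Suc (N + i)))" for N
    using sa[of "Suc N"] by simp
  have lim: "(\<lambda>j. a (Suc j) / a j) \<longlonglongrightarrow> \<bar>\<theta>\<bar>"
    using tendsto_rabs[OF ratio] by (simp add: a_def abs_divide)
  have nz: "\<forall>\<^sub>F j in sequentially. a j > 0"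
  proof -
    have "\<forall>\<^sub>F j in sequentially. a (Suc j) / a j > 0"
      using order_tendstoD(1)[OF lim, of 0] \<theta> by simp
    thus ?thesis
    proof eventually_elim
      case (elim j)
      thus ?case using a0[of j] by (cases "a j = 0") auto
    qed
  qed
  thus "\<forall>\<^sub>F j in sequentially. \<rho> (- int j) \<noteq> 0" by (simp add: a_def)
  show pos: "right_mass \<rho> N > 0" for N
  proof -
    obtain j0 where j0: "\<And>j. j \<ge> j0 \<Longrightarrow> a j > 0" using nz by (auto simp: eventually_sequentially)
    have "a (Suc (N + j0)) > 0" by (rule j0) auto
    thus ?thesis unfolding V using a0 by (intro suminf_pos2[OF sa'[of N], of j0]) auto
  qed
  show lower: "\<forall>\<^sub>F j in sequentially. c * right_mass \<rho> j \<le> right_mass \<rho> (Suc j)" if "c < \<bar>\<theta>\<bar>" for c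
  proof -
    have "\<forall>\<^sub>F j in sequentially. c < a (Suc j) / a j" using order_tendstoD(1)[OF lim that] .
    with nz have "\<forall>\<^sub>F j in sequentially. c * a j \<le> a (Suc j)"
      by eventually_elim (simp add: field_simps)
    then obtain j0 where j0: "\<And>j. j \<ge> j0 \<Longrightarrow> c * a j \<le> a (Suc j)" by (auto simp: eventually_sequentially)
    have "c * right_mass \<rho> j \<le> right_mass \<rho> (Suc j)" if "j \<ge> j0" for j
      unfolding V suminf_mult[OF sa', symmetric]
      using suminf_le[OF _ summable_mult[OF sa'[of j], of c] sa'[of "Suc j"]] j0 that by simp
    thus ?thesis by (auto simp: eventually_sequentially)
  qed
  show upper: "\<forall>\<^sub>F j in sequentially. right_mass \<rho> (Suc j) \<le> c * right_mass \<rho> j" if "\<bar>\<theta>\<bar> < c" for c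
  proof -
    have "\<forall>\<^sub>F j in sequentially. a (Suc j) / a j < c" using order_tendstoD(2)[OF lim that] .
    with nz have "\<forall>\<^sub>F j in sequentially. a (Suc j) \<le> c * a j"
      by eventually_elim (simp add: field_simps)
    then obtain j0 where j0: "\<And>j. j \<ge> j0 \<Longrightarrow> a (Suc j) \<le> c * a j" by (auto simp: eventually_sequentially)
    have "right_mass \<rho> (Suc j) \<le> c * right_mass \<rho> j" if "j \<ge> j0" for j
      unfolding V suminf_mult[OF sa', symmetric]
      using suminf_le[OF _ sa'[of "Suc j"] summable_mult[OF sa'[of j], of c]] j0 that by simp
    thus ?thesis by (auto simp: eventually_sequentially)
  qed
  show "\<forall>\<^sub>F j in sequentially. q * \<bar>\<rho> (- int j)\<bar> \<le> M * right_mass \<rho> j"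
    if q: "0 \<le> q" "0 \<le> M" "\<bar>\<theta>\<bar> < 1" "q * (1 - \<bar>\<theta>\<bar>) < M * \<bar>\<theta>\<bar>" for q M
  proof -
    have "M > 0" using q by (cases "M = 0") (auto simp: mult_less_0_iff)
    define \<delta> where "\<delta> = (M * \<bar>\<theta>\<bar> - q * (1 - \<bar>\<theta>\<bar>)) / (M + q)"
    have "\<delta> > 0" using q \<open>M > 0\<close> by (simp add: \<delta>_def)
    define c where "c = \<bar>\<theta>\<bar> - \<delta>"
    have "(M + q) * \<delta> = M * \<bar>\<theta>\<bar> - q * (1 - \<bar>\<theta>\<bar>)"
      using q \<open>M > 0\<close> by (simp add: \<delta>_def)
    hence c: "q * (1 - c) = M * c" by (simp add: c_def algebra_simps)
    have "c < 1" using q \<open>\<delta> > 0\<close> by (simp add: c_def)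
    have "\<forall>\<^sub>F j in sequentially. c * right_mass \<rho> j \<le> right_mass \<rho> (Suc j)"
      by (rule lower) (use \<open>\<delta> > 0\<close> in \<open>simp add: c_def\<close>)
    then obtain j0 where j0: "\<And>j. j \<ge> j0 \<Longrightarrow> c * right_mass \<rho> j \<le> right_mass \<rho> (Suc j)"
      by (auto simp: eventually_sequentially)
    have "q * \<bar>\<rho> (- int j)\<bar> \<le> M * right_mass \<rho> j" if "j \<ge> Suc j0" for j
    proof -
      obtain i where i: "j = Suc i" "i \<ge> j0" using \<open>j \<ge> Suc j0\<close> by (cases j) auto
      have "c * a j \<le> (1 - c) * right_mass \<rho> j"
        using j0[OF i(2)] right_mass_Suc[OF sum, of i] i(1) by (simp add: a_def algebra_simps)
      hence "M * (c * a j) \<le> M * ((1 - c) * right_mass \<rho> j)"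
        using q by (intro mult_left_mono)
      hence "(1 - c) * (q * a j) \<le> (1 - c) * (M * right_mass \<rho> j)"
        using c by (metis (no_types, lifting) mult.assoc mult.commute)
      thus ?thesis using \<open>c < 1\<close> by (simp add: a_def)
    qed
    thus ?thesis by (auto simp: eventually_sequentially)
  qed
qed

text \<open>
  The expansion of \<open>v\<close> is turned into a digit sequence: the weight \<open>a i\<close> sits at position \<open>N + 1 + i\<close>, and the
  auxiliary weight with index \<open>i \<in> I\<close> at position \<open>- l i\<close>.
\<close>

lemma conv_digit_expansion:
  fixes \<rho> :: "int \<Rightarrow> real" and l :: "nat \<Rightarrow> int" and I :: "nat set" and N M :: nat
  defines "e \<equiv> (\<lambda>i. if i \<in> I then \<rho> (l i) else 0)"
  assumes sum: "(\<lambda>m. \<bar>\<rho> m\<bar>) summable_on UNIV"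
    and l: "inj_on l I" "\<And>i. i \<in> I \<Longrightarrow> l i \<ge> 0"
    and a: "\<And>i. \<bar>\<rho> (- int (Suc (N + i)))\<bar> \<le> 2 * real M * (right_mass \<rho> (Suc (N + i)) + (\<Sum>j. \<bar>e (i + j)\<bar>))"
    and e: "\<And>i. i \<in> I \<Longrightarrow> \<bar>\<rho> (l i)\<bar> \<le> 2 * real M * right_mass \<rho> (Suc (N + i))"
    and v: "\<bar>v\<bar> \<le> M * right_mass \<rho> N"
  shows "\<exists>t. (\<forall>j. \<bar>t j\<bar> \<le> int M) \<and> (\<forall>j. j \<le> int N \<and> -j \<notin> l ` I \<longrightarrow> t j = 0) \<and> conv \<rho> t 0 = v"
proof -
  define R where "R = (\<lambda>i. - int (Suc (N + i)))"
  have "inj R" by (auto simp: R_def inj_def)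
  define aa where "aa = (\<lambda>i. \<rho> (R i))"
  have saa: "(\<lambda>i. \<bar>aa i\<bar>) summable_on UNIV"
    using summable_on_reindex[OF \<open>inj R\<close>, of "\<lambda>m. \<bar>\<rho> m\<bar>"] summable_on_subset[OF sum, of "range R"]
    by (simp add: o_def aa_def)
  have seI: "(\<lambda>i. \<bar>\<rho> (l i)\<bar>) summable_on I"
    using summable_on_reindex[OF l(1), of "\<lambda>m. \<bar>\<rho> m\<bar>"] summable_on_subset[OF sum, of "l ` I"]
    by (simp add: o_def)
  have see: "(\<lambda>i. \<bar>e i\<bar>) summable_on UNIV"
  proof -
    have "(\<lambda>i. \<bar>e i\<bar>) summable_on UNIV \<longleftrightarrow> (\<lambda>i. \<bar>\<rho> (l i)\<bar>) summable_on I"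
      by (rule summable_on_cong_neutral) (auto simp: e_def)
    thus ?thesis using seI by blast
  qed
  have rm: "right_mass \<rho> (N + i) = (\<Sum>j. \<bar>aa (i + j)\<bar>)" for i
    by (simp add: right_mass_def aa_def R_def algebra_simps)
  have sa: "summable (\<lambda>i. \<bar>aa i\<bar>)" and se: "summable (\<lambda>i. \<bar>e i\<bar>)"
    using saa see by (auto intro: summable_on_imp_summable)
  have En: "(\<Sum>j. \<bar>e (i + j)\<bar>) \<ge> 0" for i
    by (rule suminf_nonneg) (use summable_ignore_initial_segment[OF se, of i] in \<open>auto simp: add.commute\<close>)
  have "\<exists>s u. (\<forall>i. \<bar>s i\<bar> \<le> int M) \<and> (\<forall>i. \<bar>u i\<bar> \<le> int M) \<and> (\<lambda>i. aa i * real_of_int (s i) + e i * u i) sums v"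
  proof (rule digit_expansion[OF refl refl sa se])
    show "\<bar>aa i\<bar> \<le> 2 * real M * ((\<Sum>j. \<bar>aa (Suc i + j)\<bar>) + (\<Sum>j. \<bar>e (i + j)\<bar>))" for i
      using a[of i] rm[of "Suc i"] by (simp add: aa_def R_def)
    show "\<bar>e i\<bar> \<le> 2 * real M * ((\<Sum>j. \<bar>aa (Suc i + j)\<bar>) + (\<Sum>j. \<bar>e (Suc i + j)\<bar>))" for i
    proof (cases "i \<in> I")
      case True
      have "\<bar>e i\<bar> \<le> 2 * real M * (\<Sum>j. \<bar>aa (Suc i + j)\<bar>)"
        using e[OF True] rm[of "Suc i"] True by (simp add: e_def)
      also have "\<dots> \<le> 2 * real M * ((\<Sum>j. \<bar>aa (Suc i + j)\<bar>) + (\<Sum>j. \<bar>e (Suc i + j)\<bar>))"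
        using En[of "Suc i"] by (intro mult_left_mono) auto
      finally show ?thesis .
    next
      case False
      have "(\<Sum>j. \<bar>aa (Suc i + j)\<bar>) \<ge> 0"
        by (rule suminf_nonneg) (use summable_ignore_initial_segment[OF sa, of "Suc i"] in \<open>auto simp: add.commute\<close>)
      thus ?thesis using False En[of "Suc i"] by (simp add: e_def)
    qed
    have "real M * right_mass \<rho> N \<le> real M * (right_mass \<rho> N + (\<Sum>j. \<bar>e (0 + j)\<bar>))"
      using En[of 0] by (intro mult_left_mono) auto
    thus "\<bar>v\<bar> \<le> real M * ((\<Sum>j. \<bar>aa (0 + j)\<bar>) + (\<Sum>j. \<bar>e (0 + j)\<bar>))"
      using v rm[of 0] by simp
  qed blast
  then obtain s u :: "nat \<Rightarrow> int" where su: "\<And>i. \<bar>s i\<bar> \<le> int M" "\<And>i. \<bar>u i\<bar> \<le> int M"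
    "(\<lambda>i. aa i * real_of_int (s i) + e i * u i) sums v" by blast
  have su': "\<bar>real_of_int (s i)\<bar> \<le> real M" "\<bar>real_of_int (u i)\<bar> \<le> real M" for i
    using su(1,2)[of i] by linarith+
  define t where "t = (\<lambda>j. if j > int N then s (nat (j - int N - 1)) else if -j \<in> l ` I then u (the_inv_into I l (-j)) else 0)"
  have tR: "t (- R i) = s i" for i by (simp add: t_def R_def)
  have tl: "t (- l i) = u i" if "i \<in> I" for i
    using that l(2)[OF that] by (auto simp: t_def the_inv_into_f_f[OF l(1) that])
  have hs1: "(\<lambda>i. aa i * real_of_int (s i)) summable_on UNIV"
    by (rule summable_on_mult_bounded[OF saa, of _ M]) (use su'(1) in auto)
  have hs2: "(\<lambda>i. \<rho> (l i) * real_of_int (u i)) summable_on I"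
    by (rule summable_on_mult_bounded[OF seI, of _ M]) (use su'(2) in auto)
  define S where "S = (\<Sum>\<^sub>\<infinity>i. aa i * real_of_int (s i))"
  define U where "U = (\<Sum>\<^sub>\<infinity>i\<in>I. \<rho> (l i) * real_of_int (u i))"
  have h1: "((\<lambda>i. aa i * real_of_int (s i)) has_sum S) UNIV" using hs1 by (simp add: S_def)
  have h2: "((\<lambda>i. \<rho> (l i) * real_of_int (u i)) has_sum U) I" using hs2 by (simp add: U_def)
  have h2': "((\<lambda>i. e i * real_of_int (u i)) has_sum U) UNIV"
  proof -
    have "((\<lambda>i. e i * real_of_int (u i)) has_sum U) UNIV \<longleftrightarrow> ((\<lambda>i. \<rho> (l i) * real_of_int (u i)) has_sum U) I"
      by (rule has_sum_cong_neutral) (auto simp: e_def)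
    thus ?thesis using h2 by blast
  qed
  have "S + U = v"
    using sums_add[OF has_sum_imp_sums[OF h1] has_sum_imp_sums[OF h2']] su(3) by (rule sums_unique2)
  have g1: "((\<lambda>m. \<rho> m * real_of_int (t (0 - m))) has_sum S) (range R)"
    using h1 by (subst has_sum_reindex[OF \<open>inj R\<close>]) (simp add: o_def aa_def tR)
  have g2: "((\<lambda>m. \<rho> m * real_of_int (t (0 - m))) has_sum U) (l ` I)"
  proof (subst has_sum_reindex[OF l(1)])
    show "((\<lambda>m. \<rho> m * real_of_int (t (0 - m))) \<circ> l has_sum U) I"
      using h2 by (rule has_sum_cong[THEN iffD1, rotated]) (simp add: tl)
  qed
  have "range R \<inter> l ` I = {}" using l(2) by (force simp: R_def)
  from has_sum_Un_disjoint[OF g1 g2 this]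
  have g3: "((\<lambda>m. \<rho> m * real_of_int (t (0 - m))) has_sum v) (range R \<union> l ` I)"
    using \<open>S + U = v\<close> by simp
  have out: "t (- m) = 0" if "m \<notin> range R \<union> l ` I" for m
  proof -
    have "\<not> - m > int N"
    proof
      assume "- m > int N"
      hence "m = R (nat (- m - int N - 1))" by (simp add: R_def)
      thus False using that by blast
    qed
    thus ?thesis using that by (simp add: t_def)
  qed
  have "((\<lambda>m. \<rho> m * real_of_int (t (0 - m))) has_sum v) UNIV"
  proof -
    have "((\<lambda>m. \<rho> m * real_of_int (t (0 - m))) has_sum v) UNIV \<longleftrightarrow> 
      ((\<lambda>m. \<rho> m * real_of_int (t (0 - m))) has_sum v) (range R \<union> l ` I)"
      by (rule has_sum_cong_neutral) (use out in auto)
    thus ?thesis using g3 by blast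
  qed
  hence "conv \<rho> t 0 = v" unfolding conv_def by (rule infsumI)
  moreover have "\<forall>j. \<bar>t j\<bar> \<le> int M" using su by (simp add: t_def)
  moreover have "\<forall>j. j \<le> int N \<and> -j \<notin> l ` I \<longrightarrow> t j = 0" by (simp add: t_def)
  ultimately show ?thesis by blast
qed

text \<open>
  The digits beyond \<open>N\<close> and at the far-left positions \<open>-H\<close> are free. Together they reach at 0 every value within
  the trivial bound for the digits beyond \<open>N\<close> alone, while \<open>H\<close> lies so far out that it influences the
  positions \<open>n \<ge> 0\<close> only by a small fraction of the right mass.
\<close>

definition tail_hits :: "(int \<Rightarrow> real) \<Rightarrow> nat \<Rightarrow> int \<Rightarrow> real \<Rightarrow> nat \<Rightarrow> bool" where
  "tail_hits \<rho> M K \<kappa> N \<longleftrightarrow>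
     (\<exists>H \<subseteq> {K<..}. (\<forall>n\<ge>0. (\<Sum>\<^sub>\<infinity>l\<in>H. \<bar>\<rho> (n + l)\<bar>) \<le> \<kappa> * right_mass \<rho> N) \<and>
       (\<forall>v. \<bar>v\<bar> \<le> real M * right_mass \<rho> N \<longrightarrow>
          (\<exists>t. (\<forall>j. \<bar>t j\<bar> \<le> int M) \<and> (\<forall>j. j \<le> int N \<and> -j \<notin> H \<longrightarrow> t j = 0) \<and> conv \<rho> t 0 = v)))"

text \<open>
  With \<open>\<bar>\<theta>\<bar> = 1 / \<beta>\<close> the hypothesis \<open>strict\<close> says \<open>\<beta> < 2 M + 1\<close>: there are more digits than the base requires,
  and the tail of the kernel satisfies Kakeya's criterion without auxiliary positions.
\<close>

lemma tail_hits_strict: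
  fixes \<rho> :: "int \<Rightarrow> real" and M :: nat and K :: int and \<kappa> \<theta> :: real
  assumes sum: "(\<lambda>m. \<bar>\<rho> m\<bar>) summable_on UNIV"
    and ratio: "(\<lambda>j. \<rho> (- int (Suc j)) / \<rho> (- int j)) \<longlonglongrightarrow> \<theta>" and \<theta>: "0 < \<bar>\<theta>\<bar>" "\<bar>\<theta>\<bar> < 1"
    and strict: "1 - \<bar>\<theta>\<bar> < 2 * real M * \<bar>\<theta>\<bar>" and \<kappa>: "\<kappa> > 0"
  shows "\<forall>\<^sub>F N in sequentially. tail_hits \<rho> M K \<kappa> N"
proof -
  note V_pos = right_mass_pos[OF sum ratio \<theta>(1)]
  have "\<forall>\<^sub>F j in sequentially. 1 * \<bar>\<rho> (- int j)\<bar> \<le> 2 * real M * right_mass \<rho> j"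
    by (rule right_mass_dominates[OF sum ratio \<theta>(1)]) (use strict \<theta> in auto)
  then obtain N0 where N0: "\<And>j. j \<ge> N0 \<Longrightarrow> \<bar>\<rho> (- int j)\<bar> \<le> 2 * real M * right_mass \<rho> j"
    by (auto simp: eventually_sequentially)
  have hit: "\<exists>t. (\<forall>j. \<bar>t j\<bar> \<le> int M) \<and> (\<forall>j. j \<le> int N \<and> -j \<notin> {} \<longrightarrow> t j = 0) \<and> conv \<rho> t 0 = v"
    if "N \<ge> N0" "\<bar>v\<bar> \<le> real M * right_mass \<rho> N" for N v
    using conv_digit_expansion[OF sum, of id "{}" N M v] that(2) N0[of "Suc (N + _)"] that(1)
    by (auto simp: le_Suc_eq trans_le_add1)
  have "tail_hits \<rho> M K \<kappa> N" if "N \<ge> N0" for N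
    unfolding tail_hits_def using hit[OF that] \<kappa> V_pos[of N]
    by (intro exI[of _ "{}"] conjI) (auto intro: less_imp_le)
  thus ?thesis by (auto simp: eventually_sequentially)
qed

text \<open>
  This covers the borderline \<open>\<beta> = 2 M + 1\<close>, in which the tail satisfies Kakeya's criterion only up to a relative error that tends to
  0, and the sum set of the tail alone can have gaps at every scale. Left regularity supplies auxiliary positions
  \<open>-l i\<close>, one for every \<open>L + 1\<close> positions of the tail, whose weights are comparable to a fixed small fraction of the
  current tail mass: large enough to absorb the error, small enough to be covered by the tail that follows.
\<close>

lemma tail_hits_regular:
  fixes \<rho> :: "int \<Rightarrow> real" and M :: nat and K :: int and \<kappa> \<theta> :: real
  assumes sum: "(\<lambda>m. \<bar>\<rho> m\<bar>) summable_on UNIV"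
    and ratio: "(\<lambda>j. \<rho> (- int (Suc j)) / \<rho> (- int j)) \<longlonglongrightarrow> \<theta>" and \<theta>: "0 < \<bar>\<theta>\<bar>" "\<bar>\<theta>\<bar> < 1"
    and weak: "1 - \<bar>\<theta>\<bar> \<le> 2 * real M * \<bar>\<theta>\<bar>" and reg: "left_regular \<rho>" and \<kappa>: "\<kappa> > 0"
  shows "\<forall>\<^sub>F N in sequentially. tail_hits \<rho> M K \<kappa> N"
proof -
  let ?V = "right_mass \<rho>"
  note V_pos = right_mass_pos[OF sum ratio \<theta>(1)]
  have "M > 0" using weak \<theta> by (cases M) auto
  obtain r where r: "r > 0" "\<And>K::int. \<exists>x0>0. \<forall>x. 0 < x \<and> x \<le> x0 \<longrightarrow>
     (\<exists>l>K. r * x \<le> \<bar>\<rho> l\<bar> \<and> (\<forall>i\<ge>l. \<bar>\<rho> i\<bar> \<le> x))"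
    using reg unfolding left_regular_def by blast
  define K' where "K' = max K 0"
  obtain x0 where x0: "x0 > 0" "\<And>x. 0 < x \<Longrightarrow> x \<le> x0 \<Longrightarrow>
     (\<exists>l>K'. r * x \<le> \<bar>\<rho> l\<bar> \<and> (\<forall>i\<ge>l. \<bar>\<rho> i\<bar> \<le> x))" using r(2)[of K'] by blast
  define c b where "c = \<bar>\<theta>\<bar> / 2" and "b = (1 + \<bar>\<theta>\<bar>) / 2"
  have cb: "0 < c" "c < \<bar>\<theta>\<bar>" "\<bar>\<theta>\<bar> < b" "b < 1" "0 < b" "c < 1"
    using \<theta> by (auto simp: c_def b_def)
  obtain L where L: "b ^ L < r" using real_arch_pow_inv[OF r(1) cb(4)] by blast
  have L0: "b ^ Suc L < r"
    using L power_decreasing[of L "Suc L" b] cb by linarith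
  \<comment> \<open>The fraction of the tail mass given to one auxiliary weight: the first bound keeps the total influence
    below \<open>\<kappa>\<close>, the second makes the weight coverable by the tail that follows.\<close>
  define x where "x = min (\<kappa> * (1 - b)) (2 * real M * c)"
  have x: "x > 0" "x \<le> \<kappa> * (1 - b)" "x \<le> 2 * real M * c"
    using \<kappa> cb \<open>M > 0\<close> by (auto simp: x_def)
  define \<eta> where "\<eta> = 2 * real M * (r * x * c ^ Suc L)"
  have "\<eta> > 0" using \<open>M > 0\<close> r x cb by (simp add: \<eta>_def)
  have "\<forall>\<^sub>F j in sequentially. max 0 (1 - \<eta>) * \<bar>\<rho> (- int j)\<bar> \<le> 2 * real M * ?V j"
  proof (rule right_mass_dominates[OF sum ratio \<theta>(1)])
    have "max 0 (1 - \<eta>) * (1 - \<bar>\<theta>\<bar>) < 1 * (1 - \<bar>\<theta>\<bar>)"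
      by (rule mult_strict_right_mono) (use \<open>\<eta> > 0\<close> \<theta> in auto)
    also have "\<dots> \<le> 2 * real M * \<bar>\<theta>\<bar>" using weak by simp
    finally show "max 0 (1 - \<eta>) * (1 - \<bar>\<theta>\<bar>) < 2 * real M * \<bar>\<theta>\<bar>" .
  qed (use \<theta> in auto)
  moreover have "\<forall>\<^sub>F j in sequentially. c * ?V j \<le> ?V (Suc j)"
    by (rule right_mass_ratio_lower[OF sum ratio \<theta>(1) cb(2)])
  moreover have "\<forall>\<^sub>F j in sequentially. ?V (Suc j) \<le> b * ?V j"
    by (rule right_mass_ratio_upper[OF sum ratio \<theta>(1) cb(3)])
  ultimately have "\<forall>\<^sub>F j in sequentially. max 0 (1 - \<eta>) * \<bar>\<rho> (- int j)\<bar> \<le> 2 * real M * ?V j \<and>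
     c * ?V j \<le> ?V (Suc j) \<and> ?V (Suc j) \<le> b * ?V j"
    by eventually_elim blast
  then obtain N1 where N1: "\<And>j. j \<ge> N1 \<Longrightarrow> max 0 (1 - \<eta>) * \<bar>\<rho> (- int j)\<bar> \<le> 2 * real M * ?V j"
     "\<And>j. j \<ge> N1 \<Longrightarrow> c * ?V j \<le> ?V (Suc j)" "\<And>j. j \<ge> N1 \<Longrightarrow> ?V (Suc j) \<le> b * ?V j"
    by (auto simp: eventually_sequentially)
  have Vup: "?V (N + i) \<le> b ^ i * ?V N" if "N \<ge> N1" for N i
  proof (induction i)
    case (Suc i)
    have "?V (N + Suc i) \<le> b * ?V (N + i)" using N1(3)[of "N + i"] that by simp
    also have "\<dots> \<le> b * (b ^ i * ?V N)" using Suc cb by (intro mult_left_mono) auto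
    finally show ?case by simp
  qed simp
  have Vlo: "c ^ i * ?V N \<le> ?V (N + i)" if "N \<ge> N1" for N i
  proof (induction i)
    case (Suc i)
    have "c ^ Suc i * ?V N \<le> c * ?V (N + i)" using mult_left_mono[OF Suc, of c] cb by simp
    also have "\<dots> \<le> ?V (N + Suc i)" using N1(2)[of "N + i"] that by simp
    finally show ?case by simp
  qed simp
  have mono: "?V (N + i) \<le> ?V N" for N i
  proof (induction i)
    case (Suc i)
    thus ?case using right_mass_Suc[OF sum, of "N + i"] by simp
  qed simp
  obtain n2 where n2: "b ^ n2 < x0 / (x * ?V N1)"
    using real_arch_pow_inv[of "x0 / (x * ?V N1)" b] cb x x0 V_pos by auto
  define N0 where "N0 = N1 + n2"
  have xV: "x * ?V N \<le> x0" if "N \<ge> N0" for N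
  proof -
    have "x * ?V N \<le> x * ?V N0"
      using mono[of N0 "N - N0"] that x by (intro mult_left_mono) auto
    also have "\<dots> \<le> x * (b ^ n2 * ?V N1)"
      using Vup[of N1 n2] x by (intro mult_left_mono) (auto simp: N0_def)
    also have "\<dots> \<le> x0" using n2 x V_pos[of N1] by (simp add: field_simps)
    finally show ?thesis .
  qed
  have "tail_hits \<rho> M K \<kappa> N" if N: "N \<ge> N0" for N
  proof -
    have NN1: "N \<ge> N1" using N by (simp add: N0_def)
    have "\<forall>i. \<exists>l>K'. r * (x * ?V (N + i)) \<le> \<bar>\<rho> l\<bar> \<and> (\<forall>i'\<ge>l. \<bar>\<rho> i'\<bar> \<le> x * ?V (N + i))"
      by (intro allI x0(2) xV) (use N x V_pos in auto)
    then obtain l where l: "\<And>i. l i > K'" "\<And>i. r * (x * ?V (N + i)) \<le> \<bar>\<rho> (l i)\<bar>"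
       "\<And>i i'. i' \<ge> l i \<Longrightarrow> \<bar>\<rho> i'\<bar> \<le> x * ?V (N + i)" by metis
    define I where "I = {i. Suc L dvd i}"
    \<comment> \<open>Distinct indices in \<open>I\<close> have auxiliary weights of different size, hence different positions.\<close>
    have decr: "\<bar>\<rho> (l i')\<bar> < \<bar>\<rho> (l i)\<bar>" if "i' \<ge> i + Suc L" for i i'
    proof -
      have "\<bar>\<rho> (l i')\<bar> \<le> x * ?V (N + i')" by (rule l(3)) simp
      also have "\<dots> \<le> x * ?V (N + i + Suc L)"
        using mono[of "N + i + Suc L" "i' - i - Suc L"] that x by (intro mult_left_mono) auto
      also have "\<dots> \<le> x * (b ^ Suc L * ?V (N + i))"
        using Vup[of "N + i" "Suc L"] NN1 x by (intro mult_left_mono) auto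
      also have "\<dots> < x * (r * ?V (N + i))"
        using L0 x V_pos by (intro mult_strict_left_mono mult_strict_right_mono) auto
      also have "\<dots> = r * (x * ?V (N + i))" by simp
      also have "\<dots> \<le> \<bar>\<rho> (l i)\<bar>" by (rule l(2))
      finally show ?thesis .
    qed
    have inj: "inj_on l I"
    proof (rule linorder_inj_onI')
      fix i j assume ij: "i \<in> I" "j \<in> I" "i < j"
      hence "Suc L dvd j - i" by (auto simp: I_def)
      hence "Suc L \<le> j - i" using ij by (intro dvd_imp_le) auto
      hence "\<bar>\<rho> (l j)\<bar> < \<bar>\<rho> (l i)\<bar>" using ij by (intro decr) auto
      thus "l i \<noteq> l j" by auto
    qed
    define e where "e = (\<lambda>i. if i \<in> I then \<rho> (l i) else 0)"
    have se: "summable (\<lambda>i. \<bar>e i\<bar>)"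
    proof -
      have "(\<lambda>i. \<bar>\<rho> (l i)\<bar>) summable_on I"
        using summable_on_reindex[OF inj, of "\<lambda>m. \<bar>\<rho> m\<bar>"] summable_on_subset[OF sum, of "l ` I"]
        by (simp add: o_def)
      moreover have "(\<lambda>i. \<bar>e i\<bar>) summable_on UNIV \<longleftrightarrow> (\<lambda>i. \<bar>\<rho> (l i)\<bar>) summable_on I"
        by (rule summable_on_cong_neutral) (auto simp: e_def)
      ultimately show ?thesis by (auto intro: summable_on_imp_summable)
    qed
    have hit: "\<exists>t. (\<forall>j. \<bar>t j\<bar> \<le> int M) \<and> (\<forall>j. j \<le> int N \<and> -j \<notin> l ` I \<longrightarrow> t j = 0) \<and> conv \<rho> t 0 = v"
      if v: "\<bar>v\<bar> \<le> real M * ?V N" for v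
    proof (rule conv_digit_expansion[OF sum inj _ _ _ v])
      show "l i \<ge> 0" for i using l(1)[of i] by (simp add: K'_def)
      show "\<bar>\<rho> (l i)\<bar> \<le> 2 * real M * ?V (Suc (N + i))" for i
      proof -
        have "\<bar>\<rho> (l i)\<bar> \<le> x * ?V (N + i)" by (rule l(3)) simp
        also have "\<dots> \<le> 2 * real M * c * ?V (N + i)" using x V_pos by (intro mult_right_mono) (auto intro: less_imp_le)
        also have "\<dots> \<le> 2 * real M * ?V (Suc (N + i))"
          using N1(2)[of "N + i"] NN1 by (simp add: mult.assoc mult_left_mono)
        finally show ?thesis .
      qed
      show "\<bar>\<rho> (- int (Suc (N + i)))\<bar> \<le> 2 * real M * (?V (Suc (N + i)) + (\<Sum>j. \<bar>if i + j \<in> I then \<rho> (l (i + j)) else 0\<bar>))" for i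
      proof -
        \<comment> \<open>The next index after \<open>i\<close> that carries an auxiliary weight.\<close>
        define k where "k = (Suc L - i mod Suc L)"
        have k: "k \<le> Suc L" "i + k \<in> I"
        proof -
          show "k \<le> Suc L" by (simp add: k_def)
          have "i mod Suc L \<le> Suc L" by (simp add: less_imp_le)
          moreover have "Suc L * (i div Suc L) + i mod Suc L = i" by (rule mult_div_mod_eq)
          moreover have "x + y = i \<Longrightarrow> y \<le> z \<Longrightarrow> i + (z - y) = x + z" for x y z by simp
          ultimately have "i + k = Suc L * (i div Suc L) + Suc L" unfolding k_def by blast
          hence "i + k = Suc L * (i div Suc L + 1)" by (simp only: add_mult_distrib2 mult_1_right)
          thus "i + k \<in> I" by (simp only: I_def mem_Collect_eq dvd_triv_left)
        qed
        have a: "\<bar>\<rho> (- int (Suc (N + i)))\<bar> \<le> ?V (N + i)"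
          using right_mass_Suc[OF sum, of "N + i"] V_pos[of "Suc (N + i)"] by simp
        have "r * x * c ^ Suc L * \<bar>\<rho> (- int (Suc (N + i)))\<bar> \<le> r * x * c ^ Suc L * ?V (N + i)"
          using a r x cb by (intro mult_left_mono) auto
        also have "\<dots> \<le> r * x * c ^ k * ?V (N + i)"
          using r x cb k V_pos by (intro mult_right_mono mult_left_mono power_decreasing) (auto intro: less_imp_le)
        also have "\<dots> \<le> r * x * ?V (N + i + k)"
          using Vlo[of "N + i" k] NN1 r x by (simp add: mult.assoc mult_left_mono)
        also have "\<dots> \<le> \<bar>e (i + k)\<bar>" using l(2)[of "i + k"] k by (simp add: e_def add.assoc mult.assoc)
        also have "\<dots> \<le> (\<Sum>j. \<bar>e (i + j)\<bar>)"
        proof -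
          have "summable (\<lambda>j. \<bar>e (i + j)\<bar>)"
            using summable_ignore_initial_segment[OF se, of i] by (simp add: add.commute)
          from sum_le_suminf[OF this, of "{k}"] show ?thesis by simp
        qed
        finally have "2 * real M * (r * x * c ^ Suc L * \<bar>\<rho> (- int (Suc (N + i)))\<bar>) \<le> 2 * real M * (\<Sum>j. \<bar>e (i + j)\<bar>)"
          by (intro mult_left_mono) auto
        hence E: "\<eta> * \<bar>\<rho> (- int (Suc (N + i)))\<bar> \<le> 2 * real M * (\<Sum>j. \<bar>e (i + j)\<bar>)"
          by (simp add: \<eta>_def mult.assoc)
        have "(1 - \<eta>) * \<bar>\<rho> (- int (Suc (N + i)))\<bar> \<le> max 0 (1 - \<eta>) * \<bar>\<rho> (- int (Suc (N + i)))\<bar>"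
          by (intro mult_right_mono) auto
        also have "\<dots> \<le> 2 * real M * ?V (Suc (N + i))"
          using N1(1)[of "Suc (N + i)"] NN1 by simp
        finally show ?thesis using E unfolding e_def by (simp add: algebra_simps)
      qed
    qed
    have infl: "(\<Sum>\<^sub>\<infinity>m\<in>l ` I. \<bar>\<rho> (n + m)\<bar>) \<le> \<kappa> * ?V N" if "n \<ge> 0" for n
    proof -
      have gs: "summable (\<lambda>i. x * ?V N * b ^ i)" using cb by (intro summable_mult summable_geometric) auto
      have gs': "(\<lambda>i. x * ?V N * b ^ i) summable_on UNIV"
        by (rule summable_nonneg_imp_summable_on[OF gs]) (use x V_pos cb in \<open>auto intro!: mult_nonneg_nonneg intro: less_imp_le\<close>)
      have bd: "\<bar>\<rho> (n + l i)\<bar> \<le> x * ?V N * b ^ i" for i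
      proof -
        have "\<bar>\<rho> (n + l i)\<bar> \<le> x * ?V (N + i)" by (rule l(3)) (use that in simp)
        also have "\<dots> \<le> x * (b ^ i * ?V N)" using Vup[OF NN1, of i] x by (intro mult_left_mono) auto
        finally show ?thesis by (simp add: mult_ac)
      qed
      have "(\<Sum>\<^sub>\<infinity>m\<in>l ` I. \<bar>\<rho> (n + m)\<bar>) = (\<Sum>\<^sub>\<infinity>i\<in>I. \<bar>\<rho> (n + l i)\<bar>)"
        by (subst infsum_reindex[OF inj]) (simp add: o_def)
      also have "\<dots> \<le> (\<Sum>\<^sub>\<infinity>i. x * ?V N * b ^ i)"
      proof (rule infsum_mono_neutral[OF _ gs'])
        have "(\<lambda>i. x * ?V N * b ^ i) summable_on I" using gs' by (rule summable_on_subset) auto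
        thus "(\<lambda>i. \<bar>\<rho> (n + l i)\<bar>) summable_on I"
          by (rule summable_on_comparison_test) (use bd in auto)
      qed (use bd x V_pos cb in \<open>auto intro!: mult_nonneg_nonneg intro: less_imp_le\<close>)
      also have "\<dots> = x * ?V N / (1 - b)"
      proof -
        have "(\<lambda>i. x * ?V N * b ^ i) sums (x * ?V N * (1 / (1 - b)))"
          using cb by (intro sums_mult geometric_sums) auto
        moreover have "(\<lambda>i. x * ?V N * b ^ i) sums (\<Sum>\<^sub>\<infinity>i. x * ?V N * b ^ i)"
          by (rule has_sum_imp_sums) (use gs' in simp)
        ultimately show ?thesis using sums_unique2 by fastforce
      qed
      also have "\<dots> \<le> \<kappa> * ?V N"
        using mult_right_mono[OF x(2), of "?V N"] cb V_pos[of N] by (simp add: field_simps)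
      finally show ?thesis .
    qed
    show ?thesis unfolding tail_hits_def
      by (rule exI[of _ "l ` I"]) (use hit infl l(1) in \<open>auto simp: K'_def\<close>)
  qed
  thus ?thesis by (auto simp: eventually_sequentially)
qed

lemma conv_diff_self:
  assumes "(\<lambda>m. \<bar>\<rho> m\<bar>) summable_on UNIV" "\<And>j. \<bar>s j\<bar> \<le> B" "\<And>j. \<bar>s' j\<bar> \<le> B'"
  shows "conv \<rho> s n - conv \<rho> s' n = conv \<rho> (\<lambda>j. s j - s' j) n"
  unfolding conv_diff[OF assms] by (simp add: conv_def)

text \<open>
  Far from the exceptional digits the convolution cannot be much larger than \<open>M\<close> times the norm of the kernel, and
  the distance \<open>L\<close> that is far enough depends on the digits only through \<open>B\<close> and \<open>K\<close>.
\<close>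

lemma conv_far_bound:
  fixes \<rho> :: "int \<Rightarrow> real" and B K :: int and M :: nat
  assumes sum: "(\<lambda>m. \<bar>\<rho> m\<bar>) summable_on UNIV" and "\<epsilon> > 0" "B \<ge> 0" "K \<ge> 0"
  obtains L where "L \<ge> 0" "\<forall>s n. (\<forall>j. \<bar>s j\<bar> \<le> B) \<and> (\<forall>j. \<bar>j\<bar> \<ge> K \<longrightarrow> \<bar>s j\<bar> \<le> int M) \<and> \<bar>n\<bar> \<ge> L \<longrightarrow>
     \<bar>conv \<rho> s n\<bar> \<le> M * (\<Sum>\<^sub>\<infinity>m. \<bar>\<rho> m\<bar>) + \<epsilon>"
proof -
  obtain L where L: "L \<ge> 0" "(\<Sum>\<^sub>\<infinity>m\<in>{m. \<bar>m\<bar> > L}. \<bar>\<rho> m\<bar>) < \<epsilon> / (B + 1)"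
    using infsum_int_tail_small[OF sum, of "\<epsilon> / (B + 1)"] assms by auto
  have "\<bar>conv \<rho> s n\<bar> \<le> M * (\<Sum>\<^sub>\<infinity>m. \<bar>\<rho> m\<bar>) + \<epsilon>"
    if s: "\<And>j. \<bar>s j\<bar> \<le> B" "\<And>j. \<bar>j\<bar> \<ge> K \<Longrightarrow> \<bar>s j\<bar> \<le> int M" and n: "\<bar>n\<bar> \<ge> L + K" for s n
  proof -
    have "\<bar>conv \<rho> s n\<bar> \<le> M * (\<Sum>\<^sub>\<infinity>m. \<bar>\<rho> m\<bar>) + B * (\<Sum>\<^sub>\<infinity>m\<in>{m. \<bar>m\<bar> > L}. \<bar>\<rho> m\<bar>)"
      unfolding conv_def
    proof (rule infsum_mult_bounded_le[OF sum])
      fix m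
      show "\<bar>real_of_int (s (n - m))\<bar> \<le> real M" if "m \<notin> {m. \<bar>m\<bar> > L}"
      proof -
        have "\<bar>s (n - m)\<bar> \<le> int M" by (rule s(2)) (use that n in auto)
        thus ?thesis by linarith
      qed
      show "\<bar>real_of_int (s (n - m))\<bar> \<le> real M + B"
        using s(1)[of "n - m"] by linarith
    qed (use assms in auto)
    also have "B * (\<Sum>\<^sub>\<infinity>m\<in>{m. \<bar>m\<bar> > L}. \<bar>\<rho> m\<bar>) \<le> (B + 1) * (\<epsilon> / (B + 1))"
      using L assms by (intro mult_mono) (auto intro!: infsum_nonneg)
    also have "\<dots> = \<epsilon>" using assms by simp
    finally show ?thesis by simp
  qed
  thus ?thesis using that[of "L + K"] L assms by auto
qed

lemma right_mass_infsum:
  assumes sum: "(\<lambda>m. \<bar>\<rho> m\<bar>) summable_on UNIV"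
  shows "(\<Sum>\<^sub>\<infinity>m\<in>{m. m < - int N}. \<bar>\<rho> m\<bar>) = right_mass \<rho> N"
proof -
  define R where "R = (\<lambda>i. - int (Suc (N + i)))"
  have "inj R" by (auto simp: R_def inj_def)
  have "{m. m < - int N} = range R"
  proof (intro set_eqI iffI)
    fix m assume "m \<in> {m. m < - int N}"
    hence "m = R (nat (- m - int N - 1))" by (simp add: R_def)
    thus "m \<in> range R" by blast
  qed (auto simp: R_def)
  hence e: "(\<Sum>\<^sub>\<infinity>m\<in>{m. m < - int N}. \<bar>\<rho> m\<bar>) = (\<Sum>\<^sub>\<infinity>i. \<bar>\<rho> (R i)\<bar>)"
    by (simp add: infsum_reindex[OF \<open>inj R\<close>] o_def)
  have "(\<lambda>i. \<bar>\<rho> (R i)\<bar>) summable_on UNIV"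
    using summable_on_reindex[OF \<open>inj R\<close>, of "\<lambda>m. \<bar>\<rho> m\<bar>"] summable_on_subset[OF sum, of "range R"]
    by (simp add: o_def)
  hence "(\<lambda>i. \<bar>\<rho> (R i)\<bar>) sums (\<Sum>\<^sub>\<infinity>i. \<bar>\<rho> (R i)\<bar>)"
    by (intro has_sum_imp_sums) simp
  thus ?thesis using e by (simp add: right_mass_def R_def sums_iff)
qed

lemma right_mass_tendsto_0:
  assumes sum: "(\<lambda>m. \<bar>\<rho> m\<bar>) summable_on UNIV"
  shows "right_mass \<rho> \<longlonglongrightarrow> 0"
proof -
  have "summable (\<lambda>i. \<bar>\<rho> (- int (Suc i))\<bar>)"
    by (rule summable_on_int_imp_summable[OF sum]) (auto simp: inj_def)
  from suminf_exist_split2[OF this] show ?thesis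
    by (simp add: right_mass_def[abs_def] add.commute)
qed

text \<open>
  A change of the digit at a far-right position \<open>j\<close> acts at position \<open>n\<close> about \<open>\<theta> ^ (- n)\<close> times as strongly
  as at position 0.
\<close>

lemma ratio_power:
  fixes \<rho> :: "int \<Rightarrow> real"
  assumes ratio: "(\<lambda>j. \<rho> (- int (Suc j)) / \<rho> (- int j)) \<longlonglongrightarrow> \<theta>" and "\<theta> \<noteq> 0"
    and nz: "\<forall>\<^sub>F j in sequentially. \<rho> (- int j) \<noteq> 0"
  shows "(\<lambda>j. \<theta> ^ n * \<rho> (int n - int j) / \<rho> (- int j)) \<longlonglongrightarrow> 1"
proof -
  have "(\<lambda>i. \<rho> (- int (i + n)) / \<rho> (- int i)) \<longlonglongrightarrow> \<theta> ^ n"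
  proof (induction n)
    case 0
    have "(\<lambda>i. \<rho> (- int (i + 0)) / \<rho> (- int i)) \<longlonglongrightarrow> 1"
      proof (rule tendsto_eventually)
      show "\<forall>\<^sub>F i in sequentially. \<rho> (- int (i + 0)) / \<rho> (- int i) = 1"
        using nz by eventually_elim simp
    qed
    thus ?case by simp
  next
    case (Suc n)
    have nz': "\<forall>\<^sub>F i in sequentially. \<rho> (- int (i + n)) \<noteq> 0"
      using eventually_compose_filterlim[OF nz filterlim_add_const_nat_at_top[of n]] .
    have "(\<lambda>i. \<rho> (- int (Suc (i + n))) / \<rho> (- int (i + n))) \<longlonglongrightarrow> \<theta>"
      using LIMSEQ_ignore_initial_segment[OF ratio, of n] .
    from tendsto_mult[OF this Suc.IH]
    have "(\<lambda>i. \<rho> (- int (Suc (i + n))) / \<rho> (- int (i + n)) * (\<rho> (- int (i + n)) / \<rho> (- int i))) \<longlonglongrightarrow> \<theta> ^ Suc n"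
      by (simp only: power_Suc)
    moreover have cancel: "a / b * (b / c) = a / c" if "b \<noteq> 0" for a b c :: real
      using that by simp
    have "\<forall>\<^sub>F i in sequentially. \<rho> (- int (Suc (i + n))) / \<rho> (- int (i + n)) * (\<rho> (- int (i + n)) / \<rho> (- int i)) =
        \<rho> (- int (i + Suc n)) / \<rho> (- int i)"
      using nz'
    proof eventually_elim
      case (elim i)
      show ?case by (simp only: cancel[OF elim] add_Suc_right)
    qed
    ultimately show ?case by (rule Lim_transform_eventually)
  qed
  from tendsto_divide[OF tendsto_const[of "\<theta> ^ n"] this]
  have "(\<lambda>i. \<theta> ^ n / (\<rho> (- int (i + n)) / \<rho> (- int i))) \<longlonglongrightarrow> 1"
    using \<open>\<theta> \<noteq> 0\<close> by (simp del: of_nat_add)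
  moreover have "(\<lambda>i. \<theta> ^ n / (\<rho> (- int (i + n)) / \<rho> (- int i))) =
      (\<lambda>i. \<theta> ^ n * \<rho> (int n - int (i + n)) / \<rho> (- int (i + n)))"
  proof (rule ext)
    fix i :: nat
    have e: "int n - int (i + n) = - int i" by simp
    show "\<theta> ^ n / (\<rho> (- int (i + n)) / \<rho> (- int i)) = \<theta> ^ n * \<rho> (int n - int (i + n)) / \<rho> (- int (i + n))"
      unfolding e by (rule divide_divide_eq_right)
  qed
  ultimately have "(\<lambda>i. \<theta> ^ n * \<rho> (int n - int (i + n)) / \<rho> (- int (i + n))) \<longlonglongrightarrow> 1"
    by (simp only:)
  thus ?thesis
    by (rule LIMSEQ_offset[where f = "\<lambda>j. \<theta> ^ n * \<rho> (int n - int j) / \<rho> (- int j)" and k = n])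
qed

section \<open>Lacunary repetition\<close>

lemma limsup_eqI_real:
  fixes X :: "nat \<Rightarrow> real"
  assumes "\<And>\<epsilon>. \<epsilon> > 0 \<Longrightarrow> \<forall>\<^sub>F n in sequentially. X n \<le> \<tau> + \<epsilon>"
    and "\<And>\<epsilon>. \<epsilon> > 0 \<Longrightarrow> \<exists>\<^sub>F n in sequentially. X n \<ge> \<tau> - \<epsilon>"
  shows "limsup (\<lambda>n. ereal (X n)) = ereal \<tau>"
proof (rule antisym)
  show "limsup (\<lambda>n. ereal (X n)) \<le> ereal \<tau>"
  proof (rule ereal_le_epsilon2)
    fix e :: real assume "e > 0"
    thus "limsup (\<lambda>n. ereal (X n)) \<le> ereal \<tau> + ereal e"
      using assms(1) by (auto intro!: Limsup_bounded)
  qed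
  show "ereal \<tau> \<le> limsup (\<lambda>n. ereal (X n))"
  proof (rule ccontr)
    assume "\<not> ?thesis"
    then obtain y where y: "limsup (\<lambda>n. ereal (X n)) < ereal y" "ereal y < ereal \<tau>"
      using ereal_dense2[of "limsup (\<lambda>n. ereal (X n))" "ereal \<tau>"] by (auto simp: not_le)
    have "\<forall>\<^sub>F n in sequentially. X n < y" using Limsup_lessD[OF y(1)] by simp
    moreover have "\<exists>\<^sub>F n in sequentially. X n \<ge> \<tau> - (\<tau> - y)" by (rule assms(2)) (use y in simp)
    ultimately have "\<exists>\<^sub>F n in sequentially. X n \<ge> \<tau> - (\<tau> - y) \<and> X n < y"
      by (rule frequently_eventually_frequently[rotated])
    thus False by (auto dest: frequently_ex)
  qed
qed

text \<open>
  The windows of radius \<open>2 ^ k\<close> around \<open>4 ^ k\<close> are pairwise disjoint; for \<open>k = 0\<close> and \<open>k = 1\<close> they would touch.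
\<close>

lemma lacunary_windows_unique:
  fixes k k' :: nat and j :: int
  assumes "k \<ge> 1" "k' \<ge> 1" "\<bar>j - 4 ^ k\<bar> \<le> 2 ^ k" "\<bar>j - 4 ^ k'\<bar> \<le> 2 ^ k'"
  shows "k = k'"
proof -
  have *: False if "k < k'" "k \<ge> 1" "\<bar>j - 4 ^ k\<bar> \<le> 2 ^ k" "\<bar>j - 4 ^ k'\<bar> \<le> 2 ^ k'" for k k' :: nat and j :: int
  proof -
    define y z :: int where "y = 2 ^ k" and "z = 2 ^ k'"
    have "(2::int) ^ 1 \<le> 2 ^ k" by (rule power_increasing) (use that in auto)
    hence y: "y \<ge> 2" by (simp add: y_def)
    have "(2::int) ^ Suc k \<le> 2 ^ k'" by (rule power_increasing) (use that in auto)
    hence z: "z \<ge> 2 * y" by (simp add: y_def z_def)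
    have 4: "(4::int) ^ n = 2 ^ n * 2 ^ n" for n by (simp flip: power_mult_distrib)
    have "z * z - z = z * (z - 1)" by (simp add: algebra_simps)
    also have "\<dots> \<ge> (2 * y) * (2 * y - 1)" using y z by (intro mult_mono) auto
    finally have "z * z - z \<ge> 4 * (y * y) - 2 * y" by (simp add: algebra_simps)
    moreover have "y * y \<ge> 2 * y" using y by (intro mult_right_mono) auto
    moreover have "j \<le> y * y + y" "j \<ge> z * z - z" using that by (auto simp: y_def z_def 4)
    ultimately show False using y by linarith
  qed
  show ?thesis using *[of k k' j] *[of k' k j] assms by (meson linorder_neqE_nat)
qed

text \<open>
  \<open>\<tau>\<close> is the maximum over all positions of the distance to the nearest integer, for some digit sequence of which only
  finitely many digits exceed \<open>M\<close>.
\<close>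

definition peak_value :: "(int \<Rightarrow> real) \<Rightarrow> nat \<Rightarrow> real \<Rightarrow> bool" where
  "peak_value \<rho> M \<tau> \<longleftrightarrow> (\<exists>s B K n0. (\<forall>j. \<bar>s j\<bar> \<le> B) \<and> (\<forall>j. \<bar>j\<bar> \<ge> K \<longrightarrow> \<bar>s j\<bar> \<le> int M) \<and>
     dist_nearest_int (conv \<rho> s n0) = \<tau> \<and> (\<forall>n. dist_nearest_int (conv \<rho> s n) \<le> \<tau>))"

lemma peak_value_reflect:
  assumes "peak_value (\<lambda>m. \<rho> (- m)) M \<tau>" shows "peak_value \<rho> M \<tau>"
proof -
  obtain s B K n0 where s: "\<forall>j. \<bar>s j\<bar> \<le> B" "\<forall>j. \<bar>j\<bar> \<ge> K \<longrightarrow> \<bar>s j\<bar> \<le> int M"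
     "dist_nearest_int (conv (\<lambda>m. \<rho> (- m)) s n0) = \<tau>" "\<forall>n. dist_nearest_int (conv (\<lambda>m. \<rho> (- m)) s n) \<le> \<tau>"
    using assms unfolding peak_value_def by blast
  have c: "conv \<rho> (\<lambda>j. s (-j)) n = conv (\<lambda>m. \<rho> (- m)) s (-n)" for n
    using conv_reflect[of "\<lambda>m. \<rho> (- m)" s n] by simp
  show ?thesis unfolding peak_value_def
    by (rule exI[of _ "\<lambda>j. s (-j)"], rule exI[of _ B], rule exI[of _ K], rule exI[of _ "- n0"])
       (use s in \<open>simp add: c\<close>)
qed

text \<open>
  Copies of longer and longer windows of a digit sequence, placed further and further apart, turn a maximum into an
  upper limit. Around a copy the values are nearly those of the original sequence; everywhere else only digits of
  size at most \<open>M\<close> are within sight, and those contribute at most \<open>\<tau>\<close> by the hypothesis on the norm of the kernel.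
\<close>

lemma lacunary_limsup:
  fixes \<rho> :: "int \<Rightarrow> real" and M :: nat
  assumes sum: "(\<lambda>m. \<bar>\<rho> m\<bar>) summable_on UNIV"
    and peak: "peak_value \<rho> M \<tau>" and M: "M * (\<Sum>\<^sub>\<infinity>m. \<bar>\<rho> m\<bar>) \<le> \<tau>"
  obtains s' :: "int \<Rightarrow> int" and B :: int where "\<And>j. \<bar>s' j\<bar> \<le> B" "\<And>j. j < 0 \<Longrightarrow> s' j = 0"
    "limsup (\<lambda>n. ereal (dist_nearest_int (conv \<rho> s' (int n)))) = ereal \<tau>"
proof -
  obtain s B K n0 where s: "\<forall>j. \<bar>s j\<bar> \<le> B" "\<forall>j. \<bar>j\<bar> \<ge> K \<longrightarrow> \<bar>s j\<bar> \<le> int M"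
     "dist_nearest_int (conv \<rho> s n0) = \<tau>" "\<forall>n. dist_nearest_int (conv \<rho> s n) \<le> \<tau>"
    using peak unfolding peak_value_def by blast
  have "B \<ge> 0" using s(1) abs_ge_zero order_trans by blast
  with s(1) have B: "B \<ge> 0" "\<And>j. \<bar>s j\<bar> \<le> B" by auto
  have K: "\<And>j. \<bar>j\<bar> \<ge> K \<Longrightarrow> \<bar>s j\<bar> \<le> int M" using s(2) by blast
  have n0: "dist_nearest_int (conv \<rho> s n0) = \<tau>" and max: "\<And>n. dist_nearest_int (conv \<rho> s n) \<le> \<tau>"
    using s(3,4) by auto
  define W where "W = (\<lambda>(k::nat) (j::int). k \<ge> 1 \<and> \<bar>j - 4 ^ k\<bar> \<le> 2 ^ k)"
  define s' where "s' = (\<lambda>j. if \<exists>k. W k j then s (j - 4 ^ (SOME k. W k j)) else 0)"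
  have s'_W: "s' j = s (j - 4 ^ k)" if "W k j" for j k
  proof -
    have "W (SOME k. W k j) j" using that by (rule someI)
    hence "(SOME k. W k j) = k" using that unfolding W_def by (blast intro: lacunary_windows_unique)
    thus ?thesis using that by (auto simp: s'_def)
  qed
  have s'B: "\<bar>s' j\<bar> \<le> B" for j using B by (simp add: s'_def)
  have s'0: "s' j = 0" if "j < 0" for j
  proof -
    have "\<not> W k j" for k
    proof
      assume "W k j"
      hence "4 ^ k - 2 ^ k \<le> j" by (auto simp: W_def)
      moreover have "(2::int) ^ k \<le> 4 ^ k" by (rule power_mono) auto
      ultimately show False using that by linarith
    qed
    thus ?thesis by (simp add: s'_def)
  qed
  have copy: "\<bar>conv \<rho> s' n - conv \<rho> s (n - 4 ^ k)\<bar> \<le> 2 * B * (\<Sum>\<^sub>\<infinity>m\<in>{m. \<bar>m\<bar> > L}. \<bar>\<rho> m\<bar>)"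
    if "\<And>j. \<bar>j - n\<bar> \<le> L \<Longrightarrow> W k j" for n k L
  proof -
    have "\<bar>\<Sum>\<^sub>\<infinity>m. \<rho> m * real_of_int (s' (n - m) - s (n - 4 ^ k - m))\<bar> \<le> 
       0 * (\<Sum>\<^sub>\<infinity>m. \<bar>\<rho> m\<bar>) + (2 * B) * (\<Sum>\<^sub>\<infinity>m\<in>{m. \<bar>m\<bar> > L}. \<bar>\<rho> m\<bar>)"
    proof (rule infsum_mult_bounded_le[OF sum])
      fix m assume "m \<notin> {m. \<bar>m\<bar> > L}"
      hence "W k (n - m)" by (intro that) auto
      from s'_W[OF this] show "\<bar>real_of_int (s' (n - m) - s (n - 4 ^ k - m))\<bar> \<le> 0"
        by (simp add: algebra_simps)
    next
      fix m show "\<bar>real_of_int (s' (n - m) - s (n - 4 ^ k - m))\<bar> \<le> 0 + real_of_int (2 * B)"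
        using s'B[of "n - m"] B(2)[of "n - 4 ^ k - m"] by linarith
    qed (use B in auto)
    thus ?thesis unfolding conv_diff[OF sum s'B B(2)] by simp
  qed
  have tail: "\<exists>L\<ge>0. 2 * B * (\<Sum>\<^sub>\<infinity>m\<in>{m. \<bar>m\<bar> > L}. \<bar>\<rho> m\<bar>) \<le> \<epsilon>" if "\<epsilon> > 0" for \<epsilon>
  proof -
    have "real_of_int B \<ge> 0" using B by simp
    hence "\<epsilon> / (2 * B + 1) > 0" using that by simp
    then obtain L where L: "L \<ge> 0" "(\<Sum>\<^sub>\<infinity>m\<in>{m. \<bar>m\<bar> > L}. \<bar>\<rho> m\<bar>) < \<epsilon> / (2 * B + 1)"
      using infsum_int_tail_small[OF sum] by blast
    have "2 * B * (\<Sum>\<^sub>\<infinity>m\<in>{m. \<bar>m\<bar> > L}. \<bar>\<rho> m\<bar>) \<le> (2 * B + 1) * (\<epsilon> / (2 * B + 1))"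
      using L B by (intro mult_mono) (auto intro!: infsum_nonneg)
    also have "\<dots> = \<epsilon>" using \<open>real_of_int B \<ge> 0\<close> by simp
    finally show ?thesis using L by blast
  qed
  have big: "\<exists>k0. \<forall>k\<ge>k0. (2::int) ^ k \<ge> C" for C
  proof -
    have "C \<le> 2 ^ k" if "k \<ge> nat C" for k
    proof -
      have "C \<le> int k" using that by simp
      also have "\<dots> \<le> 2 ^ k" using less_exp[of k] by (metis less_imp_le of_nat_less_iff of_nat_numeral of_nat_power)
      finally show ?thesis .
    qed
    thus ?thesis by blast
  qed
  have "limsup (\<lambda>n. ereal (dist_nearest_int (conv \<rho> s' (int n)))) = ereal \<tau>"
  proof (rule limsup_eqI_real)
    fix \<epsilon> :: real assume "\<epsilon> > 0"
    then obtain L where L: "L \<ge> 0" "2 * B * (\<Sum>\<^sub>\<infinity>m\<in>{m. \<bar>m\<bar> > L}. \<bar>\<rho> m\<bar>) \<le> \<epsilon>" using tail by blast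
    obtain k0 where k0: "\<And>k. k \<ge> k0 \<Longrightarrow> (2::int) ^ k \<ge> K + 2 * L" using big by blast
    define n1 where "n1 = nat (4 ^ k0 + 2 ^ k0 + L)"
    have "dist_nearest_int (conv \<rho> s' (int n)) \<le> \<tau> + \<epsilon>" if "n > n1" for n
    proof (cases "\<exists>j. \<bar>j - int n\<bar> \<le> L \<and> \<bar>s' j\<bar> > int M")
      case True
      then obtain j where j: "\<bar>j - int n\<bar> \<le> L" "\<bar>s' j\<bar> > int M" by blast
      then obtain k where k: "W k j" by (auto simp: s'_def split: if_splits)
      have jk: "\<bar>j - 4 ^ k\<bar> < K" using K[of "j - 4 ^ k"] j(2) s'_W[OF k] by linarith
      have "k \<ge> k0"
      proof (rule ccontr)
        assume "\<not> k \<ge> k0"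
        hence "(4::int) ^ k \<le> 4 ^ k0" "(2::int) ^ k \<le> 2 ^ k0" by (auto intro!: power_increasing)
        moreover have "j \<le> 4 ^ k + 2 ^ k" using k unfolding W_def by linarith
        ultimately have "j \<le> 4 ^ k0 + 2 ^ k0" by linarith
        thus False using j(1) \<open>n > n1\<close> unfolding n1_def by linarith
      qed
      have "\<bar>conv \<rho> s' (int n) - conv \<rho> s (int n - 4 ^ k)\<bar> \<le> 2 * B * (\<Sum>\<^sub>\<infinity>m\<in>{m. \<bar>m\<bar> > L}. \<bar>\<rho> m\<bar>)"
      proof (rule copy)
        fix i assume "\<bar>i - int n\<bar> \<le> L"
        hence "\<bar>i - 4 ^ k\<bar> \<le> K + 2 * L" using jk j(1) by linarith
        thus "W k i" using k0[OF \<open>k \<ge> k0\<close>] k by (auto simp: W_def)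
      qed
      thus ?thesis using dist_nearest_int_lipschitz[of "conv \<rho> s' (int n)" "conv \<rho> s (int n - 4 ^ k)"]
          max[of "int n - 4 ^ k"] L(2) by linarith
    next
      case False
      have "\<bar>conv \<rho> s' (int n)\<bar> \<le> M * (\<Sum>\<^sub>\<infinity>m. \<bar>\<rho> m\<bar>) + (2 * B) * (\<Sum>\<^sub>\<infinity>m\<in>{m. \<bar>m\<bar> > L}. \<bar>\<rho> m\<bar>)"
        unfolding conv_def
      proof (rule infsum_mult_bounded_le[OF sum])
        fix m assume "m \<notin> {m. \<bar>m\<bar> > L}"
        hence "\<bar>s' (int n - m)\<bar> \<le> int M" using False by (auto simp: not_less)
        thus "\<bar>real_of_int (s' (int n - m))\<bar> \<le> real M" by linarith
      next
        fix m show "\<bar>real_of_int (s' (int n - m))\<bar> \<le> real M + real_of_int (2 * B)"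
          using s'B[of "int n - m"] B(1) by linarith
      qed (use B in auto)
      thus ?thesis using dist_nearest_int_le_abs[of "conv \<rho> s' (int n)"] M L(2) by simp
    qed
    thus "\<forall>\<^sub>F n in sequentially. dist_nearest_int (conv \<rho> s' (int n)) \<le> \<tau> + \<epsilon>"
      unfolding eventually_sequentially by (metis Suc_le_eq)
  next
    fix \<epsilon> :: real assume "\<epsilon> > 0"
    then obtain L where L: "L \<ge> 0" "2 * B * (\<Sum>\<^sub>\<infinity>m\<in>{m. \<bar>m\<bar> > L}. \<bar>\<rho> m\<bar>) \<le> \<epsilon>" using tail by blast
    show "\<exists>\<^sub>F n in sequentially. dist_nearest_int (conv \<rho> s' (int n)) \<ge> \<tau> - \<epsilon>"
      unfolding frequently_sequentially
    proof
      fix n1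
      obtain k0 where k0: "\<And>k. k \<ge> k0 \<Longrightarrow> (2::int) ^ k \<ge> \<bar>n0\<bar> + L + int n1 + 1" using big by blast
      define k where "k = Suc k0"
      have k: "k \<ge> 1" "(2::int) ^ k \<ge> \<bar>n0\<bar> + L + int n1 + 1" using k0[of k] by (auto simp: k_def)
      have "(2::int) ^ k \<le> 4 ^ k" by (rule power_mono) auto
      define n where "n = nat (4 ^ k + n0)"
      have "4 ^ k + n0 \<ge> int n1" using k L(1) \<open>(2::int) ^ k \<le> 4 ^ k\<close> by linarith
      hence n: "int n = 4 ^ k + n0" "n \<ge> n1" by (auto simp: n_def)
      have "\<bar>conv \<rho> s' (int n) - conv \<rho> s (int n - 4 ^ k)\<bar> \<le> 2 * B * (\<Sum>\<^sub>\<infinity>m\<in>{m. \<bar>m\<bar> > L}. \<bar>\<rho> m\<bar>)"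
        by (rule copy) (use n k in \<open>auto simp: W_def\<close>)
      thus "\<exists>n\<ge>n1. dist_nearest_int (conv \<rho> s' (int n)) \<ge> \<tau> - \<epsilon>"
        using dist_nearest_int_lipschitz[of "conv \<rho> s n0" "conv \<rho> s' (int n)"] n0 n L(2)
        by (intro exI[of _ n]) (simp add: abs_minus_commute)
    qed
  qed
  thus ?thesis using that s'B s'0 by blast
qed

section \<open>Peak values near one half\<close>

lemma bij_plus_int: "bij_betw (\<lambda>m::int. n + m) UNIV UNIV"
  by (rule bij_betw_byWitness[of _ "\<lambda>m. m - n"]) auto

lemma summable_on_shift:
  fixes f :: "int \<Rightarrow> real"
  assumes "(\<lambda>m. \<bar>f m\<bar>) summable_on UNIV" shows "(\<lambda>m. \<bar>f (n + m)\<bar>) summable_on Y"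
proof -
  have "(\<lambda>m. \<bar>f (n + m)\<bar>) summable_on UNIV"
    using summable_on_reindex_bij_betw[OF bij_plus_int[of n], of "\<lambda>m. \<bar>f m\<bar>"] assms by simp
  thus ?thesis by (rule summable_on_subset) auto
qed

lemma dist_nearest_int_half: "dist_nearest_int (1/2) = 1/2"
proof -
  obtain k where k: "dist_nearest_int (1/2) = \<bar>1/2 - real_of_int k\<bar>" using dist_nearest_int_attained by blast
  have "k \<le> 0 \<or> k \<ge> 1" by linarith
  hence "\<bar>1/2 - real_of_int k\<bar> \<ge> 1/2" by auto
  thus ?thesis using k dist_nearest_int_le_half[of "1/2"] by linarith
qed

text \<open>
  Comparison of the effect of one change of digits at two positions: if the kernel nearly satisfies
  \<open>w \<rho> (n + m) = \<rho> m\<close> on the places that matter, the effects at \<open>n\<close> and at 0 are nearly in the ratio \<open>1 / w\<close>.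
\<close>

lemma conv_two_positions:
  fixes \<rho> :: "int \<Rightarrow> real" and w :: real
  assumes sum: "(\<lambda>m. \<bar>\<rho> m\<bar>) summable_on UNIV"
    and \<Delta>: "\<And>j. \<bar>real_of_int (\<Delta> j)\<bar> \<le> B" and supp: "\<And>j. - j \<notin> X \<Longrightarrow> \<Delta> j = 0" and "B \<ge> 0"
  shows "\<bar>w * conv \<rho> \<Delta> n - conv \<rho> \<Delta> 0\<bar> \<le> B * (\<Sum>\<^sub>\<infinity>m\<in>X. \<bar>w * \<rho> (n + m) - \<rho> m\<bar>)"
    and "(\<lambda>m. \<bar>w * \<rho> (n + m) - \<rho> m\<bar>) summable_on Y"
proof -
  note sumX = summable_on_shift[OF sum]
  define f where "f = (\<lambda>m. w * \<rho> (n + m) - \<rho> m)"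
  have sf: "(\<lambda>m. \<bar>w\<bar> * \<bar>\<rho> (n + m)\<bar> + \<bar>\<rho> m\<bar>) summable_on UNIV"
    by (intro summable_on_add summable_on_cmult_right sumX sum)
  have f_le: "\<bar>f m\<bar> \<le> \<bar>w\<bar> * \<bar>\<rho> (n + m)\<bar> + \<bar>\<rho> m\<bar>" for m
    unfolding f_def using abs_triangle_ineq4[of "w * \<rho> (n + m)" "\<rho> m"] by (simp add: abs_mult)
  have f: "(\<lambda>m. \<bar>f m\<bar>) summable_on UNIV"
    by (rule summable_on_comparison_test[OF sf]) (use f_le in auto)
  thus "(\<lambda>m. \<bar>w * \<rho> (n + m) - \<rho> m\<bar>) summable_on Y" unfolding f_def by (rule summable_on_subset) auto
  have s\<Delta>: "(\<lambda>m. \<rho> (n + m) * real_of_int (\<Delta> (- m))) summable_on UNIV"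
    by (rule summable_on_mult_bounded[OF sumX, where B = B]) (use \<Delta> in auto)
  have s\<Delta>0: "(\<lambda>m. \<rho> m * real_of_int (\<Delta> (- m))) summable_on UNIV"
    by (rule summable_on_mult_bounded[OF sum, where B = B]) (use \<Delta> in auto)
  have "conv \<rho> \<Delta> n = (\<Sum>\<^sub>\<infinity>m. \<rho> (n + m) * real_of_int (\<Delta> (- m)))"
    unfolding conv_def by (rule infsum_reindex_bij_witness[of _ "\<lambda>m. n + m" "\<lambda>m. m - n"]) auto
  moreover have "conv \<rho> \<Delta> 0 = (\<Sum>\<^sub>\<infinity>m. \<rho> m * real_of_int (\<Delta> (- m)))" by (simp add: conv_def)
  ultimately have "w * conv \<rho> \<Delta> n - conv \<rho> \<Delta> 0 =
     (\<Sum>\<^sub>\<infinity>m. w * (\<rho> (n + m) * real_of_int (\<Delta> (- m)))) + (\<Sum>\<^sub>\<infinity>m. - (\<rho> m * real_of_int (\<Delta> (- m))))"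
    by (simp add: infsum_cmult_right' infsum_uminus)
  also have "\<dots> = (\<Sum>\<^sub>\<infinity>m. w * (\<rho> (n + m) * real_of_int (\<Delta> (- m))) + - (\<rho> m * real_of_int (\<Delta> (- m))))"
  proof (rule infsum_add[symmetric])
    show "(\<lambda>m. - (\<rho> m * real_of_int (\<Delta> (- m)))) summable_on UNIV"
      unfolding summable_on_uminus by (rule s\<Delta>0)
  qed (intro summable_on_cmult_right s\<Delta>)
  also have "\<dots> = (\<Sum>\<^sub>\<infinity>m. f m * real_of_int (\<Delta> (- m)))"
    by (simp add: f_def algebra_simps)
  finally have eq: "w * conv \<rho> \<Delta> n - conv \<rho> \<Delta> 0 = (\<Sum>\<^sub>\<infinity>m. f m * real_of_int (\<Delta> (- m)))" .
  have "\<bar>\<Sum>\<^sub>\<infinity>m. f m * real_of_int (\<Delta> (- m))\<bar> \<le> 0 * (\<Sum>\<^sub>\<infinity>m. \<bar>f m\<bar>) + B * (\<Sum>\<^sub>\<infinity>m\<in>X. \<bar>f m\<bar>)"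
  proof (rule infsum_mult_bounded_le[OF f])
    fix m show "\<bar>real_of_int (\<Delta> (- m))\<bar> \<le> 0 + B" using \<Delta>[of "- m"] by simp
  qed (use supp \<open>B \<ge> 0\<close> in auto)
  thus "\<bar>w * conv \<rho> \<Delta> n - conv \<rho> \<Delta> 0\<bar> \<le> B * (\<Sum>\<^sub>\<infinity>m\<in>X. \<bar>w * \<rho> (n + m) - \<rho> m\<bar>)"
    unfolding eq f_def by simp
qed

text \<open>
  A kernel with asymptotic ratio \<open>\<theta>\<close> to the left, where \<open>1 / \<bar>\<theta>\<bar>\<close> plays the part of the base of a numeration
  system with the \<open>2 M + 1\<close> digits of absolute value at most \<open>M\<close>. In the borderline case left regularity is required.
\<close>

locale dominated_kernel =
  fixes \<rho> :: "int \<Rightarrow> real" and \<theta> :: real and M :: nat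
  assumes sum: "(\<lambda>m. \<bar>\<rho> m\<bar>) summable_on UNIV"
    and ratio: "(\<lambda>j. \<rho> (- int (Suc j)) / \<rho> (- int j)) \<longlonglongrightarrow> \<theta>"
    and \<theta>: "0 < \<bar>\<theta>\<bar>" "\<bar>\<theta>\<bar> < 1"
    and cover: "1 - \<bar>\<theta>\<bar> < 2 * real M * \<bar>\<theta>\<bar> \<or> 1 - \<bar>\<theta>\<bar> \<le> 2 * real M * \<bar>\<theta>\<bar> \<and> left_regular \<rho>"
begin

abbreviation "V \<equiv> right_mass \<rho>"

lemmas V_pos = right_mass_pos[OF sum ratio \<theta>(1)]
lemmas nonzero = ratio_eventually_nonzero[OF sum ratio \<theta>(1)]

lemma M_pos: "M > 0"
  using cover \<theta> by (cases M) auto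

lemma tail_hits: "\<kappa> > 0 \<Longrightarrow> \<forall>\<^sub>F N in sequentially. tail_hits \<rho> M K \<kappa> N"
  using cover tail_hits_strict[OF sum ratio \<theta>] tail_hits_regular[OF sum ratio \<theta>] by blast

text \<open>
  A single large digit \<open>k\<close> at a position \<open>m\<close> where the kernel is tiny brings the value at 0 close to 1/2, and
  an expansion with free digits makes it exact.
\<close>

lemma conv_attains_half:
  obtains s :: "int \<Rightarrow> int" and B K :: int where "B \<ge> int M" "K \<ge> 0" "\<And>j. \<bar>s j\<bar> \<le> B" "\<And>j. \<bar>j\<bar> \<ge> K \<Longrightarrow> \<bar>s j\<bar> \<le> int M"
    "conv \<rho> s 0 = 1/2"
proof -
  obtain N0 where N0: "\<And>N v. N \<ge> N0 \<Longrightarrow> \<bar>v\<bar> \<le> real M * right_mass \<rho> N \<Longrightarrow>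
     \<exists>t. (\<forall>j. \<bar>t j\<bar> \<le> int M) \<and> conv \<rho> t 0 = v"
    using tail_hits[of 1 0] unfolding eventually_sequentially tail_hits_def by (metis zero_less_one)
  define W where "W = real M * right_mass \<rho> N0"
  have "W > 0" using V_pos[of N0] M_pos by (simp add: W_def)
  have "(\<lambda>j. \<rho> (- int j)) \<longlonglongrightarrow> 0"
  proof (rule summable_LIMSEQ_zero, rule summable_rabs_cancel)
    show "summable (\<lambda>n. \<bar>\<rho> (- int n)\<bar>)"
      by (rule summable_on_int_imp_summable[OF sum]) (auto simp: inj_def)
  qed
  hence "\<forall>\<^sub>F j in sequentially. \<bar>\<rho> (- int j)\<bar> < W"
    using \<open>W > 0\<close> by (auto simp: tendsto_iff dist_real_def)
  with nonzero
  have "\<forall>\<^sub>F j in sequentially. \<rho> (- int j) \<noteq> 0 \<and> \<bar>\<rho> (- int j)\<bar> < W"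
    by eventually_elim blast
  then obtain m where m: "\<rho> (- int m) \<noteq> 0" "\<bar>\<rho> (- int m)\<bar> < W"
    by (auto simp: eventually_sequentially)
  define a where "a = \<rho> (- int m)"
  define k where "k = round (1 / (2 * a))"
  define v where "v = 1/2 - a * k"
  have "v = a * (1 / (2 * a) - k)" using m by (simp add: v_def a_def field_simps)
  hence "\<bar>v\<bar> = \<bar>a\<bar> * \<bar>1 / (2 * a) - k\<bar>" by (metis abs_mult)
  also have "\<dots> \<le> \<bar>a\<bar> * 1"
    using of_int_round_abs_le[of "1 / (2 * a)"] unfolding k_def[symmetric]
    by (intro mult_left_mono) (auto simp: abs_minus_commute)
  also have "\<dots> \<le> W" using m by (simp add: a_def)
  finally obtain t where t: "\<And>j. \<bar>t j\<bar> \<le> int M" "conv \<rho> t 0 = v"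
    using N0[of N0 v] by (auto simp: W_def)
  define s where "s = (\<lambda>j. t j + (if j = int m then k else 0))"
  have sB: "\<bar>s j\<bar> \<le> int M + \<bar>k\<bar>" for j
    using t(1)[of j] by (auto simp: s_def)
  have "conv \<rho> s 0 - conv \<rho> t 0 = conv \<rho> (\<lambda>j. s j - t j) 0"
    by (rule conv_diff_self[OF sum sB t(1)])
  also have "\<dots> = (\<Sum>\<^sub>\<infinity>i\<in>{- int m}. \<rho> i * real_of_int k)"
    unfolding conv_def s_def by (rule infsum_cong_neutral) auto
  also have "\<dots> = a * k" by (simp add: a_def)
  finally have "conv \<rho> s 0 = 1/2" using t(2) by (simp add: v_def)
  moreover have "\<bar>s j\<bar> \<le> int M" if "\<bar>j\<bar> \<ge> int m + 1" for j
    using that t(1)[of j] by (auto simp: s_def)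
  ultimately show ?thesis using that[of "int M + \<bar>k\<bar>" "int m + 1" s] sB by auto
qed

text \<open>
  The masses decrease to 0 by bounded factors, so every small \<open>x\<close> is comparable with one of them.
\<close>

lemma comparable_scale:
  assumes c: "\<And>N. N \<ge> N1 \<Longrightarrow> c * V N \<le> V (Suc N)" and x: "0 < x" "x \<le> M * V N1"
  obtains N where "N \<ge> N1" "x \<le> M * V N" "c * (M * V N) \<le> x"
proof -
  have "(\<lambda>N. M * V (Suc N)) \<longlonglongrightarrow> real M * 0"
    using LIMSEQ_Suc[OF right_mass_tendsto_0[OF sum]] by (intro tendsto_mult tendsto_const)
  hence "\<forall>\<^sub>F N in sequentially. M * V (Suc N) < x"
    using x(1) by (intro order_tendstoD(2)) auto
  then obtain m where m: "\<And>N. N \<ge> m \<Longrightarrow> M * V (Suc N) < x" by (auto simp: eventually_sequentially)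
  define Q where "Q = (\<lambda>N. N \<ge> N1 \<and> M * V (Suc N) < x)"
  define N where "N = (LEAST N. Q N)"
  have "Q (max m N1)" using m by (simp add: Q_def)
  hence QN: "Q N" unfolding N_def by (rule LeastI)
  have "x \<le> M * V N"
  proof (cases "N = N1")
    case False
    then obtain N' where N': "N = Suc N'" "N' \<ge> N1" using QN by (cases N) (auto simp: Q_def)
    have "\<not> Q N'" using not_less_Least[of N' Q] N'(1) by (simp flip: N_def)
    thus ?thesis using N' by (simp add: Q_def)
  qed (use x in simp)
  moreover have "c * (M * V N) \<le> x"
  proof -
    have "c * V N \<le> V (Suc N)" by (rule c) (use QN in \<open>simp add: Q_def\<close>)
    hence "M * (c * V N) \<le> M * V (Suc N)" by (intro mult_left_mono) auto
    also have "\<dots> \<le> x" using QN by (simp add: Q_def)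
    finally show ?thesis by (simp add: mult_ac)
  qed
  moreover have "N \<ge> N1" using QN by (simp add: Q_def)
  ultimately show ?thesis using that by blast
qed

text \<open>
  The core of the construction. All digits beyond a position \<open>N\<close>, together with the auxiliary ones, are replaced so that the
  value at 0 moves by exactly \<open>x\<close>, up or down. At the positions \<open>n > 0\<close> of the finite set \<open>E\<close> the change
  is at least as large, because the effect of the tail grows like \<open>\<bar>\<theta>\<bar> ^ (- n)\<close>. For this the error of that asymptotic law,
  which is a small fraction of the mass beyond \<open>N\<close>, must be small compared with \<open>x\<close>; hence \<open>N\<close> is chosen with
  \<open>x\<close> comparable to that mass.
\<close>

lemma redigit:
  assumes s1: "\<And>j. \<bar>s1 j\<bar> \<le> B" "\<And>j. \<bar>j\<bar> \<ge> K1 \<Longrightarrow> \<bar>s1 j\<bar> \<le> int M" and B: "B \<ge> int M" and "K1 \<ge> 0" "L \<ge> 0"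
    and E: "finite E" "\<And>n. n \<in> E \<Longrightarrow> n \<ge> 0" and "\<epsilon> > 0"
  obtains x0 where "x0 > 0" "\<forall>x. 0 < x \<and> x \<le> x0 \<longrightarrow> (\<exists>s. (\<forall>j. \<bar>s j\<bar> \<le> B) \<and> (\<forall>j. \<bar>j\<bar> \<ge> K1 \<longrightarrow> \<bar>s j\<bar> \<le> int M) \<and>
     \<bar>conv \<rho> s 0 - conv \<rho> s1 0\<bar> = x \<and> (\<forall>n\<in>E. n \<noteq> 0 \<longrightarrow> x \<le> \<bar>conv \<rho> s n - conv \<rho> s1 n\<bar>) \<and>
     (\<forall>n. \<bar>n\<bar> < L \<longrightarrow> \<bar>conv \<rho> s n - conv \<rho> s1 n\<bar> \<le> \<epsilon>))"
proof -
  define c where "c = \<bar>\<theta>\<bar> / 2"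
  \<comment> \<open>The errors below add up to \<open>6 \<kappa>\<close> times \<open>M\<close> times the mass, and may cost at most the fraction \<open>1 - \<bar>\<theta>\<bar>\<close> of \<open>x\<close>.\<close>
  define \<kappa> where "\<kappa> = c * (1 - \<bar>\<theta>\<bar>) / 6"
  have c: "0 < c" "c < \<bar>\<theta>\<bar>" "c < 1" using \<theta> by (auto simp: c_def)
  have \<kappa>: "\<kappa> > 0" "6 * \<kappa> = c * (1 - \<bar>\<theta>\<bar>)" using c \<theta> by (auto simp: \<kappa>_def)
  have "c * (1 - \<bar>\<theta>\<bar>) \<le> c * 1" using c \<theta> by (intro mult_left_mono) auto
  hence "\<kappa> \<le> c" using \<kappa> by linarith
  obtain T where T: "T \<ge> 0" "(\<Sum>\<^sub>\<infinity>m\<in>{m. \<bar>m\<bar> > T}. \<bar>\<rho> m\<bar>) < \<epsilon> / (2 * M)"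
    using infsum_int_tail_small[OF sum, of "\<epsilon> / (2 * M)"] \<open>\<epsilon> > 0\<close> M_pos by auto
  define K2 where "K2 = K1 + L + T"
  obtain N0 where N0: "\<And>N. N \<ge> N0 \<Longrightarrow> tail_hits \<rho> M K2 \<kappa> N"
    using tail_hits[OF \<kappa>(1), of K2] by (auto simp: eventually_sequentially)
  obtain N2 where N2: "\<And>N. N \<ge> N2 \<Longrightarrow> c * V N \<le> V (Suc N)"
    using right_mass_ratio_lower[OF sum ratio \<theta>(1) c(2)] by (auto simp: eventually_sequentially)
  have "\<forall>\<^sub>F j in sequentially. \<forall>n\<in>E. \<bar>\<theta> ^ nat n * \<rho> (n - int j) - \<rho> (- int j)\<bar> \<le> \<kappa> * \<bar>\<rho> (- int j)\<bar>"
  proof (rule eventually_ball_finite[OF E(1)], rule ballI)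
    fix n assume n: "n \<in> E"
    have "(\<lambda>j. \<theta> ^ nat n * \<rho> (int (nat n) - int j) / \<rho> (- int j)) \<longlonglongrightarrow> 1"
      by (rule ratio_power[OF ratio _ nonzero]) (use \<theta> in auto)
    hence "\<forall>\<^sub>F j in sequentially. \<bar>\<theta> ^ nat n * \<rho> (n - int j) / \<rho> (- int j) - 1\<bar> < \<kappa>"
      using \<kappa>(1) E(2)[OF n] by (auto simp: tendsto_iff dist_real_def)
    with nonzero show "\<forall>\<^sub>F j in sequentially. \<bar>\<theta> ^ nat n * \<rho> (n - int j) - \<rho> (- int j)\<bar> \<le> \<kappa> * \<bar>\<rho> (- int j)\<bar>"
    proof eventually_elim
      case (elim j)
      have "\<bar>\<theta> ^ nat n * \<rho> (n - int j) - \<rho> (- int j)\<bar> = \<bar>\<theta> ^ nat n * \<rho> (n - int j) / \<rho> (- int j) - 1\<bar> * \<bar>\<rho> (- int j)\<bar>"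
        using elim(1) by (simp add: abs_mult [symmetric] field_simps)
      also have "\<dots> \<le> \<kappa> * \<bar>\<rho> (- int j)\<bar>" using elim(2) by (intro mult_right_mono) auto
      finally show ?case .
    qed
  qed
  then obtain N3 where N3: "\<And>j n. j \<ge> N3 \<Longrightarrow> n \<in> E \<Longrightarrow> \<bar>\<theta> ^ nat n * \<rho> (n - int j) - \<rho> (- int j)\<bar> \<le> \<kappa> * \<bar>\<rho> (- int j)\<bar>"
    by (auto simp: eventually_sequentially)
  define N1 where "N1 = N0 + N2 + N3 + nat K2"
  have "M * V N1 > 0" using V_pos[of N1] M_pos by simp
  moreover have "\<exists>s. (\<forall>j. \<bar>s j\<bar> \<le> B) \<and> (\<forall>j. \<bar>j\<bar> \<ge> K1 \<longrightarrow> \<bar>s j\<bar> \<le> int M) \<and>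
     \<bar>conv \<rho> s 0 - conv \<rho> s1 0\<bar> = x \<and> (\<forall>n\<in>E. n \<noteq> 0 \<longrightarrow> x \<le> \<bar>conv \<rho> s n - conv \<rho> s1 n\<bar>) \<and>
     (\<forall>n. \<bar>n\<bar> < L \<longrightarrow> \<bar>conv \<rho> s n - conv \<rho> s1 n\<bar> \<le> \<epsilon>)" if x: "x > 0" "x \<le> M * V N1" for x
  proof -
    have "c * V N \<le> V (Suc N)" if "N \<ge> N1" for N by (rule N2) (use that in \<open>simp add: N1_def\<close>)
    then obtain N where N: "N \<ge> N1" "x \<le> M * V N" "c * (M * V N) \<le> x" by (rule comparable_scale[OF _ x])
    have NN: "N \<ge> N0" "N \<ge> N3" "int N \<ge> K2" using N(1) by (auto simp: N1_def)
    have K2: "K2 \<ge> K1" "K2 \<ge> L + T" "K2 \<ge> 0" using \<open>L \<ge> 0\<close> \<open>K1 \<ge> 0\<close> T by (auto simp: K2_def)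
    obtain H where H: "H \<subseteq> {K2<..}" "\<And>n. n \<ge> 0 \<Longrightarrow> (\<Sum>\<^sub>\<infinity>l\<in>H. \<bar>\<rho> (n + l)\<bar>) \<le> \<kappa> * V N"
      "\<And>v. \<bar>v\<bar> \<le> real M * V N \<Longrightarrow> \<exists>t. (\<forall>j. \<bar>t j\<bar> \<le> int M) \<and> (\<forall>j. j \<le> int N \<and> -j \<notin> H \<longrightarrow> t j = 0) \<and> conv \<rho> t 0 = v"
      using N0[OF NN(1)] unfolding tail_hits_def by blast
    define X where "X = {m. m < - int N} \<union> H"
    have X_far: "\<bar>m\<bar> > K2" if "m \<in> X" for m using that H(1) NN(3) K2 by (auto simp: X_def)
    note sumX = summable_on_shift[OF sum]
    have split_X: "(\<Sum>\<^sub>\<infinity>m\<in>X. f m) = (\<Sum>\<^sub>\<infinity>m\<in>{m. m < - int N}. f m) + (\<Sum>\<^sub>\<infinity>m\<in>H. f m)"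
      if "f summable_on UNIV" for f :: "int \<Rightarrow> real"
      unfolding X_def using H(1) K2
      by (intro infsum_Un_disjoint summable_on_subset[OF that]) force+
    define tF where "tF = (\<lambda>j. if - j \<in> X then s1 j else 0)"
    have tF: "\<bar>tF j\<bar> \<le> int M" for j
      using s1(2)[of j] X_far[of "-j"] K2 by (auto simp: tF_def)
    define v0 where "v0 = conv \<rho> tF 0"
    have v0: "\<bar>v0\<bar> \<le> M * V N + \<kappa> * (M * V N)"
    proof -
      have "\<bar>v0\<bar> \<le> 0 * (\<Sum>\<^sub>\<infinity>m. \<bar>\<rho> m\<bar>) + M * (\<Sum>\<^sub>\<infinity>m\<in>X. \<bar>\<rho> m\<bar>)"
        unfolding v0_def conv_def
      proof (rule infsum_mult_bounded_le[OF sum])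
        fix m show "\<bar>real_of_int (tF (0 - m))\<bar> \<le> 0 + real M"
          using tF[of "0 - m"] by linarith
      qed (auto simp: tF_def)
      also have "(\<Sum>\<^sub>\<infinity>m\<in>X. \<bar>\<rho> m\<bar>) \<le> V N + \<kappa> * V N"
        using split_X[OF sum] right_mass_infsum[OF sum, of N] H(2)[of 0] by simp
      finally have "\<bar>v0\<bar> \<le> M * (V N + \<kappa> * V N)" by (simp add: mult_left_mono)
      thus ?thesis by (simp add: algebra_simps)
    qed
    \<comment> \<open>One of the two signs of the change x leads to a value within reach.\<close>
    obtain \<sigma> :: real where \<sigma>: "\<bar>\<sigma>\<bar> = 1" "\<bar>v0 + \<sigma> * x\<bar> \<le> M * V N"
    proof -
      have "\<kappa> * (M * V N) \<le> c * (M * V N)"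
        using \<open>\<kappa> \<le> c\<close> V_pos[of N] by (intro mult_right_mono) (auto intro!: mult_nonneg_nonneg intro: less_imp_le)
      hence "\<kappa> * (M * V N) \<le> x" using N(3) by linarith
      hence "\<bar>v0 + (if v0 \<ge> 0 then -1 else 1) * x\<bar> \<le> M * V N"
        using v0 N(2) x(1) by (auto simp: abs_if split: if_splits)
      thus ?thesis by (intro that[of "if v0 \<ge> 0 then -1 else 1"]) auto
    qed
    obtain t where t: "\<And>j. \<bar>t j\<bar> \<le> int M" "\<And>j. j \<le> int N \<Longrightarrow> -j \<notin> H \<Longrightarrow> t j = 0" "conv \<rho> t 0 = v0 + \<sigma> * x"
      using H(3)[OF \<sigma>(2)] by blast
    have t0: "t j = 0" if "- j \<notin> X" for j by (rule t(2)) (use that in \<open>auto simp: X_def\<close>)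
    define s where "s = (\<lambda>j. if - j \<in> X then t j else s1 j)"
    define \<Delta> where "\<Delta> = (\<lambda>j. s j - s1 j)"
    have \<Delta>: "\<Delta> j = t j - tF j" for j using t0[of j] by (auto simp: \<Delta>_def s_def tF_def)
    have \<Delta>0: "\<Delta> j = 0" if "- j \<notin> X" for j using that by (simp add: \<Delta>_def s_def)
    have \<Delta>M: "\<bar>real_of_int (\<Delta> j)\<bar> \<le> 2 * real M" for j
      unfolding \<Delta> using t(1)[of j] tF[of j] by linarith
    have sB: "\<bar>s j\<bar> \<le> B" for j using t(1)[of j] s1(1)[of j] B by (simp add: s_def)
    have sM: "\<bar>s j\<bar> \<le> int M" if "\<bar>j\<bar> \<ge> K1" for j using t(1)[of j] s1(2)[OF that] by (simp add: s_def)
    have conv_s: "conv \<rho> s n = conv \<rho> s1 n + conv \<rho> \<Delta> n" for n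
      using conv_diff_self[OF sum, of s B s1 B n] sB s1(1) by (simp add: \<Delta>_def)
    have \<Delta>_at_0: "conv \<rho> \<Delta> 0 = \<sigma> * x"
      using conv_diff_self[OF sum, of t "int M" tF "int M" 0] t(1,3) tF
      by (simp add: \<Delta>[abs_def] v0_def)
    have \<Delta>_near: "\<bar>conv \<rho> \<Delta> n\<bar> \<le> \<epsilon>" if "\<bar>n\<bar> < L" for n
    proof -
      have "\<bar>conv \<rho> \<Delta> n\<bar> \<le> 0 * (\<Sum>\<^sub>\<infinity>m. \<bar>\<rho> m\<bar>) + (2 * M) * (\<Sum>\<^sub>\<infinity>m\<in>{m. \<bar>m\<bar> > T}. \<bar>\<rho> m\<bar>)"
        unfolding conv_def
      proof (rule infsum_mult_bounded_le[OF sum])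
        fix m assume m: "m \<notin> {m. \<bar>m\<bar> > T}"
        have "- (n - m) \<notin> X" using X_far[of "- (n - m)"] K2 m that by auto
        thus "\<bar>real_of_int (\<Delta> (n - m))\<bar> \<le> 0" using \<Delta>0 by simp
      next
        fix m show "\<bar>real_of_int (\<Delta> (n - m))\<bar> \<le> 0 + real (2 * M)" using \<Delta>M[of "n - m"] by simp
      qed auto
      also have "\<dots> \<le> (2 * M) * (\<epsilon> / (2 * M))" using mult_left_mono[OF less_imp_le[OF T(2)], of "2 * real M"] by simp
      also have "\<dots> = \<epsilon>" using M_pos by simp
      finally show ?thesis .
    qed
    \<comment> \<open>Dividing by the small number w turns closeness of the two effects into growth at n.\<close>
    have \<Delta>_E: "\<bar>conv \<rho> \<Delta> n\<bar> \<ge> x" if n: "n \<in> E" "n \<noteq> 0" for n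
    proof -
      have n0: "n > 0" using E(2)[OF n(1)] n(2) by simp
      define w where "w = \<theta> ^ nat n"
      have w: "\<bar>w\<bar> \<le> \<bar>\<theta>\<bar>"
      proof -
        have "\<bar>\<theta>\<bar> ^ nat n \<le> \<bar>\<theta>\<bar> ^ 1" using n0 \<theta> by (intro power_decreasing) auto
        thus ?thesis by (simp add: w_def power_abs)
      qed
      define f where "f m = w * \<rho> (n + m) - \<rho> m" for m
      have "0 \<le> 2 * real M" by (intro mult_nonneg_nonneg) auto
      note two = conv_two_positions[OF sum, where \<Delta> = \<Delta> and B = "2 * real M" and X = X and w = w and n = n,
          OF \<Delta>M \<Delta>0 this, folded f_def]
      have f': "(\<lambda>m. \<bar>f m\<bar>) summable_on Y" for Y by (rule two(2))
      have "\<bar>w * conv \<rho> \<Delta> n - conv \<rho> \<Delta> 0\<bar> \<le> 2 * real M * (\<Sum>\<^sub>\<infinity>m\<in>X. \<bar>f m\<bar>)" by (rule two(1))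
      also have "(\<Sum>\<^sub>\<infinity>m\<in>X. \<bar>f m\<bar>) \<le> 3 * \<kappa> * V N"
      proof -
        have "(\<Sum>\<^sub>\<infinity>m\<in>{m. m < - int N}. \<bar>f m\<bar>) \<le> (\<Sum>\<^sub>\<infinity>m\<in>{m. m < - int N}. \<kappa> * \<bar>\<rho> m\<bar>)"
        proof (rule infsum_mono[OF f'])
          show "(\<lambda>m. \<kappa> * \<bar>\<rho> m\<bar>) summable_on {m. m < - int N}"
            by (intro summable_on_cmult_right summable_on_subset[OF sum]) auto
          fix m assume m: "m \<in> {m. m < - int N}"
          thus "\<bar>f m\<bar> \<le> \<kappa> * \<bar>\<rho> m\<bar>"
            using N3[of "nat (- m)" n] NN(2) n(1) by (auto simp: f_def w_def)
        qed
        also have "\<dots> = \<kappa> * V N" by (simp add: infsum_cmult_right' right_mass_infsum[OF sum])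
        finally have r: "(\<Sum>\<^sub>\<infinity>m\<in>{m. m < - int N}. \<bar>f m\<bar>) \<le> \<kappa> * V N" .
        have "(\<Sum>\<^sub>\<infinity>m\<in>H. \<bar>f m\<bar>) \<le> (\<Sum>\<^sub>\<infinity>m\<in>H. \<bar>w\<bar> * \<bar>\<rho> (n + m)\<bar> + \<bar>\<rho> m\<bar>)"
        proof (rule infsum_mono[OF f'])
          show "(\<lambda>m. \<bar>w\<bar> * \<bar>\<rho> (n + m)\<bar> + \<bar>\<rho> m\<bar>) summable_on H"
            using sumX[of 0 H] by (intro summable_on_add summable_on_cmult_right sumX) simp
          show "\<bar>f m\<bar> \<le> \<bar>w\<bar> * \<bar>\<rho> (n + m)\<bar> + \<bar>\<rho> m\<bar>" for m
            unfolding f_def using abs_triangle_ineq4[of "w * \<rho> (n + m)" "\<rho> m"] by (simp add: abs_mult)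
        qed
        also have "\<dots> = \<bar>w\<bar> * (\<Sum>\<^sub>\<infinity>m\<in>H. \<bar>\<rho> (n + m)\<bar>) + (\<Sum>\<^sub>\<infinity>m\<in>H. \<bar>\<rho> m\<bar>)"
          using sumX[of 0 H] by (subst infsum_add) (auto intro!: summable_on_cmult_right sumX simp: infsum_cmult_right')
        also have "\<dots> \<le> 1 * (\<kappa> * V N) + \<kappa> * V N"
          using H(2)[of n] H(2)[of 0] n0 w \<theta> by (intro add_mono mult_mono) (auto intro!: infsum_nonneg)
        finally have "(\<Sum>\<^sub>\<infinity>m\<in>H. \<bar>f m\<bar>) \<le> 2 * (\<kappa> * V N)" by simp
        with r split_X[OF f'] show ?thesis by simp
      qed
      finally have "\<bar>w * conv \<rho> \<Delta> n - conv \<rho> \<Delta> 0\<bar> \<le> 2 * M * (3 * \<kappa> * V N)"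
        by (simp add: mult_left_mono)
      also have "\<dots> = 6 * \<kappa> * (M * V N)" by simp
      also have "\<dots> = (1 - \<bar>\<theta>\<bar>) * (c * (M * V N))" unfolding \<kappa>(2) by (simp add: mult_ac)
      also have "\<dots> \<le> (1 - \<bar>\<theta>\<bar>) * x" using N(3) \<theta> by (intro mult_left_mono) auto
      finally have "x - (1 - \<bar>\<theta>\<bar>) * x \<le> \<bar>w\<bar> * \<bar>conv \<rho> \<Delta> n\<bar>"
        using \<Delta>_at_0 \<sigma>(1) x(1) abs_triangle_ineq2[of "conv \<rho> \<Delta> 0" "conv \<rho> \<Delta> 0 - w * conv \<rho> \<Delta> n"]
        by (simp add: abs_mult abs_minus_commute)
      also have "\<dots> \<le> \<bar>\<theta>\<bar> * \<bar>conv \<rho> \<Delta> n\<bar>" using w by (intro mult_right_mono) auto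
      finally have "\<bar>\<theta>\<bar> * x \<le> \<bar>\<theta>\<bar> * \<bar>conv \<rho> \<Delta> n\<bar>" by (simp add: algebra_simps)
      thus ?thesis using \<theta> by simp
    qed
    show ?thesis
      by (rule exI[of _ s]) (use sB sM \<Delta>_at_0 \<sigma>(1) x(1) \<Delta>_E \<Delta>_near in \<open>simp add: conv_s abs_mult\<close>)
  qed
  ultimately show ?thesis using that by blast
qed

text \<open>
  Starting from digits with value 1/2 at 0, the positions where the distance is 1/2 form a finite set \<open>E\<close>, since
  the values far out are bounded by \<open>M S < 1/2\<close>. After a shift 0 is the least element of \<open>E\<close>. A change that moves the value at
  0 by \<open>x\<close> lowers the distance there to \<open>1/2 - x\<close> and lowers it at least as much at the rest of \<open>E\<close>, while all
  other positions stay below a fixed bound. So \<open>1/2 - x\<close> is the maximum.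
\<close>

lemma half_neighbourhood_peaks:
  fixes S :: real
  defines "S \<equiv> (\<Sum>\<^sub>\<infinity>m. \<bar>\<rho> m\<bar>)"
  assumes small: "M * S < 1/2"
  obtains v where "v < 1/2" "M * S \<le> v" "\<forall>\<tau>. v \<le> \<tau> \<and> \<tau> \<le> 1/2 \<longrightarrow> peak_value \<rho> M \<tau>"
proof -
  let ?d = dist_nearest_int
  obtain s0 B K0 where s0: "B \<ge> int M" "K0 \<ge> 0" "\<And>j. \<bar>s0 j\<bar> \<le> B" "\<And>j. \<bar>j\<bar> \<ge> K0 \<Longrightarrow> \<bar>s0 j\<bar> \<le> int M"
    "conv \<rho> s0 0 = 1/2"
    by (rule conv_attains_half) (rule that)
  define g1 where "g1 = (1/2 - M * S) / 2"
  have g1: "g1 > 0" "M * S + g1 < 1/2" using small by (auto simp: g1_def field_simps)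
  have B0: "B \<ge> 0" using s0(1) by simp
  note half0 = dist_nearest_int_half
  have d_le: "?d x \<le> c" if "\<bar>x\<bar> \<le> c" for x c using dist_nearest_int_le_abs[of x] that by linarith
  \<comment> \<open>Move the leftmost place where 1/2 is attained to 0.\<close>
  define E0 where "E0 = {n. ?d (conv \<rho> s0 n) = 1/2}"
  have finE0: "finite E0"
  proof -
    obtain L where "L \<ge> 0" and L: "\<forall>s n. (\<forall>j. \<bar>s j\<bar> \<le> B) \<and> (\<forall>j. \<bar>j\<bar> \<ge> K0 \<longrightarrow> \<bar>s j\<bar> \<le> int M) \<and> \<bar>n\<bar> \<ge> L \<longrightarrow>
      \<bar>conv \<rho> s n\<bar> \<le> M * S + g1"
      by (rule conv_far_bound[OF sum g1(1) B0 s0(2), where M = M, folded S_def]) (rule that)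
    have "E0 \<subseteq> {-L..L}"
    proof
      fix n assume "n \<in> E0"
      hence "\<not> \<bar>conv \<rho> s0 n\<bar> \<le> M * S + g1" using d_le[of "conv \<rho> s0 n" "M * S + g1"] g1 by (auto simp: E0_def)
      hence "\<not> \<bar>n\<bar> \<ge> L" using L s0(3,4) by blast
      thus "n \<in> {-L..L}" by auto
    qed
    thus ?thesis using finite_subset by blast
  qed
  have "0 \<in> E0" by (simp add: E0_def s0(5) half0)
  define n0 where "n0 = Min E0"
  have n0: "n0 \<in> E0" "\<And>n. n \<in> E0 \<Longrightarrow> n0 \<le> n"
    unfolding n0_def using finE0 \<open>0 \<in> E0\<close> by (auto intro: Min_in)
  define s1 where "s1 = (\<lambda>j. s0 (j + n0))"
  define K1 where "K1 = K0 + \<bar>n0\<bar>"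
  have s1: "\<And>j. \<bar>s1 j\<bar> \<le> B" "\<And>j. \<bar>j\<bar> \<ge> K1 \<Longrightarrow> \<bar>s1 j\<bar> \<le> int M" "K1 \<ge> 0"
    using s0 by (auto simp: s1_def K1_def)
  have conv_s1: "conv \<rho> s1 n = conv \<rho> s0 (n + n0)" for n unfolding s1_def by (rule conv_shift)
  define E where "E = {n. ?d (conv \<rho> s1 n) = 1/2}"
  have "0 \<in> E" using n0(1) by (simp add: E_def conv_s1 E0_def)
  have E_nonneg: "n \<ge> 0" if "n \<in> E" for n
    using n0(2)[of "n + n0"] that by (simp add: E_def conv_s1 E0_def)
  obtain L where L: "L \<ge> 0" "\<forall>s n. (\<forall>j. \<bar>s j\<bar> \<le> B) \<and> (\<forall>j. \<bar>j\<bar> \<ge> K1 \<longrightarrow> \<bar>s j\<bar> \<le> int M) \<and> \<bar>n\<bar> \<ge> L \<longrightarrow>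
      \<bar>conv \<rho> s n\<bar> \<le> M * S + g1"
    by (rule conv_far_bound[OF sum g1(1) B0 s1(3), where M = M, folded S_def]) (rule that)
  have E_L: "\<bar>n\<bar> < L" if "n \<in> E" for n
  proof (rule ccontr)
    assume "\<not> \<bar>n\<bar> < L"
    hence "\<bar>conv \<rho> s1 n\<bar> \<le> M * S + g1" using L(2) s1(1,2) by (simp add: not_less)
    thus False using d_le[of "conv \<rho> s1 n" "M * S + g1"] that g1(2) by (auto simp: E_def)
  qed
  have finE: "finite E" by (rule finite_subset[of _ "{-L..L}"]) (use E_L in force)+
  obtain g where g: "g > 0" "g \<le> 1/2" "\<And>n. \<bar>n\<bar> < L \<Longrightarrow> n \<notin> E \<Longrightarrow> ?d (conv \<rho> s1 n) \<le> 1/2 - g"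
  proof -
    define G where "G = insert (1/2) ((\<lambda>n. 1/2 - ?d (conv \<rho> s1 n)) ` ({-L..L} - E))"
    have "finite G" by (simp add: G_def)
    have "Min G > 0" using \<open>finite G\<close> dist_nearest_int_le_half unfolding G_def E_def
      by (subst Min_gr_iff) (auto simp: less_le)
    moreover have "?d (conv \<rho> s1 n) \<le> 1/2 - Min G" if "\<bar>n\<bar> < L" "n \<notin> E" for n
    proof -
      have "n \<in> {-L..L} - E" using that by auto
      hence "1/2 - ?d (conv \<rho> s1 n) \<in> G" unfolding G_def by blast
      hence "Min G \<le> 1/2 - ?d (conv \<rho> s1 n)" using \<open>finite G\<close> by (rule Min_le[rotated])
      thus ?thesis by simp
    qed
    moreover have "Min G \<le> 1/2" using \<open>finite G\<close> by (intro Min_le) (auto simp: G_def)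
    ultimately show ?thesis using that by blast
  qed
  obtain x0 where x0: "x0 > 0" "\<forall>x. 0 < x \<and> x \<le> x0 \<longrightarrow> (\<exists>s. (\<forall>j. \<bar>s j\<bar> \<le> B) \<and> (\<forall>j. \<bar>j\<bar> \<ge> K1 \<longrightarrow> \<bar>s j\<bar> \<le> int M) \<and>
     \<bar>conv \<rho> s 0 - conv \<rho> s1 0\<bar> = x \<and> (\<forall>n\<in>E. n \<noteq> 0 \<longrightarrow> x \<le> \<bar>conv \<rho> s n - conv \<rho> s1 n\<bar>) \<and>
     (\<forall>n. \<bar>n\<bar> < L \<longrightarrow> \<bar>conv \<rho> s n - conv \<rho> s1 n\<bar> \<le> g/2))"
    by (rule redigit[OF s1(1,2) s0(1) s1(3) L(1) finE E_nonneg, where \<epsilon> = "g/2"]) (use g in auto)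
  define v where "v = max (M * S + g1) (max (1/2 - g/2) (1/2 - x0))"
  have vs: "M * S + g1 \<le> v" "1/2 - g/2 \<le> v" "1/2 - x0 \<le> v" by (simp_all add: v_def)
  have "v < 1/2" using g1 g(1) x0(1) unfolding v_def max_less_iff_conj by (intro conjI) linarith+
  moreover have "M * S \<le> v" using g1 vs(1) by linarith
  moreover have "peak_value \<rho> M \<tau>" if \<tau>: "v \<le> \<tau>" "\<tau> \<le> 1/2" for \<tau>
  proof (cases "\<tau> = 1/2")
    case True
    have h: "?d (conv \<rho> s0 0) = 1/2" unfolding s0(5) by (rule half0)
    show ?thesis unfolding True peak_value_def
      by (rule exI[of _ s0], rule exI[of _ B], rule exI[of _ K0], rule exI[of _ 0])
         (use s0(3,4) h dist_nearest_int_le_half in blast)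
  next
    case False
    define x where "x = 1/2 - \<tau>"
    have x: "x > 0" "x \<le> x0" using \<tau> False vs(3) unfolding x_def by linarith+
    from x0(2)[THEN spec, THEN mp, OF conjI[OF x]] obtain s where s: "\<forall>j. \<bar>s j\<bar> \<le> B" "\<forall>j. \<bar>j\<bar> \<ge> K1 \<longrightarrow> \<bar>s j\<bar> \<le> int M"
      "\<bar>conv \<rho> s 0 - conv \<rho> s1 0\<bar> = x" "\<forall>n\<in>E. n \<noteq> 0 \<longrightarrow> x \<le> \<bar>conv \<rho> s n - conv \<rho> s1 n\<bar>"
      "\<forall>n. \<bar>n\<bar> < L \<longrightarrow> \<bar>conv \<rho> s n - conv \<rho> s1 n\<bar> \<le> g/2" by (elim exE conjE) (rule that)
    have at_E: "?d (conv \<rho> s n) = 1/2 - \<bar>conv \<rho> s n - conv \<rho> s1 n\<bar>" if "n \<in> E" for n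
    proof -
      have "\<bar>conv \<rho> s n - conv \<rho> s1 n\<bar> \<le> g/2" using s(5) E_L[OF that] by blast
      hence "?d (conv \<rho> s1 n + (conv \<rho> s n - conv \<rho> s1 n)) = 1/2 - \<bar>conv \<rho> s n - conv \<rho> s1 n\<bar>"
        using that g(1,2) by (intro dist_nearest_int_half_plus) (auto simp: E_def)
      thus ?thesis by simp
    qed
    have at_0: "?d (conv \<rho> s 0) = \<tau>" using at_E[OF \<open>0 \<in> E\<close>] s(3) by (simp add: x_def)
    have le: "?d (conv \<rho> s n) \<le> \<tau>" for n
    proof -
      consider "\<bar>n\<bar> \<ge> L" | "\<bar>n\<bar> < L" "n \<notin> E" | "n = 0" | "n \<in> E" "n \<noteq> 0" by linarith
      thus ?thesis
      proof cases
        case 1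
        have "\<bar>conv \<rho> s n\<bar> \<le> M * S + g1" using L(2) s(1,2) 1 by blast
        also have "\<dots> \<le> \<tau>" using vs(1) \<tau>(1) by linarith
        finally show ?thesis by (rule d_le)
      next
        case 2
        have "?d (conv \<rho> s n) \<le> ?d (conv \<rho> s1 n) + \<bar>conv \<rho> s n - conv \<rho> s1 n\<bar>"
          by (rule dist_nearest_int_lipschitz)
        also have "\<dots> \<le> (1/2 - g) + g/2" using g(3)[OF 2] s(5) 2(1) by (intro add_mono) auto
        also have "\<dots> \<le> \<tau>" using \<tau>(1) vs(2) by simp
        finally show ?thesis .
      next
        case 3
        thus ?thesis using at_0 by simp
      next
        case 4
        hence "x \<le> \<bar>conv \<rho> s n - conv \<rho> s1 n\<bar>" using s(4) by blast
        thus ?thesis unfolding at_E[OF 4(1)] x_def by linarith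
      qed
    qed
    show ?thesis unfolding peak_value_def
      by (rule exI[of _ s], rule exI[of _ B], rule exI[of _ K1], rule exI[of _ 0])
         (use at_0 s(1,2) le in blast)
  qed
  ultimately show ?thesis using that by blast
qed

end

section \<open>Partial fractions and the kernel of a hyperbolic polynomial\<close>

lemma has_contour_integral_powi_circlepath:
  fixes r :: real and m :: int
  assumes "r > 0"
  shows "((\<lambda>z. z powi m) has_contour_integral (if m = -1 then 2 * of_real pi * \<i> else 0)) (circlepath 0 r)"
proof (cases "m = -1")
  case True
  have "((\<lambda>w. 1 / (w - 0)) has_contour_integral 2 * of_real pi * \<i> * 1) (circlepath 0 r)"
    using Cauchy_integral_circlepath_simple[of "\<lambda>_. 1" 0 r 0] assms by simp
  thus ?thesis using True by (simp add: power_int_minus inverse_eq_divide)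
next
  case False
  have "((\<lambda>z. z powi m) has_contour_integral 0) (circlepath 0 r)"
  proof (rule Cauchy_theorem_primitive[where S = "-{0}" and f = "\<lambda>z. z powi (m + 1) / of_int (m + 1)"])
    fix x :: complex assume "x \<in> -{0}"
    thus "((\<lambda>z. z powi (m + 1) / of_int (m + 1)) has_field_derivative x powi m) (at x within - {0})"
      unfolding has_field_derivative_def using False
      by (auto intro!: derivative_eq_intros simp: fun_eq_iff field_simps simp flip: of_int_add)
  qed (use assms in auto)
  thus ?thesis using False by simp
qed

text \<open>
  Both directions of the induction on \<open>n\<close> use \<open>z ^ n / (z - a) = z ^ (n - 1) + a z ^ (n - 1) / (z - a)\<close>, whose first summand
  contributes only when \<open>n = 0\<close>.
\<close>

lemma has_contour_integral_powi_over_linear: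
  fixes r :: real and n :: int and a :: complex
  assumes r: "r > 0" and a: "a \<noteq> 0" "norm a \<noteq> r"
  shows "((\<lambda>z. z powi (n - 1) / (z - a)) has_contour_integral (2 * of_real pi * \<i>) *
     (if norm a < r then (if n \<ge> 1 then a powi (n - 1) else 0) else (if n \<ge> 1 then 0 else - (a powi (n - 1)))))
     (circlepath 0 r)"
  (is "(?f n has_contour_integral _ * ?c n) _")
proof -
  have on_circle: "z \<noteq> 0" "z \<noteq> a" if "z \<in> path_image (circlepath 0 r)" for z
    using that r a by auto
  show ?thesis
  proof (induction n rule: int_induct[where k = 1])
    case base
    show ?case
    proof (cases "norm a < r")
      case True
      thus ?thesis using Cauchy_integral_circlepath_simple[of "\<lambda>_. 1" 0 r a] by simp
    next
      case False
      hence "norm a > r" using a by simp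
      have "((\<lambda>z. 1 / (z - a)) has_contour_integral 0) (circlepath 0 r)"
        by (rule Cauchy_theorem_convex_simple[of _ "cball 0 r"])
           (use \<open>norm a > r\<close> r in \<open>auto intro!: holomorphic_intros\<close>)
      thus ?thesis using False by simp
    qed
  next
    case (step1 i)
    have "((\<lambda>z. z powi (i - 1) + a * ?f i z) has_contour_integral 
       (if i - 1 = -1 then 2 * of_real pi * \<i> else 0) + a * ((2 * of_real pi * \<i>) * ?c i)) (circlepath 0 r)"
      by (intro has_contour_integral_add has_contour_integral_lmul has_contour_integral_powi_circlepath r step1.IH)
    moreover have "(if i - 1 = -1 then 2 * of_real pi * \<i> else 0) + a * ((2 * of_real pi * \<i>) * ?c i) =
      (2 * of_real pi * \<i>) * ?c (i + 1)"
      using step1.hyps a power_int_minus_mult[of a i] by (simp add: mult_ac)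
    ultimately have "((\<lambda>z. z powi (i - 1) + a * ?f i z) has_contour_integral (2 * of_real pi * \<i>) * ?c (i + 1)) (circlepath 0 r)"
      by simp
    thus ?case
    proof (rule has_contour_integral_eq)
      fix z assume "z \<in> path_image (circlepath 0 r)"
      hence z: "z \<noteq> 0" "z - a \<noteq> 0" using on_circle by auto
      have "z powi i = z powi (i - 1) * z" using z by (simp add: power_int_minus_mult)
      thus "z powi (i - 1) + a * ?f i z = ?f (i + 1) z"
        using z(2) by (simp add: field_simps)
    qed
  next
    case (step2 i)
    have "((\<lambda>z. (?f i z - z powi (i - 2)) / a) has_contour_integral 
       ((2 * of_real pi * \<i>) * ?c i - (if i - 2 = -1 then 2 * of_real pi * \<i> else 0)) / a) (circlepath 0 r)"
      by (intro has_contour_integral_diff has_contour_integral_div has_contour_integral_powi_circlepath r step2.IH)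
    moreover have "((2 * of_real pi * \<i>) * ?c i - (if i - 2 = -1 then 2 * of_real pi * \<i> else 0)) / a =
      (2 * of_real pi * \<i>) * ?c (i - 1)"
      using step2.hyps a power_int_minus_mult[of a "i - 1"]
      by (cases "i = 1") (auto simp: field_simps power_int_minus)
    ultimately have "((\<lambda>z. (?f i z - z powi (i - 2)) / a) has_contour_integral (2 * of_real pi * \<i>) * ?c (i - 1)) (circlepath 0 r)"
      by simp
    thus ?case
    proof (rule has_contour_integral_eq)
      fix z assume "z \<in> path_image (circlepath 0 r)"
      hence z: "z \<noteq> 0" "z - a \<noteq> 0" using on_circle by auto
      have "z powi (i - 1) = z powi (i - 2) * z" using z power_int_minus_mult[of z "i - 1"] by simp
      thus "(?f i z - z powi (i - 2)) / a = ?f (i - 1) z"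
        using z(2) a by (simp add: field_simps)
    qed
  qed
qed

locale hyperbolic_roots =
  fixes P :: "int poly" and r1 r2 :: nat and \<alpha> :: "nat \<Rightarrow> complex"
  assumes adm: "admissible_poly P" and ord: "root_ordering P r1 r2 \<alpha>"
    and monic: "lead_coeff P = 1" and hyp: "hyperbolic_poly P"
begin

abbreviation "d \<equiv> degree P"
abbreviation "p \<equiv> r1 + 2 * r2"

text \<open>
  The derivative of \<open>P\<close> at the root \<open>\<alpha> i\<close>; the residues of \<open>1 / P\<close> are the numbers \<open>1 / D i\<close>.
\<close>

definition D :: "nat \<Rightarrow> complex" where "D i = poly (pderiv (cpoly P)) (\<alpha> i)"

lemma cpoly_eq: "cpoly P = (\<Prod>i = 1..d. [:- \<alpha> i, 1:])"
  using ord monic by (simp add: root_ordering_def)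

lemma d_pos: "d \<ge> 1" and p_le_d: "p \<le> d"
  using adm ord by (auto simp: admissible_poly_def root_ordering_def)

lemma poly_cpoly: "poly (cpoly P) z = (\<Prod>i = 1..d. (z - \<alpha> i))"
  by (simp add: cpoly_eq poly_prod)

lemma root_iff: "poly (cpoly P) z = 0 \<longleftrightarrow> (\<exists>i\<in>{1..d}. z = \<alpha> i)"
  by (auto simp: poly_cpoly)

lemma root: "i \<in> {1..d} \<Longrightarrow> poly (cpoly P) (\<alpha> i) = 0"
  using root_iff by blast

lemma norm_expanding: "i \<in> {1..p} \<Longrightarrow> norm (\<alpha> i) > 1"
  using ord by (auto simp: root_ordering_def)

lemma norm_contracting: "i \<in> {p+1..d} \<Longrightarrow> norm (\<alpha> i) < 1"
  using ord hyp root[of i] by (force simp: root_ordering_def hyperbolic_poly_def less_le)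

lemma coeff0_nonzero: "coeff P 0 \<noteq> 0"
  using adm by (simp add: admissible_poly_def)

lemma root_nonzero: "i \<in> {1..d} \<Longrightarrow> \<alpha> i \<noteq> 0"
  using root[of i] coeff0_nonzero by (auto simp: poly_0_coeff_0 coeff_map_poly)

lemma D_sum: "D i = (\<Sum>a\<in>{1..d}. \<Prod>j\<in>{1..d}-{a}. (\<alpha> i - \<alpha> j))"
  by (simp add: D_def cpoly_eq pderiv_prod poly_sum poly_prod pderiv_pCons)

lemma D_nonzero: "i \<in> {1..d} \<Longrightarrow> D i \<noteq> 0"
  using adm root[of i] by (auto simp: D_def admissible_poly_def rsquarefree_roots)

lemma inj_\<alpha>: "inj_on \<alpha> {1..d}"
proof (rule inj_onI, rule ccontr)
  fix i j assume ij: "i \<in> {1..d}" "j \<in> {1..d}" "\<alpha> i = \<alpha> j" "i \<noteq> j"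
  have z: "(\<Prod>b\<in>{1..d}-{a}. (\<alpha> i - \<alpha> b)) = 0" for a
  proof (rule prod_zero)
    show "\<exists>b\<in>{1..d}-{a}. \<alpha> i - \<alpha> b = 0"
    proof (cases "a = i")
      case True
      show ?thesis by (rule bexI[of _ j]) (use ij True in auto)
    next
      case False
      show ?thesis by (rule bexI[of _ i]) (use ij False in auto)
    qed
  qed simp
  have "D i = 0" unfolding D_sum by (rule sum.neutral) (blast intro: z)
  thus False using D_nonzero[OF ij(1)] by simp
qed

lemma D_prod: 
  assumes i: "i \<in> {1..d}" shows "D i = (\<Prod>j\<in>{1..d}-{i}. (\<alpha> i - \<alpha> j))"
proof -
  have "(\<Prod>j\<in>{1..d}-{a}. (\<alpha> i - \<alpha> j)) = 0" if "a \<noteq> i" for a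
    using that i by (auto intro!: prod_zero bexI[of _ i])
  hence "D i = (\<Sum>a\<in>{1..d}. if a = i then \<Prod>j\<in>{1..d}-{i}. (\<alpha> i - \<alpha> j) else 0)"
    unfolding D_sum by (intro sum.cong) auto
  thus ?thesis using i by simp
qed

lemma lagrange:
  assumes "degree q < d"
  shows "q = (\<Sum>i=1..d. smult (poly q (\<alpha> i) / D i) (\<Prod>j\<in>{1..d}-{i}. [:- \<alpha> j, 1:]))" (is "q = ?R")
proof (rule poly_eqI_degree[where A = "\<alpha> ` {1..d}"])
  fix x assume "x \<in> \<alpha> ` {1..d}"
  then obtain k where k: "k \<in> {1..d}" "x = \<alpha> k" by blast
  have "poly ?R x = (\<Sum>i=1..d. poly q (\<alpha> i) / D i * (\<Prod>j\<in>{1..d}-{i}. (\<alpha> k - \<alpha> j)))"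
    by (simp add: poly_sum poly_prod k)
  also have "\<dots> = (\<Sum>i=1..d. if i = k then poly q (\<alpha> k) / D k * D k else 0)"
  proof (rule sum.cong)
    fix i assume "i \<in> {1..d}"
    show "poly q (\<alpha> i) / D i * (\<Prod>j\<in>{1..d}-{i}. (\<alpha> k - \<alpha> j)) = (if i = k then poly q (\<alpha> k) / D k * D k else 0)"
    proof (cases "i = k")
      case True thus ?thesis using D_prod[OF k(1)] by simp
    next
      case False
      hence "(\<Prod>j\<in>{1..d}-{i}. (\<alpha> k - \<alpha> j)) = 0" using k by (auto intro!: prod_zero bexI[of _ k])
      thus ?thesis using False by simp
    qed
  qed simp
  also have "\<dots> = poly q x" using k D_nonzero[OF k(1)] by simp
  finally show "poly q x = poly ?R x" by simp
next
  have c: "card (\<alpha> ` {1..d}) = d" using card_image[OF inj_\<alpha>] by simp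
  show "degree q < card (\<alpha> ` {1..d})" using assms c by simp
  have "degree ?R \<le> d - 1"
  proof (rule degree_sum_le)
    fix i assume i: "i \<in> {1..d}"
    have "degree (\<Prod>j\<in>{1..d}-{i}. [:- \<alpha> j, 1:]) \<le> (\<Sum>j\<in>{1..d}-{i}. 1)"
      by (rule order_trans[OF degree_prod_sum_le]) (auto simp: o_def)
    also have "\<dots> = d - 1" using i by simp
    finally show "degree (smult (poly q (\<alpha> i) / D i) (\<Prod>j\<in>{1..d}-{i}. [:- \<alpha> j, 1:])) \<le> d - 1"
      by (intro order_trans[OF degree_smult_le])
  qed simp
  thus "degree ?R < card (\<alpha> ` {1..d})" using c d_pos by simp
qed

lemma coeff_prod_linear:
  "finite A \<Longrightarrow> coeff (\<Prod>j\<in>A. [:- (f j :: complex), 1:]) (card A) = 1"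
proof -
  assume A: "finite A"
  have "degree (\<Prod>j\<in>A. [:- f j, 1:]) = card A"
    using A by (subst degree_prod_eq_sum_degree) auto
  moreover have "lead_coeff (\<Prod>j\<in>A. [:- f j, 1:]) = 1"
    by (simp add: lead_coeff_prod)
  ultimately show ?thesis by simp
qed

text \<open>
  Euler's identity, by comparison of the coefficients of degree \<open>d - 1\<close> in Lagrange's interpolation formula.
\<close>

lemma sum_over_roots:
  assumes "degree q < d"
  shows "(\<Sum>i=1..d. poly q (\<alpha> i) / D i) = coeff q (d - 1)"
proof -
  have "coeff q (d - 1) = (\<Sum>i=1..d. poly q (\<alpha> i) / D i * coeff (\<Prod>j\<in>{1..d}-{i}. [:- \<alpha> j, 1:]) (d - 1))"
    by (subst lagrange[OF assms]) (simp add: coeff_sum)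
  also have "\<dots> = (\<Sum>i=1..d. poly q (\<alpha> i) / D i)"
  proof (rule sum.cong)
    fix i assume "i \<in> {1..d}"
    hence "card ({1..d}-{i}) = d - 1" by simp
    thus "poly q (\<alpha> i) / D i * coeff (\<Prod>j\<in>{1..d}-{i}. [:- \<alpha> j, 1:]) (d - 1) = poly q (\<alpha> i) / D i"
      using coeff_prod_linear[of "{1..d}-{i}" \<alpha>] by simp
  qed simp
  finally show ?thesis by simp
qed

lemma partial_fractions:
  assumes "poly (cpoly P) z \<noteq> 0"
  shows "1 / poly (cpoly P) z = (\<Sum>i=1..d. 1 / (D i * (z - \<alpha> i)))"
proof -
  have "1 = poly (\<Sum>i=1..d. smult (poly 1 (\<alpha> i) / D i) (\<Prod>j\<in>{1..d}-{i}. [:- \<alpha> j, 1:])) z"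
    using d_pos by (subst lagrange[symmetric]) auto
  also have "\<dots> = (\<Sum>i=1..d. 1 / D i * (\<Prod>j\<in>{1..d}-{i}. (z - \<alpha> j)))"
    by (simp add: poly_sum poly_prod)
  also have "\<dots> = (\<Sum>i=1..d. poly (cpoly P) z * (1 / (D i * (z - \<alpha> i))))"
  proof (rule sum.cong)
    fix i assume i: "i \<in> {1..d}"
    have "poly (cpoly P) z = (z - \<alpha> i) * (\<Prod>j\<in>{1..d}-{i}. (z - \<alpha> j))"
      unfolding poly_cpoly using i by (subst prod.remove[of _ i]) auto
    moreover have "z - \<alpha> i \<noteq> 0" using assms root[OF i] by auto
    ultimately show "1 / D i * (\<Prod>j\<in>{1..d}-{i}. (z - \<alpha> j)) = poly (cpoly P) z * (1 / (D i * (z - \<alpha> i)))"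
      by simp
  qed simp
  also have "\<dots> = poly (cpoly P) z * (\<Sum>i=1..d. 1 / (D i * (z - \<alpha> i)))"
    by (simp add: sum_distrib_left)
  finally show ?thesis using assms by (simp add: field_simps)
qed

text \<open>
  The residue form of the kernel: expanding roots govern it to the left of 1, contracting roots from 1 on.
\<close>

definition rhoC :: "int \<Rightarrow> complex" where
  "rhoC n = (if n \<le> 0 then (\<Sum>i=1..p. \<alpha> i powi (n - 1) / D i) else - (\<Sum>i=p+1..d. \<alpha> i powi (n - 1) / D i))"

lemma sum_split: "(\<Sum>i=1..d. f i) = (\<Sum>i=1..p. f i) + (\<Sum>i=p+1..d. (f i :: complex))"
  using sum.ub_add_nat[of 1 p f "d - p"] p_le_d by simp

lemma rhoC_contour:
  assumes r: "1 < r" "\<And>i. i \<in> {1..p} \<Longrightarrow> r < norm (\<alpha> i)"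
  shows "((\<lambda>z. z powi (n - 1) / poly (cpoly P) z) has_contour_integral - (2 * of_real pi * \<i>) * rhoC n) (circlepath 0 r)"
proof -
  define c where "c i = (if norm (\<alpha> i) < r then (if n \<ge> 1 then \<alpha> i powi (n - 1) else 0) else
     (if n \<ge> 1 then 0 else - (\<alpha> i powi (n - 1))))" for i
  have small: "norm (\<alpha> i) < r" if "i \<in> {p+1..d}" for i using norm_contracting[OF that] r(1) by simp
  have big: "\<not> norm (\<alpha> i) < r" if "i \<in> {1..p}" for i using r(2)[OF that] by simp
  have ne: "norm (\<alpha> i) \<noteq> r" if "i \<in> {1..d}" for i
    using small[of i] r(2)[of i] that by (cases "i \<le> p") auto
  have "((\<lambda>z. \<Sum>i=1..d. 1 / D i * (z powi (n - 1) / (z - \<alpha> i))) has_contour_integral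
     (\<Sum>i=1..d. 1 / D i * (2 * of_real pi * \<i> * c i))) (circlepath 0 r)"
    unfolding c_def
    by (intro has_contour_integral_sum has_contour_integral_lmul has_contour_integral_powi_over_linear)
       (use r ne root_nonzero in auto)
  moreover have "(\<Sum>i=1..d. 1 / D i * (z powi (n - 1) / (z - \<alpha> i))) = z powi (n - 1) / poly (cpoly P) z"
    if "z \<in> path_image (circlepath 0 r)" for z
  proof -
    have "norm z = r" using that r by auto
    hence "z \<noteq> \<alpha> i" if "i \<in> {1..d}" for i using ne[OF that] by auto
    hence "poly (cpoly P) z \<noteq> 0" using root_iff by blast
    have "(\<Sum>i=1..d. 1 / D i * (z powi (n - 1) / (z - \<alpha> i))) = z powi (n - 1) * (\<Sum>i=1..d. 1 / (D i * (z - \<alpha> i)))"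
      by (simp add: sum_distrib_left)
    also have "\<dots> = z powi (n - 1) * (1 / poly (cpoly P) z)"
      using partial_fractions[OF \<open>poly (cpoly P) z \<noteq> 0\<close>] by simp
    finally show ?thesis by simp
  qed
  ultimately have "((\<lambda>z. z powi (n - 1) / poly (cpoly P) z) has_contour_integral
     (\<Sum>i=1..d. 1 / D i * (2 * of_real pi * \<i> * c i))) (circlepath 0 r)"
    by (rule has_contour_integral_eq)
  moreover have "(\<Sum>i=1..d. 1 / D i * (2 * of_real pi * \<i> * c i)) = 2 * of_real pi * \<i> * (\<Sum>i=1..d. c i / D i)"
    by (simp add: sum_distrib_left mult_ac)
  moreover have "(\<Sum>i=1..d. c i / D i) = - rhoC n"
  proof -
    have "(\<Sum>i=1..p. c i / D i) = (\<Sum>i=1..p. (if n \<le> 0 then - (\<alpha> i powi (n - 1) / D i) else 0))"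
      using big by (intro sum.cong) (auto simp: c_def)
    moreover have "(\<Sum>i=p+1..d. c i / D i) = (\<Sum>i=p+1..d. (if n \<le> 0 then 0 else \<alpha> i powi (n - 1) / D i))"
      using small by (intro sum.cong) (auto simp: c_def)
    ultimately show ?thesis unfolding sum_split by (simp add: rhoC_def sum_negf)
  qed
  ultimately show ?thesis by simp
qed

lemma rho_eq:
  assumes r: "1 < r" "\<And>i. i \<in> {1..p} \<Longrightarrow> r < norm (\<alpha> i)"
  shows "rho P r n = rhoC n"
  using contour_integral_unique[OF rhoC_contour[OF r, of n]] by (simp add: rho_def)

text \<open>
  The solution of the recurrence with characteristic polynomial \<open>P\<close> and initial values \<open>0, \<dots>, 0, 1\<close>. It is integral
  because \<open>P\<close> is monic, and it measures the difference between the kernel and the sum over the expanding roots alone.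
\<close>

definition h :: "nat \<Rightarrow> complex" where "h m = (\<Sum>i=1..d. \<alpha> i ^ m / D i)"

lemma h_initial: "m < d \<Longrightarrow> h m = (if m = d - 1 then 1 else 0)"
  using sum_over_roots[of "monom 1 m"] by (simp add: h_def poly_monom degree_monom_eq)

lemma poly_cpoly_sum: "poly (cpoly P) z = (\<Sum>k\<le>d. of_int (coeff P k) * z ^ k)"
proof -
  have "degree (cpoly P) = d" by (rule degree_map_poly) auto
  thus ?thesis by (simp add: poly_altdef coeff_map_poly)
qed

lemma h_recurrence: "(\<Sum>k\<le>d. of_int (coeff P k) * h (m + k)) = 0"
proof -
  have "(\<Sum>k\<le>d. of_int (coeff P k) * h (m + k)) = (\<Sum>k\<le>d. \<Sum>i=1..d. of_int (coeff P k) * (\<alpha> i ^ (m + k) / D i))"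
    by (simp add: h_def sum_distrib_left)
  also have "\<dots> = (\<Sum>i=1..d. \<Sum>k\<le>d. of_int (coeff P k) * (\<alpha> i ^ (m + k) / D i))"
    by (rule sum.swap)
  also have "\<dots> = (\<Sum>i=1..d. \<alpha> i ^ m / D i * poly (cpoly P) (\<alpha> i))"
    by (simp add: poly_cpoly_sum sum_distrib_left power_add mult_ac)
  also have "\<dots> = 0" by (rule sum.neutral) (use root in auto)
  finally show ?thesis .
qed

lemma h_top: "h (m + d) = - (\<Sum>k<d. of_int (coeff P k) * h (m + k))"
  using h_recurrence[of m] monic by (simp add: lessThan_Suc_atMost[symmetric] eq_neg_iff_add_eq_0 add.commute)

lemma h_Ints: "h m \<in> \<int>"
proof (induction m rule: less_induct)
  case (less m)
  show ?case
  proof (cases "m < d")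
    case True thus ?thesis by (simp add: h_initial)
  next
    case False
    have "h (m - d + d) = - (\<Sum>k<d. of_int (coeff P k) * h (m - d + k))" by (rule h_top)
    also have "\<dots> \<in> \<int>" using less False by (intro Ints_minus Ints_sum Ints_mult) auto
    finally show ?thesis using False by simp
  qed
qed

end

section \<open>Recurrence and asymptotics of the kernel\<close>

lemma power_sum_ratio:
  fixes c z :: "nat \<Rightarrow> complex"
  assumes A: "finite A" "i0 \<in> A" and "c i0 \<noteq> 0" "z i0 \<noteq> 0" and dom: "\<And>i. i \<in> A \<Longrightarrow> i \<noteq> i0 \<Longrightarrow> norm (z i) < norm (z i0)"
  shows "(\<lambda>m. (\<Sum>i\<in>A. c i * z i ^ Suc m) / (\<Sum>i\<in>A. c i * z i ^ m)) \<longlonglongrightarrow> z i0"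
proof -
  define u where "u m = (\<Sum>i\<in>A. c i * (z i / z i0) ^ m)" for m
  have lim: "u \<longlonglongrightarrow> (\<Sum>i\<in>A. if i = i0 then c i0 else 0)"
    unfolding u_def
  proof (rule tendsto_sum)
    fix i assume i: "i \<in> A"
    show "(\<lambda>m. c i * (z i / z i0) ^ m) \<longlonglongrightarrow> (if i = i0 then c i0 else 0)"
    proof (cases "i = i0")
      case True thus ?thesis using assms(4) by simp
    next
      case False
      have "norm (z i / z i0) < 1" using dom[OF i False] assms(4) by (simp add: norm_divide)
      hence "(\<lambda>m. c i * (z i / z i0) ^ m) \<longlonglongrightarrow> c i * 0"
        by (intro tendsto_mult tendsto_const LIMSEQ_power_zero)
      thus ?thesis using False by simp
    qed
  qed
  hence lim: "u \<longlonglongrightarrow> c i0" using A by simp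
  have sum_u: "(\<Sum>i\<in>A. c i * z i ^ m) = z i0 ^ m * u m" for m
    unfolding u_def sum_distrib_left using assms(4) by (intro sum.cong) (auto simp: power_divide)
  have "(\<lambda>m. z i0 * (u (Suc m) / u m)) \<longlonglongrightarrow> z i0 * (c i0 / c i0)"
    using lim LIMSEQ_Suc[OF lim] assms(3) by (intro tendsto_intros)
  moreover have "z i0 * (u (Suc m) / u m) = (\<Sum>i\<in>A. c i * z i ^ Suc m) / (\<Sum>i\<in>A. c i * z i ^ m)" for m
    unfolding sum_u using assms(4) by simp
  ultimately show ?thesis using assms(3) by simp
qed

text \<open>
  If all power sums vanished, so would \<open>\<Sum>i. c i * q (z i)\<close> for every polynomial \<open>q\<close>; the polynomial that vanishes at
  all nodes except \<open>z i0\<close> gives a contradiction.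
\<close>

lemma power_sum_nonzero:
  fixes c z :: "nat \<Rightarrow> complex"
  assumes A: "finite A" "i0 \<in> A" and "c i0 \<noteq> 0" and inj: "inj_on z A"
  obtains m where "(\<Sum>i\<in>A. c i * z i ^ m) \<noteq> 0"
proof (rule ccontr)
  assume "\<not> thesis"
  hence zero: "(\<Sum>i\<in>A. c i * z i ^ m) = 0" for m using that by blast
  have poly_zero: "(\<Sum>i\<in>A. c i * poly q (z i)) = 0" for q :: "complex poly"
  proof -
    have "(\<Sum>i\<in>A. c i * poly q (z i)) = (\<Sum>i\<in>A. \<Sum>m\<le>degree q. coeff q m * (c i * z i ^ m))"
      by (simp add: poly_altdef sum_distrib_left mult_ac)
    also have "\<dots> = (\<Sum>m\<le>degree q. coeff q m * (\<Sum>i\<in>A. c i * z i ^ m))"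
      by (subst sum.swap) (simp add: sum_distrib_left)
    finally show ?thesis by (simp add: zero)
  qed
  define q where "q = (\<Prod>j\<in>A-{i0}. [:- z j, 1:])"
  have "(\<Sum>i\<in>A. c i * poly q (z i)) = (\<Sum>i\<in>A. if i = i0 then c i0 * poly q (z i0) else 0)"
  proof (rule sum.cong)
    fix i assume i: "i \<in> A"
    have "poly q (z i) = 0" if "i \<noteq> i0"
      unfolding q_def poly_prod using i that A by (intro prod_zero bexI[of _ i]) auto
    thus "c i * poly q (z i) = (if i = i0 then c i0 * poly q (z i0) else 0)" by simp
  qed simp
  also have "\<dots> = c i0 * poly q (z i0)" using A by simp
  also have "\<dots> \<noteq> 0"
    using assms(3) inj A by (auto simp: q_def poly_prod inj_on_eq_iff)
  finally show False using poly_zero by simp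
qed

context hyperbolic_roots
begin

lemma radius_exists: "\<exists>r>1. \<forall>i\<in>{1..p}. r < norm (\<alpha> i)"
proof -
  define m where "m = Min (insert 2 ((\<lambda>i. norm (\<alpha> i)) ` {1..p}))"
  have "m > 1" unfolding m_def using norm_expanding by (subst Min_gr_iff) auto
  then obtain r where r: "1 < r" "r < m" using dense by blast
  have "m \<le> norm (\<alpha> i)" if "i \<in> {1..p}" for i unfolding m_def using that by (intro Min_le) auto
  thus ?thesis using r by (intro exI[of _ r]) force
qed

text \<open>
  The kernel is, up to sign, the fundamental solution of the recurrence: under the integral sign the left-hand side is
  \<open>z ^ (n - 1) * P z / P z\<close>.
\<close>

lemma rhoC_recurrence: "(\<Sum>k\<le>d. of_int (coeff P k) * rhoC (n + int k)) = (if n = 0 then -1 else 0)"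
proof -
  obtain r where r: "r > 1" "\<And>i. i \<in> {1..p} \<Longrightarrow> r < norm (\<alpha> i)" using radius_exists by blast
  define W where "W = 2 * of_real pi * \<i>"
  have "W \<noteq> 0" by (simp add: W_def)
  have "((\<lambda>z. \<Sum>k\<le>d. of_int (coeff P k) * (z powi (n + int k - 1) / poly (cpoly P) z)) has_contour_integral
     (\<Sum>k\<le>d. of_int (coeff P k) * (- W * rhoC (n + int k)))) (circlepath 0 r)"
    unfolding W_def by (intro has_contour_integral_sum has_contour_integral_lmul rhoC_contour r) auto
  moreover have "(\<Sum>k\<le>d. of_int (coeff P k) * (z powi (n + int k - 1) / poly (cpoly P) z)) = z powi (n - 1)"
    if "z \<in> path_image (circlepath 0 r)" for z
  proof -
    have z: "norm z = r" using that r by auto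
    have "z \<noteq> 0" using z r by auto
    have "z \<noteq> \<alpha> i" if "i \<in> {1..d}" for i
      using that z r norm_contracting[of i] r(2)[of i] by (cases "i \<le> p") auto
    hence nz: "poly (cpoly P) z \<noteq> 0" using root_iff by blast
    have "z powi (n + int k - 1) = z powi (n - 1) * z ^ k" for k
      using \<open>z \<noteq> 0\<close> power_int_add[of z "n - 1" "int k"] by (simp add: algebra_simps)
    hence "(\<Sum>k\<le>d. of_int (coeff P k) * (z powi (n + int k - 1) / poly (cpoly P) z)) =
       z powi (n - 1) * (\<Sum>k\<le>d. of_int (coeff P k) * z ^ k) / poly (cpoly P) z"
      by (simp add: sum_distrib_left sum_divide_distrib mult_ac)
    thus ?thesis using nz by (simp add: poly_cpoly_sum)
  qed
  ultimately have "((\<lambda>z. z powi (n - 1)) has_contour_integral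
     (\<Sum>k\<le>d. of_int (coeff P k) * (- W * rhoC (n + int k)))) (circlepath 0 r)"
    by (rule has_contour_integral_eq)
  moreover have "((\<lambda>z. z powi (n - 1)) has_contour_integral (if n - 1 = -1 then W else 0)) (circlepath 0 r)"
    unfolding W_def using r by (intro has_contour_integral_powi_circlepath) auto
  ultimately have "(\<Sum>k\<le>d. of_int (coeff P k) * (- W * rhoC (n + int k))) = (if n - 1 = -1 then W else 0)"
    by (rule has_contour_integral_unique)
  moreover have "(\<Sum>k\<le>d. of_int (coeff P k) * (- W * rhoC (n + int k))) = - W * (\<Sum>k\<le>d. of_int (coeff P k) * rhoC (n + int k))"
    by (simp add: sum_distrib_left mult_ac)
  ultimately have "- W * (\<Sum>k\<le>d. of_int (coeff P k) * rhoC (n + int k)) = (if n - 1 = -1 then W else 0)"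
    by (simp only:)
  hence "W * ((\<Sum>k\<le>d. of_int (coeff P k) * rhoC (n + int k)) + (if n = 0 then 1 else 0)) = 0"
    by (auto simp: distrib_left minus_equation_iff[of W] neg_eq_iff_add_eq_0 split: if_splits)
  hence "(\<Sum>k\<le>d. of_int (coeff P k) * rhoC (n + int k)) + (if n = 0 then 1 else 0) = 0"
    using \<open>W \<noteq> 0\<close> by (simp only: mult_eq_0_iff simp_thms)
  thus ?thesis by (simp add: eq_neg_iff_add_eq_0 split: if_splits)
qed

lemma rhoC_right: "rhoC (- int m) = (\<Sum>i=1..p. 1 / (\<alpha> i * D i) * (1 / \<alpha> i) ^ m)"
proof -
  have "- int m - 1 = - int (Suc m)" by simp
  hence "rhoC (- int m) = (\<Sum>i=1..p. \<alpha> i powi (- int (Suc m)) / D i)"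
    unfolding rhoC_def by (simp only: neg_le_0_iff_le of_nat_0_le_iff if_True)
  also have "\<dots> = (\<Sum>i=1..p. 1 / (\<alpha> i * D i) * (1 / \<alpha> i) ^ m)"
    by (intro sum.cong refl, subst power_int_minus, subst power_int_of_nat) (simp add: field_simps)
  finally show ?thesis .
qed

lemma rhoC_left: "rhoC (1 + int m) = (\<Sum>i=p+1..d. - 1 / D i * \<alpha> i ^ m)"
  by (simp add: rhoC_def sum_negf)

lemma rhoC_summable: "(\<lambda>n. norm (rhoC n)) summable_on UNIV"
proof -
  have right: "(\<lambda>n. norm (rhoC n)) summable_on {..0}"
  proof -
    have "summable (\<lambda>m. norm (rhoC (- int m)))"
    proof (rule summable_comparison_test')
      show "summable (\<lambda>m. \<Sum>i=1..p. norm (1 / (\<alpha> i * D i)) * norm (1 / \<alpha> i) ^ m)"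
        using norm_expanding by (intro summable_sum summable_mult summable_geometric) (auto simp: norm_divide divide_simps)
      show "norm (norm (rhoC (- int m))) \<le> (\<Sum>i=1..p. norm (1 / (\<alpha> i * D i)) * norm (1 / \<alpha> i) ^ m)" for m
        unfolding rhoC_right by (rule order_trans[OF _ norm_sum[THEN order_trans]]) (auto simp: norm_mult norm_power norm_divide)
    qed
    hence "(\<lambda>m. norm (rhoC (- int m))) summable_on UNIV"
      by (rule summable_nonneg_imp_summable_on) auto
    moreover have "bij_betw (\<lambda>m. - int m) UNIV {..0}"
      by (rule bij_betw_byWitness[of _ "\<lambda>n. nat (- n)"]) auto
    ultimately show ?thesis
      using summable_on_reindex_bij_betw[of "\<lambda>m. - int m" UNIV "{..0}" "\<lambda>n. norm (rhoC n)"] by blast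
  qed
  have left: "(\<lambda>n. norm (rhoC n)) summable_on {1..}"
  proof -
    have "summable (\<lambda>m. norm (rhoC (1 + int m)))"
    proof (rule summable_comparison_test')
      show "summable (\<lambda>m. \<Sum>i=p+1..d. norm (- 1 / D i) * norm (\<alpha> i) ^ m)"
        using norm_contracting by (intro summable_sum summable_mult summable_geometric) auto
      show "norm (norm (rhoC (1 + int m))) \<le> (\<Sum>i=p+1..d. norm (- 1 / D i) * norm (\<alpha> i) ^ m)" for m
        unfolding rhoC_left by (rule order_trans[OF _ norm_sum[THEN order_trans]]) (auto simp: norm_mult norm_power norm_divide)
    qed
    hence "(\<lambda>m. norm (rhoC (1 + int m))) summable_on UNIV"
      by (rule summable_nonneg_imp_summable_on) auto
    moreover have "bij_betw (\<lambda>m. 1 + int m) UNIV {1..}"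
      by (rule bij_betw_byWitness[of _ "\<lambda>n. nat (n - 1)"]) auto
    ultimately show ?thesis
      using summable_on_reindex_bij_betw[of "\<lambda>m. 1 + int m" UNIV "{1..}" "\<lambda>n. norm (rhoC n)"] by blast
  qed
  have "{..0} \<union> {1..} = (UNIV :: int set)" "{..0} \<inter> {1..} = ({} :: int set)" by auto
  with summable_on_Un_disjoint[OF right left] show ?thesis by argo
qed

lemma cnj_D: "cnj (poly (pderiv (cpoly P)) z) = poly (pderiv (cpoly P)) (cnj z)"
  by (rule poly_cnj_real) (simp add: coeff_pderiv coeff_map_poly)

lemma cnj_root: "poly (cpoly P) z = 0 \<Longrightarrow> poly (cpoly P) (cnj z) = 0"
  using poly_cnj_real[of "cpoly P" z] by (simp add: coeff_map_poly)

text \<open>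
  Both the set of expanding and the set of contracting roots are closed under complex conjugation.
\<close>

lemma rhoC_real: "rhoC n \<in> \<real>"
proof -
  define f where "f z = z powi (n - 1) / poly (pderiv (cpoly P)) z" for z
  have cnj_f: "f (cnj z) = cnj (f z)" for z
    by (simp add: f_def power_int_def flip: cnj_D)
  have real: "(\<Sum>z\<in>Z. f z) \<in> \<real>" if "cnj ` Z = Z" for Z
  proof -
    have "cnj (\<Sum>z\<in>Z. f z) = (\<Sum>z\<in>Z. f (cnj z))" by (simp add: cnj_f)
    also have "\<dots> = (\<Sum>z\<in>cnj ` Z. f z)" by (subst sum.reindex) (auto simp: inj_on_def)
    finally show ?thesis using that by (simp add: Reals_cnj_iff)
  qed
  have closed: "cnj ` Z = Z" if "\<And>z. z \<in> Z \<Longrightarrow> cnj z \<in> Z" for Z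
  proof
    show "Z \<subseteq> cnj ` Z"
    proof
      fix z assume "z \<in> Z"
      thus "z \<in> cnj ` Z" using that by (intro image_eqI[of _ _ "cnj z"]) auto
    qed
  qed (use that in auto)
  have e: "\<alpha> ` {1..p} = {z. poly (cpoly P) z = 0 \<and> norm z > 1}"
    using norm_expanding norm_contracting root p_le_d unfolding root_iff
    by (auto simp: image_iff) (metis One_nat_def Suc_eq_plus1 atLeastAtMost_iff less_asym not_less_eq_eq)
  have c: "\<alpha> ` {p+1..d} = {z. poly (cpoly P) z = 0 \<and> norm z < 1}"
  proof -
    have "i \<in> {p+1..d}" if "i \<in> {1..d}" "norm (\<alpha> i) < 1" for i
      using norm_expanding[of i] that by (cases "i \<le> p") auto
    thus ?thesis using norm_contracting root unfolding root_iff by fastforce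
  qed
  have "(\<Sum>i=1..p. \<alpha> i powi (n - 1) / D i) = sum f (\<alpha> ` {1..p})"
    using inj_on_subset[OF inj_\<alpha>, of "{1..p}"] p_le_d by (subst sum.reindex) (auto simp: f_def D_def)
  moreover have "sum f (\<alpha> ` {1..p}) \<in> \<real>" unfolding e by (intro real closed) (auto simp: cnj_root)
  moreover have "(\<Sum>i=p+1..d. \<alpha> i powi (n - 1) / D i) = sum f (\<alpha> ` {p+1..d})"
    using inj_on_subset[OF inj_\<alpha>, of "{p+1..d}"] by (subst sum.reindex) (auto simp: f_def D_def)
  moreover have "sum f (\<alpha> ` {p+1..d}) \<in> \<real>" unfolding c by (intro real closed) (auto simp: cnj_root)
  ultimately show ?thesis by (simp add: rhoC_def)
qed

definition rhoR :: "int \<Rightarrow> real" where "rhoR n = Re (rhoC n)"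

lemma rhoC_eq: "rhoC n = of_real (rhoR n)"
  using rhoC_real[of n] by (simp add: rhoR_def of_real_Re)

lemma norm_rhoC: "norm (rhoC n) = \<bar>rhoR n\<bar>"
  by (simp add: rhoC_eq)

lemma rhoR_summable: "(\<lambda>n. \<bar>rhoR n\<bar>) summable_on UNIV"
  using rhoC_summable by (simp add: norm_rhoC)

lemma rhoR_reflect_summable: "(\<lambda>n. \<bar>rhoR (-n)\<bar>) summable_on UNIV"
  and rhoR_reflect_infsum: "(\<Sum>\<^sub>\<infinity>n. \<bar>rhoR (-n)\<bar>) = (\<Sum>\<^sub>\<infinity>n. \<bar>rhoR n\<bar>)"
proof -
  have b: "bij_betw uminus (UNIV :: int set) UNIV" by (rule bij_betw_byWitness[of _ uminus]) auto
  show "(\<lambda>n. \<bar>rhoR (-n)\<bar>) summable_on UNIV"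
    using summable_on_reindex_bij_betw[OF b, of "\<lambda>n. \<bar>rhoR n\<bar>"] rhoR_summable by simp
  show "(\<Sum>\<^sub>\<infinity>n. \<bar>rhoR (-n)\<bar>) = (\<Sum>\<^sub>\<infinity>n. \<bar>rhoR n\<bar>)"
    using infsum_reindex_bij_betw[OF b, of "\<lambda>n. \<bar>rhoR n\<bar>"] by simp
qed

lemma rhoR_recurrence: "n \<noteq> 0 \<Longrightarrow> (\<Sum>k\<le>d. of_int (coeff P k) * rhoR (n + int k)) = 0"
proof -
  assume "n \<noteq> 0"
  hence "of_real (\<Sum>k\<le>d. of_int (coeff P k) * rhoR (n + int k)) = (0 :: complex)"
    using rhoC_recurrence[of n] by (simp add: rhoC_eq)
  thus ?thesis by (simp only: of_real_eq_0_iff)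
qed

definition coeff_mass :: real where "coeff_mass = (\<Sum>k\<le>d. \<bar>of_int (coeff P k)\<bar>)"

lemma coeff_mass: "k \<le> d \<Longrightarrow> \<bar>real_of_int (coeff P k)\<bar> \<le> coeff_mass"
  unfolding coeff_mass_def by (intro member_le_sum) auto

text \<open>
  On the positive side the recurrence can be solved for its lowest term, whose coefficient \<open>P 0\<close> is a nonzero integer. If
  there is a contracting root, the kernel does not vanish identically there.
\<close>

lemma left_regular_rhoR:
  assumes "p < d" shows "left_regular rhoR"
proof (rule left_regularI[OF rhoR_summable, of 1 coeff_mass d])
  fix l :: int assume "l \<ge> 1"
  hence "(\<Sum>k\<le>d. of_int (coeff P k) * rhoR (l + int k)) = 0" by (intro rhoR_recurrence) auto
  moreover have "{..d} = insert 0 {1..d}" by auto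
  ultimately have e: "of_int (coeff P 0) * rhoR l = - (\<Sum>k=1..d. of_int (coeff P k) * rhoR (l + int k))"
    by simp
  have "1 \<le> \<bar>real_of_int (coeff P 0)\<bar>" using coeff0_nonzero by linarith
  hence "1 * \<bar>rhoR l\<bar> \<le> \<bar>real_of_int (coeff P 0)\<bar> * \<bar>rhoR l\<bar>" by (intro mult_right_mono) auto
  also have "\<dots> = \<bar>\<Sum>k=1..d. of_int (coeff P k) * rhoR (l + int k)\<bar>" using e by (simp flip: abs_mult)
  also have "\<dots> \<le> (\<Sum>k=1..d. coeff_mass * \<bar>rhoR (l + int k)\<bar>)"
    by (rule order_trans[OF sum_abs]) (auto intro!: sum_mono mult_right_mono coeff_mass simp: abs_mult)
  finally show "\<bar>rhoR l\<bar> \<le> coeff_mass * (\<Sum>k=1..d. \<bar>rhoR (l + int k)\<bar>)" by (simp add: sum_distrib_left)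
next
  obtain m where "(\<Sum>i\<in>{p+1..d}. - 1 / D i * \<alpha> i ^ m) \<noteq> 0"
    using power_sum_nonzero[of "{p+1..d}" d "\<lambda>i. - 1 / D i" \<alpha>] assms D_nonzero[of d] inj_on_subset[OF inj_\<alpha>, of "{p+1..d}"] d_pos
    by auto
  hence "rhoC (1 + int m) \<noteq> 0" by (simp only: rhoC_left not_False_eq_True)
  hence "rhoR (1 + int m) \<noteq> 0" by (auto simp: rhoC_eq)
  thus "\<exists>i\<ge>1. rhoR i \<noteq> 0" by (intro exI[of _ "1 + int m"]) auto
qed

text \<open>
  If all roots had modulus less than 1, so would their product, whose modulus is the positive integer \<open>\<bar>P 0\<bar>\<close>.
\<close>

lemma p_pos: "p \<ge> 1"
proof (rule ccontr)
  assume "\<not> p \<ge> 1"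
  hence "p = 0" by simp
  have "\<bar>real_of_int (coeff P 0)\<bar> = (\<Prod>i=1..d. norm (\<alpha> i))"
  proof -
    have "coeff (cpoly P) 0 = (\<Prod>i=1..d. - \<alpha> i)"
      using poly_cpoly[of 0] by (simp add: poly_0_coeff_0)
    hence "complex_of_int (coeff P 0) = (\<Prod>i=1..d. - \<alpha> i)" by (simp add: coeff_map_poly)
    hence "norm (complex_of_int (coeff P 0)) = norm (\<Prod>i=1..d. - \<alpha> i)" by (rule arg_cong)
    also have "norm (\<Prod>i=1..d. - \<alpha> i) = (\<Prod>i=1..d. norm (- \<alpha> i))" by (rule prod_norm[symmetric])
    finally show ?thesis by (simp only: norm_minus_cancel norm_of_int)
  qed
  also have "\<dots> < (\<Prod>i=1..d. 1)"
  proof (rule prod_mono_strict[of 1])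
    show "norm (\<alpha> 1) < 1" using norm_contracting[of 1] d_pos \<open>p = 0\<close> by simp
  qed (use d_pos norm_contracting \<open>p = 0\<close> in \<open>auto intro: less_imp_le\<close>)
  finally show False using coeff0_nonzero by simp
qed

text \<open>
  Here the recurrence is solved for its highest term, whose coefficient is 1. The kernel does not vanish
  identically on this side because there is always an expanding root.
\<close>

lemma left_regular_rhoR_reflect: "left_regular (\<lambda>n. rhoR (- n))"
proof (rule left_regularI[OF rhoR_reflect_summable, of 0 coeff_mass d])
  fix l :: int assume "l \<ge> 0"
  hence "(\<Sum>k\<le>d. of_int (coeff P k) * rhoR ((- l - int d) + int k)) = 0" using d_pos by (intro rhoR_recurrence) auto
  moreover have "{..d} = insert d {..<d}" by auto
  ultimately have e: "rhoR (- l) = - (\<Sum>k<d. of_int (coeff P k) * rhoR ((- l - int d) + int k))"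
    using monic by simp
  have "(\<Sum>k<d. coeff_mass * \<bar>rhoR ((- l - int d) + int k)\<bar>) = (\<Sum>k=1..d. coeff_mass * \<bar>rhoR (- (l + int k))\<bar>)"
    by (rule sum.reindex_bij_witness[of _ "\<lambda>k. d - k" "\<lambda>k. d - k"]) (auto simp: of_nat_diff algebra_simps)
  moreover have "\<bar>rhoR (- l)\<bar> \<le> (\<Sum>k<d. coeff_mass * \<bar>rhoR ((- l - int d) + int k)\<bar>)"
    unfolding e abs_minus_cancel
    by (rule order_trans[OF sum_abs]) (auto intro!: sum_mono mult_right_mono coeff_mass simp: abs_mult)
  ultimately show "\<bar>rhoR (- l)\<bar> \<le> coeff_mass * (\<Sum>k=1..d. \<bar>rhoR (- (l + int k))\<bar>)" by (simp add: sum_distrib_left)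
next
  have inj: "inj_on (\<lambda>i. 1 / \<alpha> i) {1..p}"
  proof (rule inj_onI)
    fix i j assume ij: "i \<in> {1..p}" "j \<in> {1..p}" "1 / \<alpha> i = 1 / \<alpha> j"
    hence "\<alpha> i = \<alpha> j" by (simp flip: inverse_eq_divide)
    moreover have "i \<in> {1..d}" "j \<in> {1..d}" using ij p_le_d by auto
    ultimately show "i = j" by (rule inj_onD[OF inj_\<alpha>])
  qed
  have 1: "1 \<in> {1..p}" "1 \<in> {1..d}" using p_pos d_pos by auto
  have "1 / (\<alpha> 1 * D 1) \<noteq> 0" using D_nonzero[OF 1(2)] root_nonzero[OF 1(2)] by simp
  from power_sum_nonzero[where c = "\<lambda>i. 1 / (\<alpha> i * D i)", OF _ 1(1) this inj]
  obtain m where "(\<Sum>i\<in>{1..p}. 1 / (\<alpha> i * D i) * (1 / \<alpha> i) ^ m) \<noteq> 0"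
    by auto
  hence "rhoC (- int m) \<noteq> 0" by (simp only: rhoC_right not_False_eq_True)
  hence "rhoR (- int m) \<noteq> 0" by (auto simp: rhoC_eq)
  thus "\<exists>i\<ge>0. rhoR (- i) \<noteq> 0" by (intro exI[of _ "int m"]) auto
qed

text \<open>
  A limit of real ratios is real. In this way the reality of a root that is alone on its circle need not be shown separately.
\<close>

lemma real_ratio_limit:
  fixes f :: "nat \<Rightarrow> real" and z :: complex
  assumes "(\<lambda>m. complex_of_real (f (Suc m)) / complex_of_real (f m)) \<longlonglongrightarrow> z"
  obtains \<theta> :: real where "(\<lambda>m. f (Suc m) / f m) \<longlonglongrightarrow> \<theta>" "\<bar>\<theta>\<bar> = norm z"
proof -
  have l: "(\<lambda>m. complex_of_real (f (Suc m) / f m)) \<longlonglongrightarrow> z" using assms by simp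
  have "(\<lambda>m. f (Suc m) / f m) \<longlonglongrightarrow> Re z" using tendsto_Re[OF l] by simp
  moreover have "Im z = 0" using tendsto_Im[OF l] by (simp add: tendsto_const_iff)
  hence "\<bar>Re z\<bar> = norm z" by (simp add: cmod_eq_Re)
  ultimately show ?thesis using that by blast
qed

lemma ratio_right:
  assumes i0: "i0 \<in> {1..p}" and dom: "\<And>i. i \<in> {1..p} \<Longrightarrow> i \<noteq> i0 \<Longrightarrow> norm (\<alpha> i0) < norm (\<alpha> i)"
  obtains \<theta> where "(\<lambda>j. rhoR (- int (Suc j)) / rhoR (- int j)) \<longlonglongrightarrow> \<theta>" "\<bar>\<theta>\<bar> = 1 / norm (\<alpha> i0)"
proof -
  have i0d: "i0 \<in> {1..d}" using i0 p_le_d by auto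
  have "(\<lambda>m. (\<Sum>i=1..p. 1 / (\<alpha> i * D i) * (1 / \<alpha> i) ^ Suc m) / (\<Sum>i=1..p. 1 / (\<alpha> i * D i) * (1 / \<alpha> i) ^ m)) \<longlonglongrightarrow> 1 / \<alpha> i0"
  proof (rule power_sum_ratio[OF _ i0])
    fix i assume i: "i \<in> {1..p}" "i \<noteq> i0"
    have "0 < norm (\<alpha> i) * norm (\<alpha> i0)"
      by (rule mult_pos_pos; rule less_trans[OF zero_less_one norm_expanding]) (use i i0 in auto)
    from divide_strict_left_mono[OF dom[OF i] zero_less_one this]
    show "norm (1 / \<alpha> i) < norm (1 / \<alpha> i0)" by (simp add: norm_divide)
  qed (use root_nonzero[OF i0d] D_nonzero[OF i0d] in auto)
  hence "(\<lambda>m. complex_of_real (rhoR (- int (Suc m))) / complex_of_real (rhoR (- int m))) \<longlonglongrightarrow> 1 / \<alpha> i0"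
    unfolding rhoC_right[symmetric] by (simp only: rhoC_eq)
  from real_ratio_limit[OF this] show ?thesis using that by (metis norm_divide norm_one)
qed

lemma ratio_left:
  assumes i0: "i0 \<in> {p+1..d}" and dom: "\<And>i. i \<in> {p+1..d} \<Longrightarrow> i \<noteq> i0 \<Longrightarrow> norm (\<alpha> i) < norm (\<alpha> i0)"
  obtains \<theta> where "(\<lambda>j. rhoR (- (- int (Suc j))) / rhoR (- (- int j))) \<longlonglongrightarrow> \<theta>" "\<bar>\<theta>\<bar> = norm (\<alpha> i0)"
proof -
  have i0d: "i0 \<in> {1..d}" using i0 by auto
  have "(\<lambda>m. (\<Sum>i=p+1..d. - 1 / D i * \<alpha> i ^ Suc m) / (\<Sum>i=p+1..d. - 1 / D i * \<alpha> i ^ m)) \<longlonglongrightarrow> \<alpha> i0"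
    by (rule power_sum_ratio[OF _ i0]) (use root_nonzero[OF i0d] D_nonzero[OF i0d] dom in auto)
  hence "(\<lambda>m. complex_of_real (rhoR (1 + int (Suc m))) / complex_of_real (rhoR (1 + int m))) \<longlonglongrightarrow> \<alpha> i0"
    unfolding rhoC_left[symmetric] by (simp only: rhoC_eq)
  then obtain \<theta> where \<theta>: "(\<lambda>m. rhoR (1 + int (Suc m)) / rhoR (1 + int m)) \<longlonglongrightarrow> \<theta>" "\<bar>\<theta>\<bar> = norm (\<alpha> i0)"
    by (rule real_ratio_limit[where f = "\<lambda>m. rhoR (1 + int m)"])
  have "(\<lambda>m. rhoR (- (- int (Suc m))) / rhoR (- (- int m))) \<longlonglongrightarrow> \<theta>"
    by (rule LIMSEQ_imp_Suc) (use \<theta>(1) in \<open>simp add: add_ac\<close>)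
  thus ?thesis using that \<theta>(2) by blast
qed

end

section \<open>Accumulation at one half\<close>

lemma dist_nearest_int_frac_odd:
  fixes k q :: int
  assumes "q > 0" "odd q"
  shows "dist_nearest_int (of_int k / of_int q) \<le> (q - 1) / (2 * q)"
proof -
  define m where "m = round (real_of_int k / q)"
  have "\<bar>real_of_int k / q - m\<bar> \<le> 1/2"
    unfolding m_def using of_int_round_abs_le[of "real_of_int k / q"] by (simp add: abs_minus_commute)
  have eq: "real_of_int k / q - m = real_of_int (k - q * m) / q"
    using assms by (simp add: field_simps)
  hence "\<bar>real_of_int (k - q * m)\<bar> / q \<le> 1/2"
    using \<open>\<bar>real_of_int k / q - m\<bar> \<le> 1/2\<close> assms by (simp only: abs_divide abs_of_pos of_int_0_less_iff)
  hence "real_of_int (2 * \<bar>k - q * m\<bar>) \<le> real_of_int q" using assms by (simp add: field_simps)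
  hence "2 * \<bar>k - q * m\<bar> \<le> q" by (simp only: of_int_le_iff)
  hence "2 * \<bar>k - q * m\<bar> \<le> q - 1" using assms by presburger
  hence "real_of_int (2 * \<bar>k - q * m\<bar>) \<le> real_of_int (q - 1)" by (simp only: of_int_le_iff)
  hence "\<bar>real_of_int (k - q * m)\<bar> / q \<le> (q - 1) / (2 * q)" using assms by (simp add: field_simps)
  moreover have "\<bar>real_of_int k / q - m\<bar> = \<bar>real_of_int (k - q * m)\<bar> / q"
    unfolding eq using assms by (simp add: abs_divide)
  ultimately show ?thesis using dist_nearest_int_le[of "real_of_int k / q" m] by simp
qed

lemma dist_nearest_int_middle_odd:
  fixes q t :: int
  assumes "q > 0" "odd q" and b: "b = (q - 1) div 2"
  shows "dist_nearest_int (of_int (b * (1 + q * t)) / of_int q) = (q - 1) / (2 * q)"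
proof (rule antisym)
  show "dist_nearest_int (of_int (b * (1 + q * t)) / of_int q) \<le> (q - 1) / (2 * q)"
    by (rule dist_nearest_int_frac_odd) (use assms in auto)
  have b2: "2 * b = q - 1" using assms by simp
  obtain m where m: "dist_nearest_int (real_of_int (b * (1 + q * t)) / of_int q) = \<bar>of_int (b * (1 + q * t)) / of_int q - real_of_int m\<bar>"
    using dist_nearest_int_attained by blast
  define y where "y = q * (m - b * t)"
  define x where "x = b - y"
  have "real_of_int (b * (1 + q * t)) / of_int q - real_of_int m = real_of_int x / q"
    using assms by (simp add: x_def y_def field_simps)
  moreover have "2 * \<bar>x\<bar> \<ge> q - 1"
  proof (cases "m - b * t \<le> 0")
    case True
    hence "y \<le> 0" using assms by (simp add: y_def mult_le_0_iff)
    hence "q - 1 \<le> 2 * (b - y)" using b2 by presburger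
    also have "\<dots> \<le> 2 * \<bar>b - y\<bar>" by (intro mult_left_mono abs_ge_self) simp
    finally show ?thesis by (simp add: x_def)
  next
    case False
    hence "y \<ge> q * 1" unfolding y_def using assms by (intro mult_left_mono) auto
    hence "q - 1 \<le> 2 * - (b - y)" using b2 \<open>q > 0\<close> by presburger
    also have "\<dots> \<le> 2 * \<bar>b - y\<bar>" by (intro mult_left_mono abs_ge_minus_self) simp
    finally show ?thesis by (simp add: x_def)
  qed
  hence "real_of_int (q - 1) \<le> real_of_int (2 * \<bar>x\<bar>)" by (simp only: of_int_le_iff)
  hence "real_of_int (q - 1) / (2 * q) \<le> real_of_int (2 * \<bar>x\<bar>) / (2 * q)"
    using assms(1) by (intro divide_right_mono) auto
  hence "(q - 1) / (2 * q) \<le> \<bar>real_of_int x\<bar> / q" by simp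
  ultimately show "(q - 1) / (2 * q) \<le> dist_nearest_int (of_int (b * (1 + q * t)) / of_int q)"
    unfolding m using assms by (simp add: abs_divide)
qed

lemma has_sum_finite_sum:
  fixes f :: "'a \<Rightarrow> 'b \<Rightarrow> 'c :: {topological_comm_monoid_add}"
  assumes "finite I" "\<And>i. i \<in> I \<Longrightarrow> (f i has_sum S i) A"
  shows "((\<lambda>x. \<Sum>i\<in>I. f i x) has_sum (\<Sum>i\<in>I. S i)) A"
  using assms by (induction I rule: finite_induct) (auto intro!: has_sum_add)

context hyperbolic_roots
begin

text \<open>
  Constants \<open>c (\<alpha> i)\<close> form an admissible tuple as soon as \<open>c\<close> commutes with conjugation.
\<close>

lemma Xi_constants:
  assumes "\<And>i. i \<in> {1..p} \<Longrightarrow> g i = [:c (\<alpha> i):]" "\<And>i. i \<notin> {1..p} \<Longrightarrow> g i = 0" and c: "\<And>z. c (cnj z) = cnj (c z)"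
  shows "g \<in> Xi r1 r2 k"
  unfolding Xi_def
proof (intro CollectI conjI ballI allI impI)
  show "degree (g i) \<le> k" if "i \<in> {1..p}" for i using assms(1)[OF that] by simp
  show "coeff (g i) j \<in> \<real>" if "i \<in> {1..r1}" for i j
  proof -
    have "cnj (\<alpha> i) = \<alpha> i" using ord that by (auto simp: root_ordering_def Reals_cnj_iff)
    hence "c (\<alpha> i) \<in> \<real>" using c[of "\<alpha> i"] by (simp add: Reals_cnj_iff)
    moreover have "g i = [:c (\<alpha> i):]" using that by (intro assms(1)) auto
    ultimately show ?thesis by (cases j) auto
  qed
  show "map_poly cnj (g (r1 + i)) = g (r1 + r2 + i)" if "i \<in> {1..r2}" for i
  proof -
    have "\<alpha> (r1 + r2 + i) = cnj (\<alpha> (r1 + i))" using ord that by (auto simp: root_ordering_def)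
    moreover have "g (r1 + i) = [:c (\<alpha> (r1 + i)):]" "g (r1 + r2 + i) = [:c (\<alpha> (r1 + r2 + i)):]"
      using that by (intro assms(1); simp)+
    ultimately show ?thesis using c by (simp add: map_poly_pCons)
  qed
qed (use assms(2) in auto)

definition H :: "nat \<Rightarrow> int" where "H m = \<lfloor>Re (h m)\<rfloor>"

lemma h_eq: "h m = of_int (H m)"
  using h_Ints[of m] by (auto elim!: Ints_cases simp: H_def)

lemma H_recurrence: "(\<Sum>k\<le>d. coeff P k * H (m + k)) = 0"
proof -
  have "complex_of_int (\<Sum>k\<le>d. coeff P k * H (m + k)) = 0"
    using h_recurrence[of m] by (simp add: h_eq)
  thus ?thesis by (simp only: of_int_eq_0_iff)
qed

lemma H_one: "H (d - 1) = 1"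
  using h_initial[of "d - 1"] d_pos by (simp add: H_def)

lemma H_backward:
  assumes "coprime (coeff P 0) q" and eq: "\<And>k. k < d \<Longrightarrow> [H (Suc a + k) = H (Suc b + k)] (mod q)"
  shows "[H a = H b] (mod q)"
proof -
  have s: "coeff P 0 * H m = - (\<Sum>k<d. coeff P (Suc k) * H (Suc m + k))" for m
  proof -
    have "(\<Sum>k\<le>d. coeff P k * H (m + k)) = coeff P 0 * H m + (\<Sum>k<d. coeff P (Suc k) * H (Suc m + k))"
      using sum.atMost_shift[of "\<lambda>k. coeff P k * H (m + k)" d] by simp
    thus ?thesis using H_recurrence[of m] by simp
  qed
  have "[coeff P 0 * H a = coeff P 0 * H b] (mod q)"
    unfolding s by (intro cong_minus_minus_iff[THEN iffD2] cong_sum cong_scalar_left eq) auto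
  thus ?thesis using assms(1) by (simp add: cong_mult_lcancel)
qed

text \<open>
  Modulo \<open>q\<close> the windows of \<open>d\<close> consecutive values take finitely many states, so some state recurs infinitely often.
  Since \<open>P 0\<close> is invertible modulo \<open>q\<close>, the recurrence also runs backwards, and then the initial state with its last
  entry 1 recurs.
\<close>

lemma H_returns:
  assumes q: "q > 0" "coprime (coeff P 0) q"
  shows "infinite {n. [H n = 1] (mod q)}"
proof -
  define F where "F n = map (\<lambda>k. H (n + k) mod q) [0..<d]" for n
  have "range F \<subseteq> {xs. set xs \<subseteq> {0..<q} \<and> length xs = d}"
    using q by (auto simp: F_def)
  moreover have "finite {xs. set xs \<subseteq> {0..<q} \<and> length xs = d}" by (rule finite_lists_length_eq) auto
  ultimately have "finite (range F)" using finite_subset by blast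
  then obtain a where a: "infinite {b. F b = F a}"
    using pigeonhole_infinite[of "UNIV :: nat set" F] by auto
  have F_eq: "F x = F y \<longleftrightarrow> (\<forall>k<d. [H (x + k) = H (y + k)] (mod q))" for x y
    by (auto simp: F_def cong_def list_eq_iff_nth_eq)
  have pull_back: "F x = F y" if "F (Suc x) = F (Suc y)" for x y
    unfolding F_eq
  proof (intro allI impI)
    fix k assume "k < d"
    show "[H (x + k) = H (y + k)] (mod q)"
    proof (cases k)
      case 0 thus ?thesis using H_backward[OF q(2), of x y] that by (simp add: F_eq)
    next
      case (Suc k') thus ?thesis using that \<open>k < d\<close> by (auto simp: F_eq)
    qed
  qed
  have shift: "F x = F y" if "F (x + n) = F (y + n)" for x y n
    using that by (induction n) (auto intro: pull_back)
  have "[H (b - a + (d - 1)) = 1] (mod q)" if "F b = F a" "b \<ge> a" for b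
  proof -
    have "F (b - a) = F 0" using shift[of "b - a" a 0] that by simp
    from this[unfolded F_eq, rule_format, of "d - 1"]
    have "[H (b - a + (d - 1)) = H (0 + (d - 1))] (mod q)" using d_pos by simp
    thus ?thesis using H_one by simp
  qed
  hence "(\<lambda>b. b - a + (d - 1)) ` ({b. F b = F a} \<inter> {a..}) \<subseteq> {n. [H n = 1] (mod q)}" by auto
  moreover have "infinite ({b. F b = F a} \<inter> {a..})"
  proof
    assume "finite ({b. F b = F a} \<inter> {a..})"
    hence "finite (({b. F b = F a} \<inter> {a..}) \<union> {..a})" by simp
    moreover have "{b. F b = F a} \<subseteq> ({b. F b = F a} \<inter> {a..}) \<union> {..a}" by auto
    ultimately show False using a finite_subset by blast
  qed
  moreover have "inj_on (\<lambda>b. b - a + (d - 1)) ({b. F b = F a} \<inter> {a..})" by (auto simp: inj_on_def)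
  ultimately show ?thesis using finite_imageD finite_subset by metis
qed

lemma x_seq_constants:
  assumes "\<And>i. i \<in> {1..p} \<Longrightarrow> g i = [:c (\<alpha> i):]"
  shows "x_seq p \<alpha> g (int n) = Re (\<Sum>i=1..p. c (\<alpha> i) * \<alpha> i ^ n)"
  unfolding x_seq_def exp_poly_sum_def
  by (intro arg_cong[where f = Re] sum.cong refl) (simp only: assms, simp)

text \<open>
  With \<open>b = (q - 1) / 2\<close> the sequence \<open>b H n / q\<close> takes values in the multiples of \<open>1 / q\<close>, whose distance to the
  nearest integer is at most \<open>(q - 1) / (2 q)\<close> for odd \<open>q\<close>, with equality whenever \<open>H n\<close> is 1 modulo \<open>q\<close>. Its expanding part
  differs from it by a sequence that tends to 0.
\<close>

lemma odd_fraction_in_spectrum: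
  fixes q :: int
  assumes q: "q > 0" "odd q" "coprime (coeff P 0) q"
  shows "(q - 1) / (2 * q) \<in> spectrum_L r1 r2 \<alpha> k"
proof -
  define b where "b = (q - 1) div 2"
  define c where "c z = of_real (b / q) / poly (pderiv (cpoly P)) z" for z
  define g where "g i = (if i \<in> {1..p} then [:c (\<alpha> i):] else 0)" for i
  have g: "g \<in> Xi r1 r2 k"
    by (rule Xi_constants[where c = c]) (auto simp: g_def c_def cnj_D)
  define err where "err n = (b / q) * (\<Sum>i=p+1..d. \<alpha> i ^ n / D i)" for n
  have x: "x_seq p \<alpha> g (int n) = of_int (b * H n) / q - Re (err n)" for n
  proof -
    have "(\<Sum>i=1..p. c (\<alpha> i) * \<alpha> i ^ n) = (b / q) * (\<Sum>i=1..p. \<alpha> i ^ n / D i)"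
      by (simp add: c_def D_def sum_distrib_left)
    also have "(\<Sum>i=1..p. \<alpha> i ^ n / D i) = h n - (\<Sum>i=p+1..d. \<alpha> i ^ n / D i)"
      unfolding h_def sum_split by simp
    finally have "(\<Sum>i=1..p. c (\<alpha> i) * \<alpha> i ^ n) = of_real (of_int (b * H n) / q) - err n"
      by (simp add: err_def h_eq right_diff_distrib)
    thus ?thesis using x_seq_constants[of g c n] by (simp add: g_def)
  qed
  have "err \<longlonglongrightarrow> (b / q) * (\<Sum>i=p+1..d. 0 / D i)"
    unfolding err_def using norm_contracting D_nonzero
    by (intro tendsto_mult tendsto_const tendsto_sum tendsto_divide LIMSEQ_power_zero) auto
  hence "(\<lambda>n. Re (err n)) \<longlonglongrightarrow> 0" using tendsto_Re by fastforce
  hence small: "\<forall>\<^sub>F n in sequentially. \<bar>Re (err n)\<bar> < \<epsilon>" if "\<epsilon> > 0" for \<epsilon>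
    using that by (auto simp: tendsto_iff dist_real_def)
  have dx: "\<bar>dist_nearest_int (x_seq p \<alpha> g (int n)) - dist_nearest_int (of_int (b * H n) / q)\<bar> \<le> \<bar>Re (err n)\<bar>" for n
    using dist_nearest_int_lipschitz[of "x_seq p \<alpha> g (int n)" "of_int (b * H n) / q"]
      dist_nearest_int_lipschitz[of "of_int (b * H n) / q" "x_seq p \<alpha> g (int n)"] by (simp add: x)
  have "limsup (\<lambda>n. ereal (dist_nearest_int (x_seq p \<alpha> g (int n)))) = ereal ((q - 1) / (2 * q))"
  proof (rule limsup_eqI_real)
    fix \<epsilon> :: real assume \<epsilon>: "\<epsilon> > 0"
    show "\<forall>\<^sub>F n in sequentially. dist_nearest_int (x_seq p \<alpha> g (int n)) \<le> (q - 1) / (2 * q) + \<epsilon>"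
      using small[OF \<epsilon>]
    proof eventually_elim
      case (elim n)
      thus ?case using dx[of n] dist_nearest_int_frac_odd[OF q(1,2), of "b * H n"] by linarith
    qed
    have "\<exists>\<^sub>F n in sequentially. [H n = 1] (mod q)"
      using H_returns[OF q(1,3)] by (simp add: frequently_cofinite flip: cofinite_eq_sequentially)
    hence "\<exists>\<^sub>F n in sequentially. [H n = 1] (mod q) \<and> \<bar>Re (err n)\<bar> < \<epsilon>"
      using small[OF \<epsilon>] by (rule frequently_eventually_frequently)
    thus "\<exists>\<^sub>F n in sequentially. (q - 1) / (2 * q) - \<epsilon> \<le> dist_nearest_int (x_seq p \<alpha> g (int n))"
    proof (rule frequently_mono[rotated], intro allI impI)
      fix n assume n: "[H n = 1] (mod q) \<and> \<bar>Re (err n)\<bar> < \<epsilon>"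
      then obtain t where "H n = 1 + q * t" using cong_iff_lin[of 1 "H n" q] by (auto simp: cong_sym_eq)
      hence "dist_nearest_int (of_int (b * H n) / q) = (q - 1) / (2 * q)"
        using dist_nearest_int_middle_odd[OF q(1,2) b_def, of t] by (simp only:)
      thus "(q - 1) / (2 * q) - \<epsilon> \<le> dist_nearest_int (x_seq p \<alpha> g (int n))"
        using dx[of n] n by linarith
    qed
  qed
  thus ?thesis unfolding spectrum_L_def using g by (intro CollectI bexI[of _ g]) simp_all
qed

lemma half_islimpt_spectrum: "(1/2) islimpt spectrum_L r1 r2 \<alpha> k"
  unfolding islimpt_approachable
proof (intro allI impI)
  fix e :: real assume "e > 0"
  then obtain m :: nat where m: "m > 0" "1 / real m < e" using ex_inverse_of_nat_less[of e] by (auto simp: inverse_eq_divide)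
  define A where "A = \<bar>coeff P 0\<bar>"
  have A: "A \<ge> 1" using coeff0_nonzero by (simp add: A_def)
  \<comment> \<open>Odd and congruent to 1 modulo \<open>P 0\<close>, hence coprime to it.\<close>
  define q where "q = 2 * (A * int m) + 1"
  have "A * int m \<ge> 1 * int m" using A by (intro mult_right_mono) auto
  hence q: "q > 0" "odd q" "q \<ge> int m" unfolding q_def by (linarith, simp, linarith)
  have "coprime A q"
  proof -
    have "q = 1 + (2 * int m) * A" by (simp add: q_def)
    hence "gcd A q = gcd A 1" by (metis gcd_add_mult add.commute)
    thus ?thesis by (simp add: coprime_iff_gcd_eq_1)
  qed
  hence "coprime (coeff P 0) q" by (simp add: A_def)
  hence mem: "(q - 1) / (2 * q) \<in> spectrum_L r1 r2 \<alpha> k" by (intro odd_fraction_in_spectrum q)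
  have eq: "real_of_int (q - 1) / real_of_int (2 * q) = 1/2 - 1 / (2 * real_of_int q)" using q by (simp add: field_simps)
  have "1 / (2 * real_of_int q) \<le> 1 / real m"
    using q m by (intro divide_left_mono) (auto intro!: mult_pos_pos)
  hence "dist (real_of_int (q - 1) / real_of_int (2 * q)) (1/2) < e"
    using m q unfolding eq dist_real_def by simp
  moreover have "real_of_int (q - 1) / real_of_int (2 * q) \<noteq> 1/2" using q by (simp add: eq)
  ultimately show "\<exists>x'\<in>spectrum_L r1 r2 \<alpha> k. x' \<noteq> 1/2 \<and> dist x' (1/2) < e" using mem by blast
qed

section \<open>Realizing convolutions in the spectrum\<close>

text \<open>
  Each constant is chosen such that its term collects the contributions \<open>\<alpha> i ^ (n - j - 1) / D i\<close> of all positions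
  \<open>j \<ge> 0\<close>. For \<open>j \<ge> n\<close> these are the terms of the kernel itself; for \<open>j < n\<close> the kernel has the contracting roots with
  a minus sign instead, and the difference is \<open>h (n - j - 1)\<close>, an integer.
\<close>

lemma realization:
  assumes B: "\<And>j. \<bar>s j\<bar> \<le> B" and s0: "\<And>j. j < 0 \<Longrightarrow> s j = 0"
  shows "\<exists>g\<in>Xi r1 r2 0. \<forall>n. x_seq p \<alpha> g (int n) - conv rhoR s (int n) \<in> \<int>"
proof -
  define c where "c z = (\<Sum>\<^sub>\<infinity>j::nat. of_int (s (int j)) * inverse z ^ Suc j) / poly (pderiv (cpoly P)) z" for z
  define g where "g i = (if i \<in> {1..p} then [:c (\<alpha> i):] else 0)" for i
  have "c (cnj z) = cnj (c z)" for z by (simp add: c_def cnj_D flip: infsum_cnj)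
  hence g: "g \<in> Xi r1 r2 0"
    by (intro Xi_constants[where c = c]) (auto simp: g_def)
  have sb: "norm (complex_of_int (s j)) \<le> of_int B" for j using B[of j] by (simp flip: of_int_abs)
  have B0: "real_of_int B \<ge> 0" using sb[of 0] norm_ge_zero order_trans by blast
  have "x_seq p \<alpha> g (int n) - conv rhoR s (int n) \<in> \<int>" for n
  proof -
    define X where "X = (\<Sum>i=1..p. c (\<alpha> i) * \<alpha> i ^ n)"
    have hX: "((\<lambda>j. of_int (s (int j)) * (\<Sum>i=1..p. \<alpha> i powi (int n - int j - 1) / D i)) has_sum X) UNIV"
    proof -
      have "((\<lambda>j. \<Sum>i=1..p. of_int (s (int j)) * (\<alpha> i powi (int n - int j - 1) / D i)) has_sum X) UNIV"
        unfolding X_def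
      proof (rule has_sum_finite_sum[OF finite_atLeastAtMost])
        fix i assume i: "i \<in> {1..p}"
        have a: "norm (\<alpha> i) > 1" "\<alpha> i \<noteq> 0" using norm_expanding[OF i] by auto
        have "summable (\<lambda>j. norm (of_int (s (int j)) * inverse (\<alpha> i) ^ Suc j))"
        proof (rule summable_comparison_test')
          show "summable (\<lambda>j. of_int B * (norm (inverse (\<alpha> i)) * norm (inverse (\<alpha> i)) ^ j))"
            using a by (intro summable_mult summable_geometric) (auto simp: norm_inverse inverse_less_1_iff)
          show "norm (norm (of_int (s (int j)) * inverse (\<alpha> i) ^ Suc j)) \<le> of_int B * (norm (inverse (\<alpha> i)) * norm (inverse (\<alpha> i)) ^ j)" for j
            using sb[of "int j"] by (simp add: norm_mult norm_power mult_right_mono)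
        qed
        hence "(\<lambda>j. of_int (s (int j)) * inverse (\<alpha> i) ^ Suc j) summable_on UNIV"
          by (rule norm_summable_imp_summable_on)
        hence "((\<lambda>j. of_int (s (int j)) * inverse (\<alpha> i) ^ Suc j) has_sum (c (\<alpha> i) * D i)) UNIV"
          using D_nonzero[of i] i p_le_d by (simp add: c_def D_def has_sum_infsum)
        hence "((\<lambda>j. of_int (s (int j)) * inverse (\<alpha> i) ^ Suc j * (\<alpha> i ^ n / D i)) has_sum (c (\<alpha> i) * D i * (\<alpha> i ^ n / D i))) UNIV"
          by (rule has_sum_cmult_left)
        moreover have "of_int (s (int j)) * inverse (\<alpha> i) ^ Suc j * (\<alpha> i ^ n / D i) = of_int (s (int j)) * (\<alpha> i powi (int n - int j - 1) / D i)" for j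
        proof -
          have "\<alpha> i powi (int n - int (Suc j)) = \<alpha> i ^ n / \<alpha> i ^ Suc j"
            using power_int_diff[OF disjI1[OF a(2)], of "int n" "int (Suc j)"] by (simp only: power_int_of_nat)
          hence "\<alpha> i powi (int n - int j - 1) = \<alpha> i ^ n * inverse (\<alpha> i) ^ Suc j"
            by (simp add: divide_inverse power_inverse diff_diff_eq add.commute del: power_Suc)
          thus ?thesis by simp
        qed
        moreover have "c (\<alpha> i) * D i * (\<alpha> i ^ n / D i) = c (\<alpha> i) * \<alpha> i ^ n"
          using D_nonzero[of i] i p_le_d by simp
        ultimately show "((\<lambda>j. of_int (s (int j)) * (\<alpha> i powi (int n - int j - 1) / D i)) has_sum c (\<alpha> i) * \<alpha> i ^ n) UNIV"
          by (simp only:)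
      qed
      thus ?thesis by (simp add: sum_distrib_left)
    qed
    define Y where "Y = (\<Sum>\<^sub>\<infinity>m. rhoR m * of_int (s (int n - m)))"
    have hY: "((\<lambda>j. of_int (s (int j)) * rhoC (int n - int j)) has_sum of_real Y) UNIV"
    proof -
      have "(\<lambda>m. rhoR m * of_int (s (int n - m))) summable_on UNIV"
        by (rule summable_on_mult_bounded[OF rhoR_summable, of _ "of_int B"]) (use B in \<open>simp flip: of_int_abs\<close>)
      hence "((\<lambda>m. rhoR m * of_int (s (int n - m))) has_sum Y) UNIV" by (simp add: Y_def)
      hence "((\<lambda>m. complex_of_real (rhoR m * of_int (s (int n - m)))) has_sum of_real Y) UNIV"
        by (simp only: has_sum_of_real_iff)
      moreover have "((\<lambda>m. complex_of_real (rhoR m * of_int (s (int n - m)))) has_sum of_real Y) UNIV \<longleftrightarrow>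
         ((\<lambda>m. complex_of_real (rhoR m * of_int (s (int n - m)))) has_sum of_real Y) {..int n}"
        by (rule has_sum_cong_neutral) (auto simp: s0)
      moreover have "bij_betw (\<lambda>j. int n - int j) UNIV {..int n}"
        by (rule bij_betw_byWitness[of _ "\<lambda>m. nat (int n - m)"]) auto
      ultimately have "((\<lambda>j. complex_of_real (rhoR (int n - int j) * of_int (s (int n - (int n - int j))))) has_sum of_real Y) UNIV"
        using has_sum_reindex_bij_betw[of "\<lambda>j. int n - int j" UNIV "{..int n}" "\<lambda>m. complex_of_real (rhoR m * of_int (s (int n - m)))"] by blast
      thus ?thesis by (simp add: rhoC_eq mult.commute)
    qed
    have "((\<lambda>j. of_int (s (int j)) * (\<Sum>i=1..p. \<alpha> i powi (int n - int j - 1) / D i) +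
        - (of_int (s (int j)) * rhoC (int n - int j))) has_sum (X + - of_real Y)) UNIV"
      using hX hY by (intro has_sum_add) (simp_all only: has_sum_uminus minus_minus)
    moreover have "((\<lambda>j. of_int (s (int j)) * (\<Sum>i=1..p. \<alpha> i powi (int n - int j - 1) / D i) +
        - (of_int (s (int j)) * rhoC (int n - int j))) has_sum (\<Sum>j<n. of_int (s (int j)) * h (n - Suc j))) UNIV"
    proof (rule has_sum_finite_neutralI[of "{..<n}"])
      show "(\<Sum>j<n. of_int (s (int j)) * h (n - Suc j)) = (\<Sum>j<n. of_int (s (int j)) * (\<Sum>i=1..p. \<alpha> i powi (int n - int j - 1) / D i) +
        - (of_int (s (int j)) * rhoC (int n - int j)))"
      proof (rule sum.cong)
        fix j assume "j \<in> {..<n}"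
        hence j: "int n - int j - 1 = int (n - Suc j)" "\<not> int n - int j \<le> 0" by auto
        have "h (n - Suc j) = (\<Sum>i=1..p. \<alpha> i powi (int n - int j - 1) / D i) - rhoC (int n - int j)"
          unfolding h_def sum_split rhoC_def if_not_P[OF j(2)] j(1) power_int_of_nat by simp
        thus "of_int (s (int j)) * h (n - Suc j) = of_int (s (int j)) * (\<Sum>i=1..p. \<alpha> i powi (int n - int j - 1) / D i) +
          - (of_int (s (int j)) * rhoC (int n - int j))" by (simp add: right_diff_distrib)
      qed simp
      fix j assume "j \<in> UNIV - {..<n}"
      hence j: "int n - int j \<le> 0" by auto
      show "of_int (s (int j)) * (\<Sum>i=1..p. \<alpha> i powi (int n - int j - 1) / D i) +
        - (of_int (s (int j)) * rhoC (int n - int j)) = 0"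
        unfolding rhoC_def if_P[OF j] by simp
    qed auto
    ultimately have "X + - of_real Y = (\<Sum>j<n. of_int (s (int j)) * h (n - Suc j))" by (rule has_sum_unique)
    also have "\<dots> = of_real (of_int (\<Sum>j<n. s (int j) * H (n - Suc j)))" by (simp add: h_eq)
    finally have "Re (X + - of_real Y) = of_int (\<Sum>j<n. s (int j) * H (n - Suc j))" by (simp only: Re_complex_of_real)
    moreover have "x_seq p \<alpha> g (int n) = Re X" unfolding X_def by (rule x_seq_constants) (simp add: g_def)
    ultimately have "x_seq p \<alpha> g (int n) - conv rhoR s (int n) = of_int (\<Sum>j<n. s (int j) * H (n - Suc j))"
      by (simp add: conv_def Y_def)
    thus ?thesis by (simp only: Ints_of_int)
  qed
  thus ?thesis using g by blast
qed

lemma peak_value_in_spectrum: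
  assumes "peak_value rhoR M \<tau>" and "M * (\<Sum>\<^sub>\<infinity>m. \<bar>rhoR m\<bar>) \<le> \<tau>"
  shows "\<tau> \<in> spectrum_L r1 r2 \<alpha> 0"
proof -
  obtain s B where s: "\<And>j. \<bar>s j\<bar> \<le> B" "\<And>j. j < 0 \<Longrightarrow> s j = 0"
    "limsup (\<lambda>n. ereal (dist_nearest_int (conv rhoR s (int n)))) = ereal \<tau>"
    by (rule lacunary_limsup[OF rhoR_summable assms]) (rule that)
  obtain g where g: "g \<in> Xi r1 r2 0" "\<And>n. x_seq p \<alpha> g (int n) - conv rhoR s (int n) \<in> \<int>"
    using realization[of s B] s(1,2) by blast
  have "dist_nearest_int (x_seq p \<alpha> g (int n)) = dist_nearest_int (conv rhoR s (int n))" for n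
    by (rule dist_nearest_int_diff_Ints[OF g(2)])
  thus ?thesis unfolding spectrum_L_def using g(1) s(3) by (intro CollectI bexI[of _ g]) simp_all
qed

lemma neighbourhood_right:
  assumes i0: "i0 \<in> {1..p}" and dom: "\<And>i. i \<in> {1..p} \<Longrightarrow> i \<noteq> i0 \<Longrightarrow> norm (\<alpha> i0) < norm (\<alpha> i)"
    and M: "norm (\<alpha> i0) - 1 < 2 * real M \<or> norm (\<alpha> i0) - 1 \<le> 2 * real M \<and> p < d"
    and small: "M * (\<Sum>\<^sub>\<infinity>m. norm (rhoC m)) < 1/2"
  shows "\<exists>v<1/2. {v..1/2} \<subseteq> spectrum_L r1 r2 \<alpha> 0"
proof -
  define \<beta> where "\<beta> = norm (\<alpha> i0)"
  have \<beta>: "\<beta> > 1" using norm_expanding[OF i0] by (simp add: \<beta>_def)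
  obtain \<theta> where \<theta>: "(\<lambda>j. rhoR (- int (Suc j)) / rhoR (- int j)) \<longlonglongrightarrow> \<theta>" "\<bar>\<theta>\<bar> = 1 / \<beta>"
    using ratio_right[OF i0 dom] unfolding \<beta>_def by blast
  have "1 - \<bar>\<theta>\<bar> = (\<beta> - 1) / \<beta>" "2 * real M * \<bar>\<theta>\<bar> = 2 * real M / \<beta>"
    using \<beta> by (simp_all add: \<theta>(2) diff_divide_distrib)
  hence "1 - \<bar>\<theta>\<bar> < 2 * real M * \<bar>\<theta>\<bar> \<longleftrightarrow> \<beta> - 1 < 2 * real M" "1 - \<bar>\<theta>\<bar> \<le> 2 * real M * \<bar>\<theta>\<bar> \<longleftrightarrow> \<beta> - 1 \<le> 2 * real M"
    using \<beta> by (simp_all only: divide_strict_right_mono divide_less_cancel divide_le_cancel) auto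
  hence cover: "1 - \<bar>\<theta>\<bar> < 2 * real M * \<bar>\<theta>\<bar> \<or> 1 - \<bar>\<theta>\<bar> \<le> 2 * real M * \<bar>\<theta>\<bar> \<and> left_regular rhoR"
    using M left_regular_rhoR unfolding \<beta>_def by blast
  have t: "0 < \<bar>\<theta>\<bar>" "\<bar>\<theta>\<bar> < 1" using \<beta> by (simp_all add: \<theta>(2))
  interpret dominated_kernel rhoR \<theta> M
    by unfold_locales (fact rhoR_summable \<theta>(1) t cover)+
  obtain v where v: "v < 1/2" "M * (\<Sum>\<^sub>\<infinity>m. \<bar>rhoR m\<bar>) \<le> v" "\<forall>\<tau>. v \<le> \<tau> \<and> \<tau> \<le> 1/2 \<longrightarrow> peak_value rhoR M \<tau>"
    by (rule half_neighbourhood_peaks[OF small[unfolded norm_rhoC]])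
  have "\<tau> \<in> spectrum_L r1 r2 \<alpha> 0" if "\<tau> \<in> {v..1/2}" for \<tau>
    by (rule peak_value_in_spectrum[of M]) (use that v(2,3) in \<open>simp_all add: order_trans[OF v(2)]\<close>)
  thus ?thesis using v(1) by blast
qed

text \<open>
  The roles of expanding and contracting roots are exchanged by reflecting the kernel, and distances are unaffected by
  reflecting the digits as well.
\<close>

lemma neighbourhood_left:
  assumes i0: "i0 \<in> {p+1..d}" and dom: "\<And>i. i \<in> {p+1..d} \<Longrightarrow> i \<noteq> i0 \<Longrightarrow> norm (\<alpha> i) < norm (\<alpha> i0)"
    and M: "inverse (norm (\<alpha> i0)) - 1 \<le> 2 * real M"
    and small: "M * (\<Sum>\<^sub>\<infinity>m. norm (rhoC m)) < 1/2"
  shows "\<exists>v<1/2. {v..1/2} \<subseteq> spectrum_L r1 r2 \<alpha> 0"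
proof -
  obtain \<theta> where \<theta>: "(\<lambda>j. rhoR (- (- int (Suc j))) / rhoR (- (- int j))) \<longlonglongrightarrow> \<theta>" "\<bar>\<theta>\<bar> = norm (\<alpha> i0)"
    using ratio_left[OF i0 dom] by blast
  have t: "0 < \<bar>\<theta>\<bar>" "\<bar>\<theta>\<bar> < 1" using norm_contracting[OF i0] root_nonzero[of i0] i0 by (auto simp: \<theta>(2))
  have "1 - \<bar>\<theta>\<bar> \<le> 2 * real M * \<bar>\<theta>\<bar>" using M t unfolding \<theta>(2)[symmetric] by (simp add: field_simps)
  hence cover: "1 - \<bar>\<theta>\<bar> < 2 * real M * \<bar>\<theta>\<bar> \<or> 1 - \<bar>\<theta>\<bar> \<le> 2 * real M * \<bar>\<theta>\<bar> \<and> left_regular (\<lambda>n. rhoR (- n))"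
    using left_regular_rhoR_reflect by blast
  interpret dominated_kernel "\<lambda>n. rhoR (- n)" \<theta> M
    by unfold_locales (fact rhoR_reflect_summable \<theta>(1) t cover)+
  obtain v where v: "v < 1/2" "M * (\<Sum>\<^sub>\<infinity>m. \<bar>rhoR (- m)\<bar>) \<le> v"
    "\<forall>\<tau>. v \<le> \<tau> \<and> \<tau> \<le> 1/2 \<longrightarrow> peak_value (\<lambda>n. rhoR (- n)) M \<tau>"
    by (rule half_neighbourhood_peaks[OF small[unfolded norm_rhoC, folded rhoR_reflect_infsum]])
  have "\<tau> \<in> spectrum_L r1 r2 \<alpha> 0" if "\<tau> \<in> {v..1/2}" for \<tau>
    by (rule peak_value_in_spectrum[of M])
       (use that v(3) in \<open>simp_all add: peak_value_reflect order_trans[OF v(2)[unfolded rhoR_reflect_infsum]]\<close>)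
  thus ?thesis using v(1) by blast
qed

end

section \<open>Polynomials without contracting roots\<close>

text \<open>
  The polynomial \<open>q\<close> evaluated at the shift operator.
\<close>

definition shift_op :: "complex poly \<Rightarrow> (int \<Rightarrow> complex) \<Rightarrow> int \<Rightarrow> complex" where
  "shift_op q u n = (\<Sum>k\<le>degree q. coeff q k * u (n + int k))"

lemma shift_op_linear_factor: "shift_op ([:- a, 1:] * q) u n = shift_op q u (n + 1) - a * shift_op q u n"
proof (cases "q = 0")
  case False
  hence "degree ([:- a, 1:] * q) = Suc (degree q)" by (subst degree_mult_eq) auto
  hence "shift_op ([:- a, 1:] * q) u n =
     (\<Sum>k\<le>Suc (degree q). coeff (pCons 0 q) k * u (n + int k)) - a * (\<Sum>k\<le>Suc (degree q). coeff q k * u (n + int k))"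
    by (simp add: shift_op_def algebra_simps sum_distrib_left sum.distrib sum_subtractf)
  moreover have "(\<Sum>k\<le>Suc (degree q). coeff q k * u (n + int k)) = shift_op q u n"
    by (simp add: shift_op_def coeff_eq_0)
  moreover have "(\<Sum>k\<le>Suc (degree q). coeff (pCons 0 q) k * u (n + int k)) = shift_op q u (n + 1)"
    by (subst sum.atMost_Suc_shift) (simp add: shift_op_def algebra_simps)
  ultimately show ?thesis by simp
qed (simp add: shift_op_def)

text \<open>
  The operator \<open>shift - a\<close> enlarges the norm of a summable sequence at least by the factor \<open>\<bar>a\<bar> - 1\<close>.
\<close>

lemma shift_op_norm_ge:
  fixes f :: "'a \<Rightarrow> complex" and u :: "int \<Rightarrow> complex"
  assumes "finite A" and u: "(\<lambda>n. norm (u n)) summable_on UNIV" and f: "\<And>i. i \<in> A \<Longrightarrow> norm (f i) \<ge> 1"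
  shows "(\<lambda>n. norm (shift_op (\<Prod>i\<in>A. [:- f i, 1:]) u n)) summable_on UNIV \<and>
    (\<Prod>i\<in>A. norm (f i) - 1) * (\<Sum>\<^sub>\<infinity>n. norm (u n)) \<le> (\<Sum>\<^sub>\<infinity>n. norm (shift_op (\<Prod>i\<in>A. [:- f i, 1:]) u n))"
  using assms(1,3)
proof (induction A rule: finite_induct)
  case empty
  have "shift_op 1 u n = u n" for n by (simp add: shift_op_def)
  thus ?case using u by simp
next
  case (insert a A)
  define w where "w = shift_op (\<Prod>i\<in>A. [:- f i, 1:]) u"
  have IH: "(\<lambda>n. norm (w n)) summable_on UNIV" "(\<Prod>i\<in>A. norm (f i) - 1) * (\<Sum>\<^sub>\<infinity>n. norm (u n)) \<le> (\<Sum>\<^sub>\<infinity>n. norm (w n))"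
    using insert unfolding w_def by auto
  have e: "shift_op (\<Prod>i\<in>insert a A. [:- f i, 1:]) u = (\<lambda>n. w (n + 1) - f a * w n)"
    unfolding prod.insert[OF insert.hyps] by (rule ext) (simp only: shift_op_linear_factor w_def)
  have b: "bij_betw (\<lambda>n::int. n + 1) UNIV UNIV" by (rule bij_betw_byWitness[of _ "\<lambda>n. n - 1"]) auto
  have s1: "(\<lambda>n. norm (w (n + 1))) summable_on UNIV"
    using summable_on_reindex_bij_betw[OF b, of "\<lambda>n. norm (w n)"] IH(1) by blast
  have i1: "(\<Sum>\<^sub>\<infinity>n. norm (w (n + 1))) = (\<Sum>\<^sub>\<infinity>n. norm (w n))"
    using infsum_reindex_bij_betw[OF b, of "\<lambda>n. norm (w n)"] by simp
  have s2: "(\<lambda>n. norm (f a) * norm (w n)) summable_on UNIV" using IH(1) by (rule summable_on_cmult_right)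
  have s: "(\<lambda>n. norm (w (n + 1) - f a * w n)) summable_on UNIV"
    by (rule summable_on_comparison_test[OF summable_on_add[OF s1 s2]])
       (auto intro: order_trans[OF norm_triangle_ineq4] simp: norm_mult)
  have "norm (f a) * (\<Sum>\<^sub>\<infinity>n. norm (w n)) = (\<Sum>\<^sub>\<infinity>n. norm (f a) * norm (w n))"
    by (simp add: infsum_cmult_right')
  also have "\<dots> \<le> (\<Sum>\<^sub>\<infinity>n. norm (w (n + 1)) + norm (w (n + 1) - f a * w n))"
  proof (rule infsum_mono[OF s2 summable_on_add[OF s1 s]])
    fix n show "norm (f a) * norm (w n) \<le> norm (w (n + 1)) + norm (w (n + 1) - f a * w n)"
      using norm_triangle_ineq4[of "w (n + 1)" "w (n + 1) - f a * w n"] by (simp add: norm_mult)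
  qed
  also have "\<dots> = (\<Sum>\<^sub>\<infinity>n. norm (w n)) + (\<Sum>\<^sub>\<infinity>n. norm (w (n + 1) - f a * w n))"
    by (simp add: infsum_add[OF s1 s] i1)
  finally have "(norm (f a) - 1) * (\<Sum>\<^sub>\<infinity>n. norm (w n)) \<le> (\<Sum>\<^sub>\<infinity>n. norm (w (n + 1) - f a * w n))"
    by (simp add: algebra_simps)
  moreover have "(norm (f a) - 1) * ((\<Prod>i\<in>A. norm (f i) - 1) * (\<Sum>\<^sub>\<infinity>n. norm (u n))) \<le> (norm (f a) - 1) * (\<Sum>\<^sub>\<infinity>n. norm (w n))"
    using IH(2) insert.prems by (intro mult_left_mono) auto
  ultimately show ?case unfolding e using s insert.hyps by (simp add: mult.assoc)
qed

context hyperbolic_roots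
begin

lemma rhoC_sum_expanding:
  assumes "p = d"
  shows "(\<Prod>i=1..d. norm (\<alpha> i) - 1) * (\<Sum>\<^sub>\<infinity>n. norm (rhoC n)) \<le> 1"
proof -
  have deg: "degree (cpoly P) = d" by (rule degree_map_poly) auto
  have op: "shift_op (cpoly P) rhoC n = (if n = 0 then -1 else 0)" for n
    using rhoC_recurrence[of n] by (simp add: shift_op_def deg coeff_map_poly)
  have "(\<Prod>i=1..d. norm (\<alpha> i) - 1) * (\<Sum>\<^sub>\<infinity>n. norm (rhoC n)) \<le> (\<Sum>\<^sub>\<infinity>n. norm (shift_op (cpoly P) rhoC n))"
    unfolding cpoly_eq
    using shift_op_norm_ge[OF _ rhoC_summable, of "{1..d}" \<alpha>] norm_expanding assms by (auto simp: less_imp_le)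
  also have "\<dots> = (\<Sum>\<^sub>\<infinity>n\<in>{0}. norm (shift_op (cpoly P) rhoC n))"
    by (rule infsum_cong_neutral) (auto simp: op)
  also have "\<dots> = 1" by (simp add: op)
  finally show ?thesis .
qed

lemma rhoC_sum_linear:
  assumes "d = 1"
  shows "(\<Sum>\<^sub>\<infinity>n. norm (rhoC n)) = 1 / (norm (\<alpha> 1) - 1)"
proof -
  have pd: "p = 1" using p_pos p_le_d assms by simp
  have a: "norm (\<alpha> 1) > 1" using norm_expanding[of 1] pd by simp
  have D1: "D (Suc 0) = 1" using D_prod[of 1] assms by simp
  have bij: "bij_betw (\<lambda>m. - int m) UNIV {..0}"
    by (rule bij_betw_byWitness[of _ "\<lambda>n. nat (- n)"]) auto
  have "(\<Sum>\<^sub>\<infinity>n. norm (rhoC n)) = (\<Sum>\<^sub>\<infinity>n\<in>{..0}. norm (rhoC n))"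
    by (rule infsum_cong_neutral) (use pd assms in \<open>auto simp: rhoC_def\<close>)
  also have "\<dots> = (\<Sum>\<^sub>\<infinity>m. norm (rhoC (- int m)))"
    using infsum_reindex_bij_betw[OF bij, of "\<lambda>n. norm (rhoC n)"] by simp
  also have "\<dots> = (\<Sum>\<^sub>\<infinity>m. 1 / norm (\<alpha> 1) * (1 / norm (\<alpha> 1)) ^ m)"
    by (rule infsum_cong) (simp add: rhoC_right pd D1 norm_mult norm_divide norm_power)
  also have "\<dots> = 1 / norm (\<alpha> 1) * (1 / (1 - 1 / norm (\<alpha> 1)))"
  proof -
    have "(\<lambda>m. 1 / norm (\<alpha> 1) * (1 / norm (\<alpha> 1)) ^ m) sums (1 / norm (\<alpha> 1) * (1 / (1 - 1 / norm (\<alpha> 1))))"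
    proof (intro sums_mult geometric_sums)
      show "norm (1 / norm (\<alpha> 1)) < 1" using a by (simp add: divide_less_eq)
    qed
    from sums_nonneg_imp_has_sum[OF this] show ?thesis by (auto intro!: infsumI)
  qed
  also have "\<dots> = 1 / (norm (\<alpha> 1) - 1)" using a by (auto simp: field_simps)
  finally show ?thesis .
qed

text \<open>
  The borderline \<open>\<beta> = 2 M + 1\<close> when all roots are expanding. There are at least two roots, as for a single one
  \<open>M\<close> times the norm of the kernel would equal 1/2. All factors \<open>\<bar>\<alpha> i\<bar> - 1\<close> are then at least \<open>2 M\<close>, so the norm of the
  kernel is less than \<open>1 / (4 M\<^sup>2)\<close>, and the digit bound can be raised to \<open>M + 1\<close>.
\<close>

lemma extra_digit_affordable:
  assumes pd: "p = d" and i0: "i0 \<in> {1..p}" and dom: "\<And>i. i \<in> {1..p} \<Longrightarrow> i \<noteq> i0 \<Longrightarrow> norm (\<alpha> i0) < norm (\<alpha> i)"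
    and M: "norm (\<alpha> i0) - 1 = 2 * real M" and small: "M * (\<Sum>\<^sub>\<infinity>m. norm (rhoC m)) < 1/2"
  shows "Suc M * (\<Sum>\<^sub>\<infinity>m. norm (rhoC m)) < 1/2"
proof -
  define S where "S = (\<Sum>\<^sub>\<infinity>m. norm (rhoC m))"
  have S0: "S \<ge> 0" unfolding S_def by (rule infsum_nonneg) auto
  have M1: "M \<ge> 1" using M norm_expanding[OF i0] by (cases M) auto
  have "d \<noteq> 1"
  proof
    assume "d = 1"
    hence "i0 = 1" using i0 pd by auto
    hence "S = 1 / (2 * M)" using rhoC_sum_linear[OF \<open>d = 1\<close>] M by (simp add: S_def)
    thus False using small M1 unfolding S_def[symmetric] by simp
  qed
  define i1 :: nat where "i1 = (if i0 = 1 then 2 else 1)"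
  have i1: "i1 \<in> {1..d} - {i0}" using \<open>d \<noteq> 1\<close> d_pos by (auto simp: i1_def)
  have big: "norm (\<alpha> i) - 1 > 2 * M" if "i \<in> {1..d} - {i0}" for i using dom[of i] that pd M by auto
  have "(\<Prod>i\<in>{1..d}-{i0}-{i1}. 1) \<le> (\<Prod>i\<in>{1..d}-{i0}-{i1}. norm (\<alpha> i) - 1)"
    by (rule prod_mono) (use big M1 in force)
  hence "(norm (\<alpha> i1) - 1) * 1 \<le> (norm (\<alpha> i1) - 1) * (\<Prod>i\<in>{1..d}-{i0}-{i1}. norm (\<alpha> i) - 1)"
    using big[OF i1] by (intro mult_left_mono) auto
  also have "\<dots> = (\<Prod>i\<in>{1..d}-{i0}. norm (\<alpha> i) - 1)"
    using i1 by (subst prod.remove[of "{1..d}-{i0}" i1]) auto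
  finally have "2 * real M < (\<Prod>i\<in>{1..d}-{i0}. norm (\<alpha> i) - 1)" using big[OF i1] by simp
  hence "2 * real M * (2 * real M) < 2 * real M * (\<Prod>i\<in>{1..d}-{i0}. norm (\<alpha> i) - 1)"
    using M1 by (intro mult_strict_left_mono) auto
  also have "\<dots> = (\<Prod>i=1..d. norm (\<alpha> i) - 1)"
    using i0 pd by (subst prod.remove[of "{1..d}" i0]) (auto simp: M)
  finally have prod: "4 * (real M * real M) < (\<Prod>i=1..d. norm (\<alpha> i) - 1)" by simp
  have MM: "real M + 1 \<le> 2 * (real M * real M)"
  proof -
    have "real M * 1 \<le> real M * real M" using M1 by (intro mult_left_mono) auto
    moreover have "1 * 1 \<le> real M * real M" using M1 by (intro mult_mono) auto
    ultimately have "real M * 1 + 1 * 1 \<le> real M * real M + real M * real M" by (rule add_mono)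
    thus ?thesis by simp
  qed
  show ?thesis
  proof (cases "S = 0")
    case False
    hence "4 * (real M * real M) * S < (\<Prod>i=1..d. norm (\<alpha> i) - 1) * S"
      using S0 prod by (intro mult_strict_right_mono) auto
    also have "\<dots> \<le> 1" using rhoC_sum_expanding[OF pd] by (simp add: S_def)
    finally have "4 * (real M * real M) * S < 1" .
    moreover have "(real M + 1) * S \<le> 2 * (real M * real M) * S" using MM S0 by (intro mult_right_mono)
    ultimately show ?thesis unfolding S_def[symmetric] by (simp add: algebra_simps)
  qed (simp add: S_def)
qed

text \<open>
  The borderline case is reduced to the strict one by an additional digit if there is no contracting root, and is covered by
  left regularity if there is one.
\<close>

lemma spectrum_contains_neighbourhood_expanding:
  assumes i0: "i0 \<in> {1..p}" and dom: "\<And>i. i \<in> {1..p} \<Longrightarrow> i \<noteq> i0 \<Longrightarrow> norm (\<alpha> i0) < norm (\<alpha> i)"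
    and M: "norm (\<alpha> i0) - 1 \<le> 2 * real M" and small: "M * (\<Sum>\<^sub>\<infinity>m. norm (rhoC m)) < 1/2"
  shows "\<exists>v<1/2. {v..1/2} \<subseteq> spectrum_L r1 r2 \<alpha> 0"
proof (cases "p = d \<and> norm (\<alpha> i0) - 1 = 2 * real M")
  case True
  show ?thesis
    by (rule neighbourhood_right[OF i0 dom, where M = "Suc M"])
       (use True extra_digit_affordable[OF _ i0 dom _ small] in auto)
next
  case False
  show ?thesis
    by (rule neighbourhood_right[OF i0 dom _ small]) (use False M p_le_d in auto)
qed

section \<open>Neighbourhoods of one half in the spectrum\<close>

lemma beta1_props:
  shows beta1_le: "i \<in> {1..p} \<Longrightarrow> beta1 p \<alpha> \<le> norm (\<alpha> i)"
    and beta1_gt: "beta1 p \<alpha> > 1"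
proof -
  show "beta1 p \<alpha> \<le> norm (\<alpha> i)" if "i \<in> {1..p}" unfolding beta1_def using that by (intro Min_le) auto
  show "beta1 p \<alpha> > 1" unfolding beta1_def using p_pos norm_expanding by (subst Min_gr_iff) auto
qed

lemma beta2_props:
  assumes "p < d"
  obtains b where "beta2 p d \<alpha> = ereal b" "b > 1" "\<And>i. i \<in> {p+1..d} \<Longrightarrow> b \<le> inverse (norm (\<alpha> i))"
proof -
  define b where "b = Min ((\<lambda>i. inverse (norm (\<alpha> i))) ` {p + 1..d})"
  have "b > 1" unfolding b_def using assms norm_contracting root_nonzero
    by (subst Min_gr_iff) (auto simp: one_less_inverse_iff)
  moreover have "b \<le> inverse (norm (\<alpha> i))" if "i \<in> {p+1..d}" for i
    unfolding b_def using that by (intro Min_le) auto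
  moreover have "beta2 p d \<alpha> = ereal b" using assms by (simp add: beta2_def b_def)
  ultimately show ?thesis using that by blast
qed

text \<open>
  Stated for any \<open>x \<ge> \<beta>\<^sub>1\<close> in the digit bound, so that it serves both for the smaller and for the larger of
  \<open>\<beta>\<^sub>1\<close> and \<open>\<beta>\<^sub>2\<close>.
\<close>

lemma neighbourhood_beta1:
  assumes ex: "\<exists>!i. i \<in> {1..p} \<and> norm (\<alpha> i) = beta1 p \<alpha>" and N: "beta1 p \<alpha> \<le> x"
    and r: "1 < r" "r < beta1 p \<alpha>" and small: "of_int \<lceil>(x - 1) / 2\<rceil> * (\<Sum>\<^sub>\<infinity>n. norm (rho P r n)) < 1/2"
  shows "\<exists>v<1/2. {v..1/2} \<subseteq> spectrum_L r1 r2 \<alpha> 0"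
proof -
  obtain i0 where i0: "i0 \<in> {1..p}" "norm (\<alpha> i0) = beta1 p \<alpha>"
    "\<And>i. i \<in> {1..p} \<Longrightarrow> norm (\<alpha> i) = beta1 p \<alpha> \<Longrightarrow> i = i0" using ex by blast
  have dom: "norm (\<alpha> i0) < norm (\<alpha> i)" if "i \<in> {1..p}" "i \<noteq> i0" for i
    using beta1_le[OF that(1)] i0(2) i0(3)[OF that(1)] that(2) by force
  have rho: "rho P r n = rhoC n" for n
    by (rule rho_eq) (use r beta1_le in force)+
  define M where "M = nat \<lceil>(x - 1) / 2\<rceil>"
  have x: "x > 1" using N beta1_gt by simp
  hence M: "real M = of_int \<lceil>(x - 1) / 2\<rceil>" by (simp add: M_def)
  show ?thesis
  proof (rule spectrum_contains_neighbourhood_expanding[OF i0(1) dom])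
    show "norm (\<alpha> i0) - 1 \<le> 2 * real M"
    proof -
      define k where "k = real_of_int \<lceil>(x - 1) / 2\<rceil>"
      have "(x - 1) / 2 \<le> k" unfolding k_def by (rule le_of_int_ceiling)
      hence "x - 1 \<le> 2 * k" by simp
      thus ?thesis unfolding M i0(2) k_def[symmetric] using N by simp
    qed
    show "real M * (\<Sum>\<^sub>\<infinity>m. norm (rhoC m)) < 1/2" using small unfolding M rho .
  qed
qed

lemma neighbourhood_beta2:
  assumes ex: "\<exists>!i. i \<in> {p+1..d} \<and> ereal (inverse (norm (\<alpha> i))) = beta2 p d \<alpha>"
    and r: "1 < r" "r < beta1 p \<alpha>"
    and small: "of_int \<lceil>(real_of_ereal (beta2 p d \<alpha>) - 1) / 2\<rceil> * (\<Sum>\<^sub>\<infinity>n. norm (rho P r n)) < 1/2"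
  shows "\<exists>v<1/2. {v..1/2} \<subseteq> spectrum_L r1 r2 \<alpha> 0"
proof -
  have "p < d" using ex by force
  then obtain b where b: "beta2 p d \<alpha> = ereal b" "b > 1" "\<And>i. i \<in> {p+1..d} \<Longrightarrow> b \<le> inverse (norm (\<alpha> i))"
    using beta2_props by blast
  have "\<exists>!i. i \<in> {p+1..d} \<and> inverse (norm (\<alpha> i)) = b" using ex unfolding b(1) ereal.inject .
  then obtain i0 where i0: "i0 \<in> {p+1..d}" "inverse (norm (\<alpha> i0)) = b"
    "\<And>i. i \<in> {p+1..d} \<Longrightarrow> inverse (norm (\<alpha> i)) = b \<Longrightarrow> i = i0" by blast
  have dom: "norm (\<alpha> i) < norm (\<alpha> i0)" if "i \<in> {p+1..d}" "i \<noteq> i0" for i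
  proof -
    have "inverse (norm (\<alpha> i0)) < inverse (norm (\<alpha> i))"
    proof -
      have "inverse (norm (\<alpha> i)) \<noteq> b" using i0(3)[OF that(1)] that(2) by blast
      with b(3)[OF that(1)] i0(2) show ?thesis by (simp add: less_le)
    qed
    moreover have "norm (\<alpha> i) > 0" "norm (\<alpha> i0) > 0" using root_nonzero that(1) i0(1) by auto
    ultimately show ?thesis by (simp add: inverse_less_iff_less)
  qed
  have rho: "rho P r n = rhoC n" for n
    by (rule rho_eq) (use r beta1_le in force)+
  define M where "M = nat \<lceil>(b - 1) / 2\<rceil>"
  have M: "real M = of_int \<lceil>(b - 1) / 2\<rceil>" using b(2) by (simp add: M_def)
  show ?thesis
  proof (rule neighbourhood_left[OF i0(1) dom])
    show "inverse (norm (\<alpha> i0)) - 1 \<le> 2 * real M"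
    proof -
      define k where "k = real_of_int \<lceil>(b - 1) / 2\<rceil>"
      have "(b - 1) / 2 \<le> k" unfolding k_def by (rule le_of_int_ceiling)
      hence "b - 1 \<le> 2 * k" by simp
      thus ?thesis unfolding M i0(2) k_def[symmetric] by simp
    qed
    show "real M * (\<Sum>\<^sub>\<infinity>m. norm (rhoC m)) < 1/2" using small unfolding M rho b(1) by simp
  qed
qed

end

lemma shrinking_intervals:
  fixes A :: "real set"
  assumes "v < 1/2" "{v..1/2} \<subseteq> A"
  shows "\<exists>c e :: nat \<Rightarrow> real. (\<forall>i. c i < e i \<and> {c i..e i} \<subseteq> A) \<and> c \<longlonglongrightarrow> 1/2"
proof (intro exI conjI allI)
  define c where "c i = 1/2 - (1/2 - v) / real (Suc i)" for i
  show "c i < 1/2" for i using assms(1) by (simp add: c_def)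
  have "v \<le> c i" for i
  proof -
    have "(1/2 - v) / real (Suc i) \<le> (1/2 - v) / 1"
      using assms(1) by (intro divide_left_mono) auto
    thus ?thesis unfolding c_def by simp
  qed
  thus "{c i..1/2} \<subseteq> A" for i
    using assms(2) by (meson atLeastatMost_subset_iff order_refl subset_trans)
  have "(\<lambda>i. (1/2 - v) * (1 / real (Suc i))) \<longlonglongrightarrow> (1/2 - v) * 0"
    using LIMSEQ_Suc[OF lim_1_over_n] by (intro tendsto_mult tendsto_const) simp
  hence "c \<longlonglongrightarrow> 1/2 - (1/2 - v) * 0" unfolding c_def by (intro tendsto_diff tendsto_const) simp
  thus "c \<longlonglongrightarrow> 1/2" by simp
qed

theorem theorem4:
  fixes P :: "int poly" and d p r1 r2 :: nat and \<alpha> :: "nat \<Rightarrow> complex"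
    and \<beta>1 :: real and \<beta>2 \<beta> \<beta>' :: ereal
  assumes "admissible_poly P"
    and "d = degree P" and "p = r1 + 2 * r2"
    and "root_ordering P r1 r2 \<alpha>"
    and "lead_coeff P = 1"
    and "hyperbolic_poly P"
    and "\<beta>1 = beta1 p \<alpha>" and "\<beta>2 = beta2 p d \<alpha>"
    and "\<beta> = min (ereal \<beta>1) \<beta>2" and "\<beta>' = max (ereal \<beta>1) \<beta>2"
  shows
    "(\<forall>k. (1/2) islimpt spectrum_L r1 r2 \<alpha> k) \<and>
     (\<forall>r. 1 < r \<and> r < \<beta>1 \<and>
        ((ereal \<beta>1 = \<beta> \<and> (\<exists>!i. i \<in> {1..p} \<and> norm (\<alpha> i) = \<beta>1)) \<or>
         (\<beta>2 = \<beta> \<and> (\<exists>!i. i \<in> {p + 1..d} \<and> ereal (inverse (norm (\<alpha> i))) = \<beta>2))) \<and>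
        of_int \<lceil>(real_of_ereal \<beta> - 1) / 2\<rceil> * (\<Sum>\<^sub>\<infinity>n\<in>UNIV. norm (rho P r n)) < 1/2 \<longrightarrow>
        (\<exists>c e :: nat \<Rightarrow> real.
           (\<forall>i. c i < e i \<and> {c i..e i} \<subseteq> spectrum_L r1 r2 \<alpha> 0) \<and> c \<longlonglongrightarrow> 1/2)) \<and>
     (\<forall>r. 1 < r \<and> r < \<beta>1 \<and>
        (\<exists>!i. i \<in> {1..p} \<and> norm (\<alpha> i) = \<beta>1) \<and>
        (\<exists>!i. i \<in> {p + 1..d} \<and> ereal (inverse (norm (\<alpha> i))) = \<beta>2) \<and>
        of_int \<lceil>(real_of_ereal \<beta>' - 1) / 2\<rceil> * (\<Sum>\<^sub>\<infinity>n\<in>UNIV. norm (rho P r n)) < 1/2 \<longrightarrow>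
        (\<exists>v<1/2. {v..1/2} \<subseteq> spectrum_L r1 r2 \<alpha> 0))"
proof -
  interpret hyperbolic_roots P r1 r2 \<alpha>
    by unfold_locales (use assms in auto)
  note defs = assms(2,3,7,8)
  show ?thesis
  proof (intro conjI allI impI)
    show "(1/2) islimpt spectrum_L r1 r2 \<alpha> k" for k by (rule half_islimpt_spectrum)
  next
    fix r assume A: "1 < r \<and> r < \<beta>1 \<and>
        ((ereal \<beta>1 = \<beta> \<and> (\<exists>!i. i \<in> {1..p} \<and> norm (\<alpha> i) = \<beta>1)) \<or>
         (\<beta>2 = \<beta> \<and> (\<exists>!i. i \<in> {p + 1..d} \<and> ereal (inverse (norm (\<alpha> i))) = \<beta>2))) \<and>
        of_int \<lceil>(real_of_ereal \<beta> - 1) / 2\<rceil> * (\<Sum>\<^sub>\<infinity>n\<in>UNIV. norm (rho P r n)) < 1/2"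
    hence "\<exists>v<1/2. {v..1/2} \<subseteq> spectrum_L r1 r2 \<alpha> 0"
    proof (elim conjE disjE)
      assume *: "1 < r" "r < \<beta>1" "ereal \<beta>1 = \<beta>" "\<exists>!i. i \<in> {1..p} \<and> norm (\<alpha> i) = \<beta>1"
        "of_int \<lceil>(real_of_ereal \<beta> - 1) / 2\<rceil> * (\<Sum>\<^sub>\<infinity>n\<in>UNIV. norm (rho P r n)) < 1/2"
      have "real_of_ereal \<beta> = \<beta>1" by (simp flip: *(3))
      thus ?thesis using neighbourhood_beta1[of \<beta>1 r] * unfolding defs by simp
    next
      assume *: "1 < r" "r < \<beta>1" "\<beta>2 = \<beta>" "\<exists>!i. i \<in> {p + 1..d} \<and> ereal (inverse (norm (\<alpha> i))) = \<beta>2"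
        "of_int \<lceil>(real_of_ereal \<beta> - 1) / 2\<rceil> * (\<Sum>\<^sub>\<infinity>n\<in>UNIV. norm (rho P r n)) < 1/2"
      show ?thesis
        by (rule neighbourhood_beta2[of r]) (use * in \<open>simp_all only: defs\<close>)
    qed
    thus "\<exists>c e :: nat \<Rightarrow> real. (\<forall>i. c i < e i \<and> {c i..e i} \<subseteq> spectrum_L r1 r2 \<alpha> 0) \<and> c \<longlonglongrightarrow> 1/2"
      using shrinking_intervals by blast
  next
    fix r assume A: "1 < r \<and> r < \<beta>1 \<and>
        (\<exists>!i. i \<in> {1..p} \<and> norm (\<alpha> i) = \<beta>1) \<and>
        (\<exists>!i. i \<in> {p + 1..d} \<and> ereal (inverse (norm (\<alpha> i))) = \<beta>2) \<and>
        of_int \<lceil>(real_of_ereal \<beta>' - 1) / 2\<rceil> * (\<Sum>\<^sub>\<infinity>n\<in>UNIV. norm (rho P r n)) < 1/2"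
    hence "r1 + 2 * r2 < degree P" unfolding defs by force
    then obtain b where b: "\<beta>2 = ereal b" using beta2_props unfolding defs by blast
    have "real_of_ereal \<beta>' = max \<beta>1 b" by (simp add: assms(10) b max_def)
    hence "\<beta>1 \<le> real_of_ereal \<beta>'" by simp
    thus "\<exists>v<1/2. {v..1/2} \<subseteq> spectrum_L r1 r2 \<alpha> 0"
      using neighbourhood_beta1[of "real_of_ereal \<beta>'" r] A unfolding defs by blast
  qed
qed

end
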